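(* A sequence $S\in\mathbf{C}$ has algorithmic strong measure zero if and only if $S\in\mathrm{NCR}$.
   Context: $\mathbf{C}=\{0,1\}^\infty$; $S[0\dots n]$ is the string of the first $n+1$ bits of $S$. An odds function is $O:\{0,1\}^*\to[1,\infty)$; it is acceptable if $\prod_{w\sqsubset S}O(w)=\infty$ for every $S\in\mathbf{C}$. An $O$-supermartingale is $d:\{0,1\}^*\to[0,\infty)$ with $d(w)\ge d(w0)/O(w0)+d(w1)/O(w1)$ for all $w$; it succeeds on $S$ if $\limsup_n d(S[0\dots n])=\infty$. $S$ has algorithmic strong measure zero if there is an oracle Turing machine $M$ such that for every acceptable odds function $O:\{0,1\}^*\to\mathbb{Q}\cap[1,2]$, with oracle $O$, $M$ computes a function $g:\mathbb{N}\times\{0,1\}^*\to\mathbb{Q}\cap[0,\infty)$ nondecreasing in the first argument whose limit $F(O)(x)=\lim_r g(r,x)$ is an $O$-supermartingale succeeding on $S$ (i.e. $F(O)$ is lower semicomputable uniformly in $O$). NCR (Reimann–Slaman) is the set of sequences never continuously random: for a probability measure $\mu$ on $\mathbf{C}$ with a representation $r_\mu$, a Martin-Löf $\mu$-test relative to $r_\mu$ is a sequence $(W_n)$ of uniformly $\Sigma^0_1(r_\mu)$ classes with $\mu(W_n)\le 2^{-n}$; $X$ is $\mu$-random if for some representation $r_\mu$ of $\mu$, $X\notin\bigcap_n W_n$ for every such test; $X\in\mathrm{NCR}$ iff $X$ is not $\mu$-random for any continuous (atomless) probability measure $\mu$ on $\mathbf{C}$. *)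

theory Defs
  imports "HOL-Probability.Probability" "HOL-Library.Nat_Bijection"
begin

section \<open>Oracle computation\<close>

text \<open>
  Oracle machines are given as programs for Kleene's schemes of partial recursive functions,
  extended by a query to the oracle \<open>A :: nat \<Rightarrow> nat\<close>. The program itself does not depend on the
  oracle, so a single program is a computation uniform in all oracles.
  \<open>computes A p xs y\<close> means that \<open>p\<close> with oracle \<open>A\<close> halts on input \<open>xs\<close> with output \<open>y\<close>.
\<close>

datatype oracle_program =
    Zero
  | Succ
  | Proj nat
  | Query
  | Comp oracle_program "oracle_program list"
  | PrimRec oracle_program oracle_program
  | Minimize oracle_program

inductive computes :: "(nat \<Rightarrow> nat) \<Rightarrow> oracle_program \<Rightarrow> nat list \<Rightarrow> nat \<Rightarrow> bool"
  for A :: "nat \<Rightarrow> nat"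
where
  zero: "computes A Zero xs 0"
| succ: "computes A Succ [x] (Suc x)"
| proj: "i < length xs \<Longrightarrow> computes A (Proj i) xs (xs ! i)"
| query: "computes A Query [x] (A x)"
| comp: "list_all2 (\<lambda>q y. computes A q xs y) qs ys \<Longrightarrow> computes A p ys z
    \<Longrightarrow> computes A (Comp p qs) xs z"
| primrec_0: "computes A p xs y \<Longrightarrow> computes A (PrimRec p q) (0 # xs) y"
| primrec_Suc: "computes A (PrimRec p q) (n # xs) y \<Longrightarrow> computes A q (n # y # xs) z
    \<Longrightarrow> computes A (PrimRec p q) (Suc n # xs) z"
| minimize: "computes A p (n # xs) 0
    \<Longrightarrow> (\<And>m. m < n \<Longrightarrow> computes A p (m # xs) (Suc (h m)))
    \<Longrightarrow> computes A (Minimize p) xs n"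

lemma computes_deterministic:
  assumes "computes A p xs y" and "computes A p xs z"
  shows "y = z"
  using assms
proof (induction arbitrary: z rule: computes.induct)
  case (comp xs qs ys p y)
  from comp.prems show ?case
  proof cases
    case c: (comp ys')
    have "ys = ys'"
      using comp.IH(1) c(1) by (auto simp: list_all2_conv_all_nth intro!: nth_equalityI)
    then show ?thesis using comp.IH(2) c(2) by blast
  qed
next
  case (minimize p n xs h)
  from minimize.prems show ?case
  proof cases
    case m: (minimize h')
    have "\<not> z < n" using minimize.IH(2) m(1) by blast
    moreover have "\<not> n < z" using minimize.IH(1) m(2) by blast
    ultimately show ?thesis by linarith
  qed
next
  case (primrec_Suc p q n xs y z')
  from primrec_Suc.prems show ?case
  proof cases
    case c: (primrec_Suc y')
    then show ?thesis using primrec_Suc.IH by blast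
  qed
next
  case (primrec_0 p xs y q)
  from primrec_0.prems show ?case
  proof cases
    case c: primrec_0
    then show ?thesis using primrec_0.IH by blast
  qed
qed (erule computes.cases; simp; fail)+


section \<open>Strings, rationals and their codes\<close>

text \<open>The bijective base-2 numeration of strings.\<close>

fun str_code :: "bool list \<Rightarrow> nat" where
  "str_code [] = 0"
| "str_code (b # w) = 2 * str_code w + (if b then 2 else 1)"

lemma bij_str_code: "bij str_code"
proof (rule bijI)
  show "inj str_code"
  proof (rule injI)
    fix v w show "str_code v = str_code w \<Longrightarrow> v = w"
    proof (induction v arbitrary: w)
      case Nil then show ?case by (cases w) (auto split: if_splits)
    next
      case (Cons b v)
      then obtain c u where w: "w = c # u" by (cases w) (auto split: if_splits)
      have "b = c \<and> str_code v = str_code u"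
        using Cons.prems unfolding w by (cases b; cases c; simp; presburger)
      then show ?case using Cons.IH w by blast
    qed
  qed
  have "\<exists>w. str_code w = n" for n
  proof (induction n rule: less_induct)
    case (less n)
    show ?case
    proof (cases "n = 0")
      case True then show ?thesis by (metis str_code.simps(1))
    next
      case False
      then have "(n - 1) div 2 < n" by linarith
      with less obtain w where w: "str_code w = (n - 1) div 2" by blast
      have "str_code (even n # w) = n"
        using w False by (cases "even n"; simp; presburger)
      then show ?thesis by blast
    qed
  qed
  then show "surj str_code" by (metis surjI)
qed

definition rat_code :: "rat \<Rightarrow> nat" where
  "rat_code q = (case quotient_of q of (a, b) \<Rightarrow> prod_encode (int_encode a, nat b))"

lemma inj_rat_code: "inj rat_code"
proof (rule injI)
  fix p q :: rat assume eq: "rat_code p = rat_code q"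
  obtain a b c d where ab: "quotient_of p = (a, b)" and cd: "quotient_of q = (c, d)"
    by (meson surj_pair)
  have "b > 0" "d > 0" using ab cd quotient_of_denom_pos by blast+
  then have "quotient_of p = quotient_of q"
    using eq ab cd by (simp add: rat_code_def eq_nat_nat_iff inj_eq[OF inj_int_encode])
  then show "p = q" by (rule quotient_of_inject)
qed

definition string_oracle :: "(bool list \<Rightarrow> rat) \<Rightarrow> nat \<Rightarrow> nat" where
  "string_oracle f n = rat_code (f (inv str_code n))"

definition initial_segment :: "(nat \<Rightarrow> bool) \<Rightarrow> nat \<Rightarrow> bool list" where
  "initial_segment S n = map S [0..<n]"

definition cylinder :: "bool list \<Rightarrow> (nat \<Rightarrow> bool) set" where
  "cylinder w = {X. initial_segment X (length w) = w}"


section \<open>Algorithmic strong measure zero\<close>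

definition odds_function :: "(bool list \<Rightarrow> real) \<Rightarrow> bool" where
  "odds_function b \<longleftrightarrow> (\<forall>w. 1 \<le> b w)"

definition acceptable :: "(bool list \<Rightarrow> real) \<Rightarrow> bool" where
  "acceptable b \<longleftrightarrow> odds_function b \<and>
     (\<forall>S. filterlim (\<lambda>n. \<Prod>k<n. b (initial_segment S k)) at_top sequentially)"

definition supermartingale :: "(bool list \<Rightarrow> real) \<Rightarrow> (bool list \<Rightarrow> real) \<Rightarrow> bool" where
  "supermartingale b d \<longleftrightarrow> (\<forall>w. 0 \<le> d w) \<and>
     (\<forall>w. d w \<ge> d (w @ [False]) / b (w @ [False]) + d (w @ [True]) / b (w @ [True]))"

definition succeeds_on :: "(bool list \<Rightarrow> real) \<Rightarrow> (nat \<Rightarrow> bool) \<Rightarrow> bool" where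
  "succeeds_on d S \<longleftrightarrow> limsup (\<lambda>n. ereal (d (initial_segment S (Suc n)))) = \<infinity>"

definition algorithmic_strong_measure_zero :: "(nat \<Rightarrow> bool) \<Rightarrow> bool" where
  "algorithmic_strong_measure_zero S \<longleftrightarrow>
     (\<exists>M. \<forall>b :: bool list \<Rightarrow> rat.
        (\<forall>w. b w \<in> {1..2}) \<and> acceptable (\<lambda>w. real_of_rat (b w)) \<longrightarrow>
        (\<exists>(g :: nat \<Rightarrow> bool list \<Rightarrow> rat) F.
           (\<forall>r x. computes (string_oracle b) M [r, str_code x] (rat_code (g r x))) \<and>
           (\<forall>r x. 0 \<le> g r x) \<and>
           (\<forall>x. mono (\<lambda>r. g r x)) \<and>
           (\<forall>x. (\<lambda>r. real_of_rat (g r x)) \<longlonglongrightarrow> F x) \<and>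
           supermartingale (\<lambda>w. real_of_rat (b w)) F \<and>
           succeeds_on F S))"


section \<open>Never continuously random sequences\<close>

text \<open>The topology on \<^typ>\<open>nat \<Rightarrow> bool\<close> is the product topology, so \<open>borel\<close> is the Borel
  sigma-algebra of Cantor space.\<close>

definition cantor_prob_measure :: "(nat \<Rightarrow> bool) measure \<Rightarrow> bool" where
  "cantor_prob_measure \<mu> \<longleftrightarrow> prob_space \<mu> \<and> sets \<mu> = sets borel"

definition continuous_measure :: "(nat \<Rightarrow> bool) measure \<Rightarrow> bool" where
  "continuous_measure \<mu> \<longleftrightarrow> (\<forall>X. measure \<mu> {X} = 0)"

text \<open>A representation of \<open>\<mu>\<close> is a name giving, for each string \<open>w\<close> and precision \<open>n\<close>, a rational
  within \<open>2\<^sup>-\<^sup>n\<close> of the measure of the cylinder of \<open>w\<close>. A measure has many representations.\<close>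

definition represents :: "(nat \<Rightarrow> nat) \<Rightarrow> (nat \<Rightarrow> bool) measure \<Rightarrow> bool" where
  "represents r \<mu> \<longleftrightarrow>
     (\<forall>w n. \<exists>q. r (prod_encode (str_code w, n)) = rat_code q \<and>
        \<bar>real_of_rat q - measure \<mu> (cylinder w)\<bar> \<le> 1 / 2 ^ n)"

text \<open>\<open>W\<close> is a sequence of uniformly \<open>\<Sigma>\<^sup>0\<^sub>1\<close> classes relative to \<open>r\<close>: the \<open>n\<close>-th class is the union
  of the cylinders of the strings \<open>w\<close> such that \<open>(n, w)\<close> lies in a fixed set that is recursively
  enumerable in \<open>r\<close>, i.e. the domain of a partial function computed with oracle \<open>r\<close>.\<close>

definition uniformly_Sigma01 ::
    "(nat \<Rightarrow> nat) \<Rightarrow> (nat \<Rightarrow> (nat \<Rightarrow> bool) set) \<Rightarrow> bool" where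
  "uniformly_Sigma01 r W \<longleftrightarrow>
     (\<exists>p. \<forall>n. W n = (\<Union>w\<in>{w. \<exists>y. computes r p [n, str_code w] y}. cylinder w))"

definition Martin_Loef_test ::
    "(nat \<Rightarrow> bool) measure \<Rightarrow> (nat \<Rightarrow> nat) \<Rightarrow> (nat \<Rightarrow> (nat \<Rightarrow> bool) set) \<Rightarrow> bool" where
  "Martin_Loef_test \<mu> r W \<longleftrightarrow>
     uniformly_Sigma01 r W \<and> (\<forall>n. measure \<mu> (W n) \<le> 1 / 2 ^ n)"

definition random_for :: "(nat \<Rightarrow> bool) measure \<Rightarrow> (nat \<Rightarrow> bool) \<Rightarrow> bool" where
  "random_for \<mu> X \<longleftrightarrow>
     (\<exists>r. represents r \<mu> \<and> (\<forall>W. Martin_Loef_test \<mu> r W \<longrightarrow> X \<notin> (\<Inter>n. W n)))"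

definition NCR :: "(nat \<Rightarrow> bool) set" where
  "NCR = {X. \<not> (\<exists>\<mu>. cantor_prob_measure \<mu> \<and> continuous_measure \<mu> \<and> random_for \<mu> X)}"

end

theory Submission
  imports Defs
begin

text \<open>
  Proof idea. Odds \<open>O\<close> define a capacity \<open>\<lambda>(w)\<close>, the product of the \<open>1 / O(u)\<close> over the nonempty
  prefixes \<open>u\<close> of \<open>w\<close>; multiplication by \<open>\<lambda>\<close> turns \<open>O\<close>-supermartingales \<open>d\<close> into superadditive
  masses. If \<open>S\<close> is random for a continuous measure \<open>\<mu>\<close> with name \<open>r\<close>, then \<open>r\<close> computes odds in
  \<open>{1, 2}\<close> whose capacity dominates \<open>\<mu>\<close>, and by Ville's inequality a semicomputable supermartingale
  succeeding on \<open>S\<close> would give a Martin-Loef test.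
  Conversely, since \<open>O \<le> 2\<close>, the capacity is subadditive, so that by max-flow min-cut the
  \<open>\<lambda>\<close>-weight of the cheapest cover of a clopen set is the largest measure of that set under
  probability measures \<open>\<mu> \<le> \<lambda>\<close>. The names of these \<open>\<mu>\<close> form an effectively compact class of
  continuous measures. If \<open>S\<close> is in NCR, then every such name has a test capturing \<open>S\<close>; by
  compactness the sequences captured by the universal tests of all these names form effectively
  open sets, whose minimal cuts are small and grow into a semicomputable mass. Summing over the
  levels of the test gives a supermartingale succeeding on \<open>S\<close>, by one machine for all \<open>O\<close>.
\<close>

section \<open>Computable functions of an environment\<close>

text \<open>Representations of measures branch infinitely, so they are not compact. Binary names
  are, and they suffice: a sequence in NCR fails against every representation of a continuous
  measure, in particular against the one computed from a binary name. Stage \<open>t\<close> of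
  every construction reads only the first \<open>t\<close> bits of a name. Quantifying over all
  names then becomes quantifying over the numbers below \<open>2 ^ t\<close>, and halting is
  replaced by bounded certificates, which are decidable. The capacity that is cut is the product of
  the \<open>1 / O(u)\<close> rounded up to a power of 1/2. Stage \<open>t\<close> is then exact
  integer arithmetic in units of \<open>1 / 2 ^ t\<close>, and the rounding costs nothing: where the
  mass equals the rounded capacity, its product with the odds is still at least 1. The value of a
  minimal cut may fail to be superadditive at a string that is itself the cut. The mass is therefore
  frozen below such strings, and this makes it both superadditive and nondecreasing in the stage.
  The machine never refers to \<open>S\<close>; membership in NCR is used only to show that it
  succeeds.\<close>

text \<open>A context consists of an arity and of the argument values that an environment of type \<open>'c\<close>
  supplies; \<open>push\<close> binds one more variable as the first argument. As environments are nested pairs,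
  computability of a lambda term is derived by rules following its syntax.\<close>

type_synonym 'c ctx = "nat \<times> ('c \<Rightarrow> nat \<Rightarrow> nat)"

definition ctx_args :: "'c ctx \<Rightarrow> 'c \<Rightarrow> nat list" where
  "ctx_args K c = map (snd K c) [0..<fst K]"

text \<open>One program serves all oracles in \<open>D\<close>. The restriction to \<open>D\<close>
  is there because some searches terminate only for certain oracles, for instance those that code
  odds functions.\<close>

definition rc :: "(nat \<Rightarrow> nat) set \<Rightarrow> 'c ctx \<Rightarrow> ((nat \<Rightarrow> nat) \<Rightarrow> 'c \<Rightarrow> nat) \<Rightarrow> bool" where
  "rc D K f \<longleftrightarrow> (\<exists>p. \<forall>A\<in>D. \<forall>c. computes A p (ctx_args K c) (f A c))"

definition decid :: "(nat \<Rightarrow> nat) set \<Rightarrow> 'c ctx \<Rightarrow> ((nat \<Rightarrow> nat) \<Rightarrow> 'c \<Rightarrow> bool) \<Rightarrow> bool" where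
  "decid D K P \<longleftrightarrow> rc D K (\<lambda>A c. of_bool (P A c))"

definition emp :: "unit ctx" where
  "emp = (0, \<lambda>_ _. 0)"

definition push :: "'c ctx \<Rightarrow> ('c \<times> nat) ctx" where
  "push K = (Suc (fst K), \<lambda>c i. case i of 0 \<Rightarrow> snd c | Suc j \<Rightarrow> snd K (fst c) j)"

lemma args_emp [simp]: "ctx_args emp c = []"
  by (simp add: ctx_args_def emp_def)

lemma args_push [simp]: "ctx_args (push K) c = snd c # ctx_args K (fst c)"
proof -
  have "[0..<Suc (fst K)] = 0 # map Suc [0..<fst K]"
    by (metis map_Suc_upt upt_conv_Cons zero_less_Suc)
  then show ?thesis by (simp only: ctx_args_def push_def fst_conv snd_conv) (simp add: comp_def)
qed

lemma length_args [simp]: "length (ctx_args K c) = fst K"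
  by (simp add: ctx_args_def)

named_theorems rc_intros

lemma computes_Comp1:
  "computes A q xs a \<Longrightarrow> computes A p [a] y \<Longrightarrow> computes A (Comp p [q]) xs y"
  by (rule computes.comp[where ys = "[a]"]) auto

lemma computes_Proj_map:
  assumes "k + n \<le> length xs"
  shows "list_all2 (\<lambda>q y. computes A q xs y) (map Proj [k..<k + n]) (take n (drop k xs))"
proof -
  have "computes A (Proj (k + i)) xs (xs ! (k + i))" if "i < n" for i
    using that assms by (intro computes.proj) simp
  then show ?thesis using assms by (simp add: list_all2_conv_all_nth)
qed

lemma rc_weaken:
  assumes "rc D K f" shows "rc D (push K) (\<lambda>A c. f A (fst c))"
proof -
  from assms obtain p where p: "\<And>A c. A \<in> D \<Longrightarrow> computes A p (ctx_args K c) (f A c)"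
    unfolding rc_def by blast
  have "computes A (Comp p (map Proj [1..<1 + fst K])) (ctx_args (push K) c) (f A (fst c))"
    if "A \<in> D" for A c
    by (rule computes.comp[OF computes_Proj_map]) (use p[OF that] in simp_all)
  then show ?thesis unfolding rc_def by blast
qed

lemma rc_0 [rc_intros]: "rc D (push K) (\<lambda>A c. snd c)"
  unfolding rc_def using computes.proj[of 0] by (force intro!: exI[of _ "Proj 0"])

lemmas rc_1 [rc_intros] = rc_weaken[OF rc_0]
lemmas rc_2 [rc_intros] = rc_weaken[OF rc_1]
lemmas rc_3 [rc_intros] = rc_weaken[OF rc_2]
lemmas rc_4 [rc_intros] = rc_weaken[OF rc_3]
lemmas rc_5 [rc_intros] = rc_weaken[OF rc_4]
lemmas rc_6 [rc_intros] = rc_weaken[OF rc_5]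
lemmas rc_7 [rc_intros] = rc_weaken[OF rc_6]
text \<open>Defining formulas are treated once in a context of bare variables and then instantiated
  by these substitution rules. Otherwise the argument terms would have to be weakened under every
  binder of the formula.\<close>

lemma rc_subst1:
  assumes "rc D (push emp) (\<lambda>A c. h A (snd c))" "rc D K f1"
  shows "rc D K (\<lambda>A c. h A (f1 A c))"
proof -
  from assms obtain p q1 where
    p: "\<forall>A\<in>D. \<forall>c. computes A p (ctx_args (push emp) c) (h A (snd c))" and
    q1: "\<forall>A\<in>D. \<forall>c. computes A q1 (ctx_args K c) (f1 A c)"
    unfolding rc_def by blast
  have "computes A (Comp p [q1]) (ctx_args K c) (h A (f1 A c))" if A: "A \<in> D" for A c
    by (rule computes.comp[where ys = "[f1 A c]"])
       (use q1 A p[rule_format, OF A, of "((), f1 A c)"] in simp_all)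
  then show ?thesis unfolding rc_def by blast
qed

lemma rc_subst2:
  assumes "rc D (push (push emp)) (\<lambda>A c. h A (snd (fst c)) (snd c))" "rc D K f1" "rc D K f2"
  shows "rc D K (\<lambda>A c. h A (f1 A c) (f2 A c))"
proof -
  from assms obtain p q1 q2 where
    p: "\<forall>A\<in>D. \<forall>c. computes A p (ctx_args (push (push emp)) c) (h A (snd (fst c)) (snd c))" and
    q1: "\<forall>A\<in>D. \<forall>c. computes A q1 (ctx_args K c) (f1 A c)" and
    q2: "\<forall>A\<in>D. \<forall>c. computes A q2 (ctx_args K c) (f2 A c)"
    unfolding rc_def by blast
  have "computes A (Comp p [q2, q1]) (ctx_args K c) (h A (f1 A c) (f2 A c))" if A: "A \<in> D" for A c
    by (rule computes.comp[where ys = "[f2 A c, f1 A c]"])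
       (use q1 q2 A p[rule_format, OF A, of "(((), f1 A c), f2 A c)"] in simp_all)
  then show ?thesis unfolding rc_def by blast
qed

lemma rc_subst3:
  assumes "rc D (push (push (push emp))) (\<lambda>A c. h A (snd (fst (fst c))) (snd (fst c)) (snd c))"
    "rc D K f1" "rc D K f2" "rc D K f3"
  shows "rc D K (\<lambda>A c. h A (f1 A c) (f2 A c) (f3 A c))"
proof -
  from assms obtain p q1 q2 q3 where
    p: "\<forall>A\<in>D. \<forall>c. computes A p (ctx_args (push (push (push emp))) c) (h A (snd (fst (fst c))) (snd (fst c)) (snd c))" and
    q1: "\<forall>A\<in>D. \<forall>c. computes A q1 (ctx_args K c) (f1 A c)" and
    q2: "\<forall>A\<in>D. \<forall>c. computes A q2 (ctx_args K c) (f2 A c)" and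
    q3: "\<forall>A\<in>D. \<forall>c. computes A q3 (ctx_args K c) (f3 A c)"
    unfolding rc_def by blast
  have "computes A (Comp p [q3, q2, q1]) (ctx_args K c) (h A (f1 A c) (f2 A c) (f3 A c))" if A: "A \<in> D" for A c
    by (rule computes.comp[where ys = "[f3 A c, f2 A c, f1 A c]"])
       (use q1 q2 q3 A p[rule_format, OF A, of "((((), f1 A c), f2 A c), f3 A c)"] in simp_all)
  then show ?thesis unfolding rc_def by blast
qed

lemma rc_subst4:
  assumes "rc D (push (push (push (push emp))))
      (\<lambda>A c. h A (snd (fst (fst (fst c)))) (snd (fst (fst c))) (snd (fst c)) (snd c))"
    "rc D K f1" "rc D K f2" "rc D K f3" "rc D K f4"
  shows "rc D K (\<lambda>A c. h A (f1 A c) (f2 A c) (f3 A c) (f4 A c))"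
proof -
  from assms obtain p q1 q2 q3 q4 where
    p: "\<forall>A\<in>D. \<forall>c. computes A p (ctx_args (push (push (push (push emp)))) c) (h A (snd (fst (fst (fst c)))) (snd (fst (fst c))) (snd (fst c)) (snd c))" and
    q1: "\<forall>A\<in>D. \<forall>c. computes A q1 (ctx_args K c) (f1 A c)" and
    q2: "\<forall>A\<in>D. \<forall>c. computes A q2 (ctx_args K c) (f2 A c)" and
    q3: "\<forall>A\<in>D. \<forall>c. computes A q3 (ctx_args K c) (f3 A c)" and
    q4: "\<forall>A\<in>D. \<forall>c. computes A q4 (ctx_args K c) (f4 A c)"
    unfolding rc_def by blast
  have "computes A (Comp p [q4, q3, q2, q1]) (ctx_args K c) (h A (f1 A c) (f2 A c) (f3 A c) (f4 A c))" if A: "A \<in> D" for A c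
    by (rule computes.comp[where ys = "[f4 A c, f3 A c, f2 A c, f1 A c]"])
       (use q1 q2 q3 q4 A p[rule_format, OF A, of "(((((), f1 A c), f2 A c), f3 A c), f4 A c)"] in simp_all)
  then show ?thesis unfolding rc_def by blast
qed

lemma rc_subst5:
  assumes "rc D (push (push (push (push (push emp)))))
      (\<lambda>A c. h A (snd (fst (fst (fst (fst c))))) (snd (fst (fst (fst c)))) (snd (fst (fst c)))
        (snd (fst c)) (snd c))"
    "rc D K f1" "rc D K f2" "rc D K f3" "rc D K f4" "rc D K f5"
  shows "rc D K (\<lambda>A c. h A (f1 A c) (f2 A c) (f3 A c) (f4 A c) (f5 A c))"
proof -
  from assms obtain p q1 q2 q3 q4 q5 where
    p: "\<forall>A\<in>D. \<forall>c. computes A p (ctx_args (push (push (push (push (push emp))))) c) (h A (snd (fst (fst (fst (fst c))))) (snd (fst (fst (fst c)))) (snd (fst (fst c))) (snd (fst c)) (snd c))" and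
    q1: "\<forall>A\<in>D. \<forall>c. computes A q1 (ctx_args K c) (f1 A c)" and
    q2: "\<forall>A\<in>D. \<forall>c. computes A q2 (ctx_args K c) (f2 A c)" and
    q3: "\<forall>A\<in>D. \<forall>c. computes A q3 (ctx_args K c) (f3 A c)" and
    q4: "\<forall>A\<in>D. \<forall>c. computes A q4 (ctx_args K c) (f4 A c)" and
    q5: "\<forall>A\<in>D. \<forall>c. computes A q5 (ctx_args K c) (f5 A c)"
    unfolding rc_def by blast
  have "computes A (Comp p [q5, q4, q3, q2, q1]) (ctx_args K c) (h A (f1 A c) (f2 A c) (f3 A c) (f4 A c) (f5 A c))" if A: "A \<in> D" for A c
    by (rule computes.comp[where ys = "[f5 A c, f4 A c, f3 A c, f2 A c, f1 A c]"])
       (use q1 q2 q3 q4 q5 A p[rule_format, OF A, of "((((((), f1 A c), f2 A c), f3 A c), f4 A c), f5 A c)"] in simp_all)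
  then show ?thesis unfolding rc_def by blast
qed

lemma rc_zero [rc_intros]: "rc D K (\<lambda>A c. 0)"
  unfolding rc_def using computes.zero by blast

lemma rc_Suc [rc_intros]: "rc D K f \<Longrightarrow> rc D K (\<lambda>A c. Suc (f A c))"
  unfolding rc_def by (meson computes_Comp1 computes.succ)

lemma rc_oracle [rc_intros]: "rc D K f \<Longrightarrow> rc D K (\<lambda>A c. A (f A c))"
  unfolding rc_def by (meson computes_Comp1 computes.query)

lemma rc_const: "rc D K (\<lambda>A c. k)"
  by (induction k) (rule rc_zero, rule rc_Suc)

text \<open>\<open>PrimRec\<close> passes the counter first and the previous value second, so in the
  step function the counter is the innermost variable and the accumulator the next one.\<close>

lemma rc_rec:
  assumes "rc D K n" "rc D K a" "rc D (push (push K)) (\<lambda>A c. g A (fst (fst c)) (snd c) (snd (fst c)))"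
  shows "rc D K (\<lambda>A c. rec_nat (a A c) (\<lambda>i y. g A c i y) (n A c))"
proof -
  from assms obtain m p q where
    m: "\<And>A c. A \<in> D \<Longrightarrow> computes A m (ctx_args K c) (n A c)" and
    p: "\<And>A c. A \<in> D \<Longrightarrow> computes A p (ctx_args K c) (a A c)" and
    q: "\<And>A c. A \<in> D \<Longrightarrow> computes A q (ctx_args (push (push K)) c) (g A (fst (fst c)) (snd c) (snd (fst c)))"
    unfolding rc_def by blast
  have pr: "computes A (PrimRec p q) (k # ctx_args K c) (rec_nat (a A c) (\<lambda>i y. g A c i y) k)"
    if A: "A \<in> D" for A c k
  proof (induction k)
    case 0 then show ?case using p[OF A] by (auto intro: computes.intros)
  next
    case (Suc k)
    show ?case using computes.primrec_Suc[OF Suc q[OF A, of "((c, _), k)", simplified]] by simp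
  qed
  let ?P = "Comp (PrimRec p q) (m # map Proj [0..<0 + fst K])"
  have "computes A ?P (ctx_args K c) (rec_nat (a A c) (\<lambda>i y. g A c i y) (n A c))"
    if A: "A \<in> D" for A c
    by (rule computes.comp[OF _ pr[OF A]])
       (use m[OF A] computes_Proj_map[of 0 "fst K" "ctx_args K c" A] in simp)
  then show ?thesis unfolding rc_def by blast
qed

lemma rc_Least_zero:
  assumes "rc D (push K) (\<lambda>A c. f A (fst c) (snd c))" "\<And>A c. A \<in> D \<Longrightarrow> \<exists>n. f A c n = 0"
  shows "rc D K (\<lambda>A c. LEAST n. f A c n = 0)"
proof -
  from assms obtain p where
    p: "\<And>A c. A \<in> D \<Longrightarrow> computes A p (ctx_args (push K) c) (f A (fst c) (snd c))"
    unfolding rc_def by blast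
  have "computes A (Minimize p) (ctx_args K c) (LEAST n. f A c n = 0)" if A: "A \<in> D" for A c
  proof (rule computes.minimize[where h = "\<lambda>m. f A c m - 1"])
    show "computes A p ((LEAST n. f A c n = 0) # ctx_args K c) 0"
      using p[OF A, of "(c, LEAST n. f A c n = 0)"] LeastI_ex[OF assms(2)[OF A]] by simp
  next
    fix m assume "m < (LEAST n. f A c n = 0)"
    then have "f A c m \<noteq> 0" by (rule not_less_Least)
    then show "computes A p (m # ctx_args K c) (Suc (f A c m - 1))"
      using p[OF A, of "(c, m)"] by simp
  qed
  then show ?thesis unfolding rc_def by blast
qed

section \<open>Arithmetic, bounded quantifiers and search\<close>

lemma rc_add [rc_intros]:
  assumes "rc D K f" "rc D K g" shows "rc D K (\<lambda>A c. f A c + g A c)"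
proof -
  have "rec_nat x (\<lambda>_ y. Suc y) n = x + n" for x n by (induction n) auto
  moreover have "rc D K (\<lambda>A c. rec_nat (f A c) (\<lambda>_ y. Suc y) (g A c))"
    by (rule rc_rec assms rc_intros)+
  ultimately show ?thesis by simp
qed

lemma rc_mult [rc_intros]:
  assumes "rc D K f" "rc D K g" shows "rc D K (\<lambda>A c. f A c * g A c)"
proof -
  have "rec_nat 0 (\<lambda>_ y. y + x) n = x * n" for x n :: nat by (induction n) auto
  moreover have "rc D K (\<lambda>A c. rec_nat 0 (\<lambda>_ y. y + f A c) (g A c))"
    by (intro rc_rec assms rc_intros rc_weaken[OF rc_weaken])
  ultimately show ?thesis by simp
qed

lemma rc_power [rc_intros]:
  assumes "rc D K f" "rc D K g" shows "rc D K (\<lambda>A c. f A c ^ g A c)"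
proof -
  have "rec_nat 1 (\<lambda>_ y. y * x) n = x ^ n" for x n :: nat by (induction n) auto
  moreover have "rc D K (\<lambda>A c. rec_nat 1 (\<lambda>_ y. y * f A c) (g A c))"
    by (intro rc_rec assms rc_intros rc_const[of _ _ 1] rc_weaken[OF rc_weaken])
  ultimately show ?thesis by simp
qed

lemma rc_pred: assumes "rc D K f" shows "rc D K (\<lambda>A c. f A c - 1)"
proof -
  have "rec_nat 0 (\<lambda>i y. i) n = n - 1" for n :: nat by (induction n) auto
  moreover have "rc D K (\<lambda>A c. rec_nat 0 (\<lambda>i y. i) (f A c))"
    by (rule rc_rec assms rc_intros)+
  ultimately show ?thesis by simp
qed

lemma rc_diff [rc_intros]:
  assumes "rc D K f" "rc D K g" shows "rc D K (\<lambda>A c. f A c - g A c)"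
proof -
  have "rec_nat x (\<lambda>i y. y - 1) n = x - n" for n x :: nat by (induction n) auto
  moreover have "rc D K (\<lambda>A c. rec_nat (f A c) (\<lambda>i y. y - 1) (g A c))"
    by (rule rc_rec assms rc_intros rc_pred)+
  ultimately show ?thesis by simp
qed

lemma decid_le [rc_intros]:
  assumes "rc D K f" "rc D K g" shows "decid D K (\<lambda>A c. f A c \<le> g A c)"
proof -
  have "of_bool (x \<le> y) = (1::nat) - (x - y)" for x y :: nat by auto
  moreover have "rc D K (\<lambda>A c. (1::nat) - (f A c - g A c))"
    by (rule assms rc_intros rc_const)+
  ultimately show ?thesis unfolding decid_def by simp
qed

lemma decid_not [rc_intros]: assumes "decid D K P" shows "decid D K (\<lambda>A c. \<not> P A c)"
proof -
  have "rc D K (\<lambda>A c. (1::nat) - of_bool (P A c))"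
    by (rule rc_intros rc_const assms[unfolded decid_def])+
  moreover have "(1::nat) - of_bool b = of_bool (\<not> b)" for b by simp
  ultimately show ?thesis unfolding decid_def by simp
qed

lemma decid_conj [rc_intros]:
  assumes "decid D K P" "decid D K Q" shows "decid D K (\<lambda>A c. P A c \<and> Q A c)"
  using rc_mult[OF assms[unfolded decid_def]] unfolding decid_def by (simp add: of_bool_conj)

lemma decid_disj [rc_intros]:
  assumes "decid D K P" "decid D K Q" shows "decid D K (\<lambda>A c. P A c \<or> Q A c)"
  using decid_not[OF decid_conj[OF assms[THEN decid_not]]] by simp

lemma decid_imp [rc_intros]:
  assumes "decid D K P" "decid D K Q" shows "decid D K (\<lambda>A c. P A c \<longrightarrow> Q A c)"
  using decid_disj[OF decid_not[OF assms(1)] assms(2)] by simp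

lemma decid_less [rc_intros]:
  assumes "rc D K f" "rc D K g" shows "decid D K (\<lambda>A c. f A c < g A c)"
  using decid_not[OF decid_le[OF assms(2,1)]] by (simp add: not_le)

lemma decid_eq [rc_intros]:
  assumes "rc D K f" "rc D K g" shows "decid D K (\<lambda>A c. f A c = g A c)"
  using decid_conj[OF decid_le[OF assms] decid_le[OF assms(2,1)]] by (simp add: eq_iff)

lemma rc_if [rc_intros]:
  assumes "decid D K P" "rc D K f" "rc D K g" shows "rc D K (\<lambda>A c. if P A c then f A c else g A c)"
proof -
  have "rc D K (\<lambda>A c. of_bool (P A c) * f A c + (1 - of_bool (P A c)) * g A c)"
    by (rule rc_intros rc_const assms assms(1)[unfolded decid_def])+
  moreover have "of_bool b * x + (1 - of_bool b) * y = (if b then x else y)" for b and x y :: nat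
    by auto
  ultimately show ?thesis by simp
qed

lemma rc_of_bool [rc_intros]: "decid D K P \<Longrightarrow> rc D K (\<lambda>A c. of_bool (P A c))"
  unfolding decid_def .

text \<open>In a recursion the accumulator sits between the counter and the surrounding context;
  this rule inserts it beneath the bound variable of a summand or factor.\<close>

lemma rc_skip:
  assumes "rc D (push K) (\<lambda>A c. f A (fst c) (snd c))"
  shows "rc D (push (push K)) (\<lambda>A c. f A (fst (fst c)) (snd c))"
proof -
  from assms obtain p where p: "\<And>A c. A \<in> D \<Longrightarrow> computes A p (ctx_args (push K) c) (f A (fst c) (snd c))"
    unfolding rc_def by blast
  let ?p = "Comp p (Proj 0 # map Proj [2..<2 + fst K])"
  have "computes A ?p (ctx_args (push (push K)) c) (f A (fst (fst c)) (snd c))" if "A \<in> D" for A c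
    by (rule computes.comp[of _ _ _ "snd c # ctx_args K (fst (fst c))"])
       (use p[OF that, of "(fst (fst c), snd c)"] computes.proj[of 0 "ctx_args (push (push K)) c" A]
         computes_Proj_map[of 2 "fst K" "ctx_args (push (push K)) c" A] in auto)
  then show ?thesis unfolding rc_def by blast
qed

lemma rc_sum [rc_intros]:
  assumes "rc D K n" "rc D (push K) (\<lambda>A c. f A (fst c) (snd c))"
  shows "rc D K (\<lambda>A c. \<Sum>i<n A c. f A c i)"
proof -
  have "rec_nat 0 (\<lambda>i y. y + h i) n = (\<Sum>i<n. h i)" for h :: "nat \<Rightarrow> nat" and n by (induction n) auto
  moreover have "rc D K (\<lambda>A c. rec_nat 0 (\<lambda>i y. y + f A c i) (n A c))"
    by (rule rc_rec assms rc_skip[OF assms(2)] rc_intros)+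
  ultimately show ?thesis by simp
qed

lemma decid_ex [rc_intros]:
  assumes "rc D K n" "decid D (push K) (\<lambda>A c. P A (fst c) (snd c))"
  shows "decid D K (\<lambda>A c. \<exists>i<n A c. P A c i)"
proof -
  have "decid D K (\<lambda>A c. \<not> (\<Sum>i<n A c. of_bool (P A c i)) \<le> (0::nat))"
    by (rule rc_intros assms)+
  moreover have "(\<not> (\<Sum>i<m. of_bool (Q i)) \<le> (0::nat)) = (\<exists>i<m. Q i)" for m and Q :: "nat \<Rightarrow> bool"
    by auto
  ultimately show ?thesis by simp
qed

lemma decid_all [rc_intros]:
  assumes "rc D K n" "decid D (push K) (\<lambda>A c. P A (fst c) (snd c))"
  shows "decid D K (\<lambda>A c. \<forall>i<n A c. P A c i)"
  using decid_not[OF decid_ex[OF assms(1) decid_not[OF assms(2)]]] by simp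

lemma decid_ex_le [rc_intros]:
  assumes "rc D K n" "decid D (push K) (\<lambda>A c. P A (fst c) (snd c))"
  shows "decid D K (\<lambda>A c. \<exists>i\<le>n A c. P A c i)"
  using decid_ex[OF rc_Suc[OF assms(1)] assms(2)] by (simp add: less_Suc_eq_le)

lemma decid_all_le [rc_intros]:
  assumes "rc D K n" "decid D (push K) (\<lambda>A c. P A (fst c) (snd c))"
  shows "decid D K (\<lambda>A c. \<forall>i\<le>n A c. P A c i)"
  using decid_all[OF rc_Suc[OF assms(1)] assms(2)] by (simp add: less_Suc_eq_le)

lemma rc_Least:
  assumes "decid D (push K) (\<lambda>A c. P A (fst c) (snd c))" "\<And>A c. A \<in> D \<Longrightarrow> \<exists>n. P A c n"
  shows "rc D K (\<lambda>A c. LEAST n. P A c n)"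
proof -
  have "rc D K (\<lambda>A c. LEAST n. of_bool (\<not> P A c n) = (0::nat))"
  proof (rule rc_Least_zero)
    show "\<exists>n. of_bool (\<not> P A c n) = (0::nat)" if "A \<in> D" for A c
      using assms(2)[OF that] by simp
  qed (rule rc_intros assms)+
  then show ?thesis by simp
qed

lemma rc_numeral [rc_intros]: "rc D K (\<lambda>A c. numeral k)" "rc D K (\<lambda>A c. 1)"
  by (rule rc_const)+

lemma rc_prod [rc_intros]:
  assumes "rc D K n" "rc D (push K) (\<lambda>A c. f A (fst c) (snd c))"
  shows "rc D K (\<lambda>A c. \<Prod>i<n A c. f A c i)"
proof -
  have "rec_nat 1 (\<lambda>i y. y * h i) n = (\<Prod>i<n. h i)" for h :: "nat \<Rightarrow> nat" and n by (induction n) auto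
  moreover have "rc D K (\<lambda>A c. rec_nat 1 (\<lambda>i y. y * f A c i) (n A c))"
    by (rule rc_rec assms rc_skip[OF assms(2)] rc_intros)+
  ultimately show ?thesis by simp
qed

lemma rc_min [rc_intros]:
  assumes "rc D K f" "rc D K g" shows "rc D K (\<lambda>A c. min (f A c) (g A c))"
  unfolding min_def by (intro rc_intros assms)

lemma rc_div [rc_intros]:
  assumes "rc D K f" "rc D K g" shows "rc D K (\<lambda>A c. f A c div g A c)"
proof -
  \<comment> \<open>The disjunct for divisor 0 keeps the search total and makes it return 0, in
    agreement with \<open>x div 0 = 0\<close>.\<close>
  have "rc D (push (push emp)) (\<lambda>A c. LEAST n. snd c = 0 \<or> snd (fst c) < Suc n * snd c)"
  proof (rule rc_Least)
    show "\<exists>n. snd c = 0 \<or> snd (fst c) < Suc n * snd c" for c :: "(unit \<times> nat) \<times> nat"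
      by (cases "snd c") (auto intro!: exI[of _ "snd (fst c)"])
  qed (rule rc_intros)+
  note rc_subst2[OF this assms]
  moreover have "(LEAST n. y = 0 \<or> x < Suc n * y) = x div y" for x y :: nat
  proof (rule Least_equality)
    show "y = 0 \<or> x < Suc (x div y) * y"
      by (cases "y = 0") (auto simp: dividend_less_div_times)
    fix n assume "y = 0 \<or> x < Suc n * y"
    then show "x div y \<le> n"
      by (metis div_by_0 le0 less_Suc_eq_le less_mult_imp_div_less)
  qed
  ultimately show ?thesis by simp
qed

lemma rc_mod [rc_intros]:
  assumes "rc D K f" "rc D K g" shows "rc D K (\<lambda>A c. f A c mod g A c)"
  unfolding minus_div_mult_eq_mod[symmetric] by (rule rc_intros assms)+

lemma rc_prod_encode [rc_intros]:
  assumes "rc D K f" "rc D K g" shows "rc D K (\<lambda>A c. prod_encode (f A c, g A c))"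
  unfolding prod_encode_def triangle_def prod.case by (rule rc_intros assms)+

lemma rc_fst_prod_decode [rc_intros]:
  assumes "rc D K f" shows "rc D K (\<lambda>A c. fst (prod_decode (f A c)))"
proof -
  have "rc D (push emp) (\<lambda>A c. LEAST x. \<exists>y\<le>snd c. prod_encode (x, y) = snd c)"
  proof (rule rc_Least)
    show "\<exists>x. \<exists>y\<le>snd c. prod_encode (x, y) = snd c" for c :: "unit \<times> nat"
      by (metis le_prod_encode_2 prod_decode_inverse surj_pair)
  qed (rule rc_intros)+
  note rc_subst1[OF this assms]
  moreover have "(LEAST x. \<exists>y\<le>n. prod_encode (x, y) = n) = fst (prod_decode n)" for n
    by (rule Least_equality)
       (metis le_prod_encode_2 prod_decode_inverse surj_pair fst_conv prod_encode_inverse order_refl)+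
  ultimately show ?thesis by simp
qed

lemma rc_snd_prod_decode [rc_intros]:
  assumes "rc D K f" shows "rc D K (\<lambda>A c. snd (prod_decode (f A c)))"
proof -
  have "rc D (push emp) (\<lambda>A c. LEAST x. prod_encode (fst (prod_decode (snd c)), x) = snd c)"
  proof (rule rc_Least)
    show "\<exists>x. prod_encode (fst (prod_decode (snd c)), x) = snd c" for c :: "unit \<times> nat"
      by (metis prod.collapse prod_decode_inverse)
  qed (rule rc_intros)+
  note rc_subst1[OF this assms]
  moreover have "(LEAST x. prod_encode (fst (prod_decode n), x) = n) = snd (prod_decode n)" for n
    by (rule Least_equality) (metis prod.collapse prod_decode_inverse snd_conv prod_encode_inverse order_refl)+
  ultimately show ?thesis by simp
qed

section \<open>Computing with codes of strings and lists\<close>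

abbreviation str :: "nat \<Rightarrow> bool list" where "str \<equiv> inv str_code"

lemma str_str_code [simp]: "str (str_code w) = w"
  by (simp add: bij_str_code bij_is_inj)

lemma str_code_str [simp]: "str_code (str n) = n"
  by (simp add: bij_str_code bij_is_surj surj_f_inv_f)

lemma str_code_append: "str_code (u @ v) = str_code u + 2 ^ length u * str_code v"
  by (induction u) (auto simp: algebra_simps)

lemma str_code_tl: "str_code (tl w) = (str_code w - 1) div 2"
  by (cases w) auto

lemma str_code_drop: "str_code (drop k w) = rec_nat (str_code w) (\<lambda>_ y. (y - 1) div 2) k"
  by (induction k) (simp_all add: drop_Suc tl_drop[symmetric] str_code_tl)

lemma str_code_take: "str_code (take k w) = str_code w - 2 ^ k * str_code (drop k w)"
  using str_code_append[of "take k w" "drop k w"] by (cases "k \<le> length w") auto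

lemma str_code_eq_0 [simp]: "str_code w = 0 \<longleftrightarrow> w = []"
  by (cases w) auto

lemma length_Least: "length w = (LEAST k. str_code (drop k w) \<le> 0)"
  by (rule Least_equality[symmetric]) auto

lemma rc_drop [rc_intros]:
  assumes "rc D K k" "rc D K f" shows "rc D K (\<lambda>A c. str_code (drop (k A c) (str (f A c))))"
  unfolding str_code_drop str_code_str by (intro rc_rec assms rc_intros)

lemma rc_take [rc_intros]:
  assumes "rc D K k" "rc D K f" shows "rc D K (\<lambda>A c. str_code (take (k A c) (str (f A c))))"
  unfolding str_code_take str_code_str by (intro assms rc_intros)

lemma rc_length [rc_intros]:
  assumes "rc D K f" shows "rc D K (\<lambda>A c. length (str (f A c)))"
proof -
  have "rc D (push emp) (\<lambda>A c. length (str (snd c)))"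
    unfolding length_Least
  proof (rule rc_Least)
    show "\<exists>n. str_code (drop n (str (snd c))) \<le> 0" for c :: "unit \<times> nat"
      by (rule exI[of _ "length (str (snd c))"]) simp
  qed (intro rc_intros)
  from rc_subst1[OF this assms] show ?thesis .
qed

lemma str_code_snoc: "str_code (w @ [b]) = str_code w + 2 ^ length w * (if b then 2 else 1)"
  by (simp add: str_code_append)

lemma rc_snoc [rc_intros]:
  assumes "rc D K f"
  shows "rc D K (\<lambda>A c. str_code (str (f A c) @ [True]))" "rc D K (\<lambda>A c. str_code (str (f A c) @ [False]))"
  unfolding str_code_snoc str_code_str if_True if_False by (intro assms rc_intros)+

definition nthd :: "nat list \<Rightarrow> nat \<Rightarrow> nat" where
  "nthd xs i = (if i < length xs then xs ! i else 0)"

text \<open>With \<open>0 - 1 = 0\<close> this makes the code arithmetic send the empty list to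
  itself under \<open>tl\<close>, so that \<open>drop\<close> is an iteration without case
  distinction.\<close>

lemma prod_decode_0 [simp]: "prod_decode 0 = (0, 0)"
  by (simp add: prod_decode_def prod_decode_aux.simps)

lemma list_encode_tl: "list_encode (tl xs) = snd (prod_decode (list_encode xs - 1))"
  by (cases xs) simp_all

lemma list_encode_drop: "list_encode (drop k xs) = rec_nat (list_encode xs) (\<lambda>_ y. snd (prod_decode (y - 1))) k"
  by (induction k) (simp_all add: drop_Suc tl_drop[symmetric] list_encode_tl)

lemma list_encode_eq_0: "list_encode xs \<le> 0 \<longleftrightarrow> xs = []"
  by (cases xs) auto

lemma length_list_Least: "length xs = (LEAST k. list_encode (drop k xs) \<le> 0)"
  unfolding list_encode_eq_0 by (rule Least_equality[symmetric]) auto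

lemma nthd_code: "nthd xs i = fst (prod_decode (list_encode (drop i xs) - 1))"
  by (cases "i < length xs") (simp_all add: nthd_def Cons_nth_drop_Suc[symmetric])

lemma rc_list_drop [rc_intros]:
  assumes "rc D K k" "rc D K f" shows "rc D K (\<lambda>A c. list_encode (drop (k A c) (list_decode (f A c))))"
  unfolding list_encode_drop list_decode_inverse by (intro rc_rec assms rc_intros)

lemma rc_list_length [rc_intros]:
  assumes "rc D K f" shows "rc D K (\<lambda>A c. length (list_decode (f A c)))"
proof -
  have "rc D (push emp) (\<lambda>A c. length (list_decode (snd c)))"
    unfolding length_list_Least
  proof (rule rc_Least)
    show "\<exists>n. list_encode (drop n (list_decode (snd c))) \<le> 0" for c :: "unit \<times> nat"
      by (rule exI[of _ "length (list_decode (snd c))"]) simp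
  qed (intro rc_intros)
  from rc_subst1[OF this assms] show ?thesis .
qed

lemma rc_nthd [rc_intros]:
  assumes "rc D K k" "rc D K f" shows "rc D K (\<lambda>A c. nthd (list_decode (f A c)) (k A c))"
  unfolding nthd_code by (intro assms rc_intros)

lemma rc_Cons [rc_intros]:
  assumes "rc D K k" "rc D K f" shows "rc D K (\<lambda>A c. list_encode (k A c # list_decode (f A c)))"
  unfolding list_encode.simps list_decode_inverse by (intro assms rc_intros)

lemma decid_bex [rc_intros]:
  assumes "rc D K f" "decid D (push K) (\<lambda>A c. P A (fst c) (snd c))"
  shows "decid D K (\<lambda>A c. \<exists>a\<in>set (list_decode (f A c)). P A c a)"
proof -
  from assms(2) have "rc D (push K) (\<lambda>A c. of_bool (P A (fst c) (snd c)))"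
    unfolding decid_def .
  then obtain p where p: "\<And>A c. A \<in> D \<Longrightarrow> computes A p (ctx_args (push K) c) (of_bool (P A (fst c) (snd c)))"
    unfolding rc_def by blast
  from rc_nthd[OF rc_0 rc_weaken[OF assms(1)]] have
    "rc D (push K) (\<lambda>A c. nthd (list_decode (f A (fst c))) (snd c))" .
  then obtain q where q: "\<And>A c. A \<in> D \<Longrightarrow> computes A q (ctx_args (push K) c) (nthd (list_decode (f A (fst c))) (snd c))"
    unfolding rc_def by blast
  \<comment> \<open>\<open>rc_subst1\<close> is for bodies with a single variable. Here the body
    also sees the environment of \<open>K\<close>, which is passed on by projections.\<close>
  let ?p = "Comp p (q # map Proj [1..<1 + fst K])"
  have "computes A ?p (ctx_args (push K) c) (of_bool (P A (fst c) (nthd (list_decode (f A (fst c))) (snd c))))"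
    if A: "A \<in> D" for A c
    by (rule computes.comp[OF _ p[OF A, of "(fst c, nthd (list_decode (f A (fst c))) (snd c))", simplified]])
       (use q[OF A, of c] computes_Proj_map[of 1 "fst K" "ctx_args (push K) c" A] in auto)
  then have *: "decid D (push K) (\<lambda>A c. P A (fst c) (nthd (list_decode (f A (fst c))) (snd c)))"
    unfolding decid_def rc_def by blast
  have "(\<exists>a\<in>set xs. Q a) \<longleftrightarrow> (\<exists>i<length xs. Q (nthd xs i))" for xs and Q :: "nat \<Rightarrow> bool"
    unfolding nthd_def by (metis in_set_conv_nth)
  moreover have "decid D K (\<lambda>A c. \<exists>i<length (list_decode (f A c)). P A c (nthd (list_decode (f A c)) i))"
    by (rule decid_ex[OF rc_list_length[OF assms(1)] *])
  ultimately show ?thesis by simp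
qed

lemma decid_mem [rc_intros]:
  assumes "rc D K g" "rc D K f" shows "decid D K (\<lambda>A c. g A c \<in> set (list_decode (f A c)))"
proof -
  have "decid D K (\<lambda>A c. \<exists>a\<in>set (list_decode (f A c)). g A c = a)"
    by (intro rc_intros assms rc_weaken[of D K g])
  then show ?thesis by simp
qed


section \<open>Certificates of halting computations\<close>

fun pcode :: "oracle_program \<Rightarrow> nat" where
  "pcode Zero = prod_encode (0, 0)"
| "pcode Succ = prod_encode (1, 0)"
| "pcode (Proj i) = prod_encode (2, i)"
| "pcode Query = prod_encode (3, 0)"
| "pcode (Comp p qs) = prod_encode (4, prod_encode (pcode p, list_encode (map pcode qs)))"
| "pcode (PrimRec p q) = prod_encode (5, prod_encode (pcode p, pcode q))"
| "pcode (Minimize p) = prod_encode (6, pcode p)"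

text \<open>A judgement: the program with code \<open>p\<close> maps the argument list with code
  \<open>x\<close> to \<open>y\<close>.\<close>

definition jcode :: "nat \<Rightarrow> nat \<Rightarrow> nat \<Rightarrow> nat" where
  "jcode p x y = prod_encode (p, prod_encode (x, y))"

definition jprog :: "nat \<Rightarrow> nat" where "jprog j = fst (prod_decode j)"
definition jin :: "nat \<Rightarrow> nat" where "jin j = fst (prod_decode (snd (prod_decode j)))"
definition jout :: "nat \<Rightarrow> nat" where "jout j = snd (prod_decode (snd (prod_decode j)))"

lemma jcode_sel [simp]: "jprog (jcode p x y) = p" "jin (jcode p x y) = x" "jout (jcode p x y) = y"
  by (simp_all add: jcode_def jprog_def jin_def jout_def)

lemma jcode_collapse [simp]: "jcode (jprog j) (jin j) (jout j) = j"
  by (simp add: jcode_def jprog_def jin_def jout_def)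

lemma rc_jcode [rc_intros]:
  "rc D K f \<Longrightarrow> rc D K g \<Longrightarrow> rc D K h \<Longrightarrow> rc D K (\<lambda>A c. jcode (f A c) (g A c) (h A c))"
  "rc D K f \<Longrightarrow> rc D K (\<lambda>A c. jprog (f A c))"
  "rc D K f \<Longrightarrow> rc D K (\<lambda>A c. jin (f A c))"
  "rc D K f \<Longrightarrow> rc D K (\<lambda>A c. jout (f A c))"
  unfolding jcode_def jprog_def jin_def jout_def by (intro rc_intros; assumption)+

text \<open>The disjuncts follow the tags of \<^const>\<open>pcode\<close>; \<open>d\<close> is what follows the tag \<open>tag\<close> in the program
  code \<open>p\<close>, and queries are answered below \<open>t\<close> only.\<close>

definition justified_by ::
  "(nat \<Rightarrow> nat) \<Rightarrow> nat \<Rightarrow> nat set \<Rightarrow> nat \<Rightarrow> nat \<Rightarrow> nat \<Rightarrow> nat \<Rightarrow> nat \<Rightarrow> bool" where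
  "justified_by A t J p tag d x y \<longleftrightarrow>
     (tag = 0 \<and> y = 0) \<or>
     (tag = 1 \<and> 0 < y \<and> x = list_encode ((y - 1) # list_decode 0)) \<or>
     (tag = 2 \<and> d < length (list_decode x) \<and> y = nthd (list_decode x) d) \<or>
     (tag = 3 \<and> length (list_decode x) = 1 \<and> nthd (list_decode x) 0 < t \<and> y = A (nthd (list_decode x) 0)) \<or>
     (tag = 4 \<and> (\<exists>j\<in>J. jprog j = fst (prod_decode d) \<and> jout j = y \<and>
        length (list_decode (jin j)) = length (list_decode (snd (prod_decode d))) \<and>
        (\<forall>k<length (list_decode (jin j)).
          jcode (nthd (list_decode (snd (prod_decode d))) k) x (nthd (list_decode (jin j)) k) \<in> J))) \<or>
     (tag = 5 \<and> 0 < length (list_decode x) \<and>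
       (if nthd (list_decode x) 0 = 0
        then jcode (fst (prod_decode d)) (list_encode (drop 1 (list_decode x))) y \<in> J
        else \<exists>j\<in>J. jprog j = p \<and>
          jin j = list_encode ((nthd (list_decode x) 0 - 1) # list_decode (list_encode (drop 1 (list_decode x)))) \<and>
          jcode (snd (prod_decode d))
            (list_encode ((nthd (list_decode x) 0 - 1) # list_decode
              (list_encode (jout j # list_decode (list_encode (drop 1 (list_decode x))))))) y \<in> J)) \<or>
     (tag = 6 \<and> jcode d (list_encode (y # list_decode x)) 0 \<in> J \<and>
       (\<forall>m<y. \<exists>j\<in>J. jprog j = d \<and> jin j = list_encode (m # list_decode x) \<and> 0 < jout j))"

definition justified :: "(nat \<Rightarrow> nat) \<Rightarrow> nat \<Rightarrow> nat set \<Rightarrow> nat \<Rightarrow> bool" where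
  "justified A t J j \<longleftrightarrow>
     justified_by A t J (jprog j) (fst (prod_decode (jprog j))) (snd (prod_decode (jprog j))) (jin j) (jout j)"

text \<open>A derivation tree of \<open>computes\<close> flattened into a list, conclusion first.
  Each judgement may use only those behind it, which excludes circular justifications.\<close>

fun certificate :: "(nat \<Rightarrow> nat) \<Rightarrow> nat \<Rightarrow> nat list \<Rightarrow> bool" where
  "certificate A t [] \<longleftrightarrow> True"
| "certificate A t (j # js) \<longleftrightarrow> justified A t (set js) j \<and> certificate A t js"

text \<open>Trades the recursion for a bounded quantifier, to which the decidability rules
  apply.\<close>

lemma certificate_nth:
  "certificate A t js \<longleftrightarrow> (\<forall>i<length js. justified A t (set (drop (Suc i) js)) (nthd js i))"
proof (induction js)
  case (Cons j js)
  show ?case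
    by (subst length_Cons, subst All_less_Suc2) (simp add: Cons nthd_def)
qed simp

lemma justified_mono: "justified A t J j \<Longrightarrow> J \<subseteq> J' \<Longrightarrow> t \<le> t' \<Longrightarrow> justified A t' J' j"
  unfolding justified_def justified_by_def
  apply (elim disj_forward)
        apply assumption
       apply assumption
      apply assumption
     apply (elim conjE, intro conjI; (assumption | erule (1) less_le_trans))
    apply (elim conjE bexE, intro conjI bexI; blast)
   apply (elim conjE, intro conjI)
     apply assumption
    apply assumption
   apply (split if_split_asm; simp; blast)
  apply (elim conjE, intro conjI; blast)
  done

lemma certificate_mono: "certificate A t js \<Longrightarrow> t \<le> t' \<Longrightarrow> certificate A t' js"
  by (induction js) (auto intro: justified_mono)

lemma certificate_append:
  "certificate A t js \<Longrightarrow> certificate A t js' \<Longrightarrow> certificate A t (js @ js')"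
  by (induction js) (auto intro: justified_mono)

text \<open>Finite use: queries are answered below \<open>t\<close> only. Through this a test
  relative to an infinite name can be evaluated on finite prefixes of the name.\<close>

lemma certificate_cong:
  assumes "\<And>i. i < t \<Longrightarrow> A i = B i" shows "certificate A t js = certificate B t js"
proof -
  have "justified A t J j = justified B t J j" for J j
    unfolding justified_def justified_by_def
    by (intro arg_cong2[where f = "(\<or>)"] refl conj_cong) (use assms in auto)
  then show ?thesis by (induction js) auto
qed

lemma certificate_sound:
  assumes "certificate A t js" "jcode (pcode p) (list_encode xs) y \<in> set js"
  shows "computes A p xs y"
  using assms
proof (induction js arbitrary: p xs y)
  case (Cons j js)
  show ?case
  proof (cases "jcode (pcode p) (list_encode xs) y \<in> set js")
    case True then show ?thesis using Cons by auto
  next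
    case False
    then have j: "j = jcode (pcode p) (list_encode xs) y" using Cons.prems by auto
    have IH: "computes A p' xs' y'" if "jcode (pcode p') (list_encode xs') y' \<in> set js" for p' xs' y'
      using Cons that by auto
    have IH': "computes A p' xs' (jout j)" if "j \<in> set js" "jprog j = pcode p'" "jin j = list_encode xs'" for j p' xs'
      using IH that jcode_collapse by metis
    have J: "justified_by A t (set js) (pcode p) (fst (prod_decode (pcode p)))
       (snd (prod_decode (pcode p))) (list_encode xs) y"
      using Cons.prems unfolding j by (simp add: justified_def)
    show ?thesis
    proof (cases p)
      case Zero
      then show ?thesis using J by (auto simp: justified_by_def intro: computes.zero)
    next
      case Succ
      then have "list_encode xs = list_encode [y - 1]" "0 < y" using J
        by (auto simp: justified_by_def simp del: list_encode.simps)
      then have "xs = [y - 1]" by (metis list_encode_inverse)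
      then show ?thesis using computes.succ[of A "y - 1"] Succ \<open>0 < y\<close> by simp
    next
      case (Proj i)
      then show ?thesis using J computes.proj[of i xs A] by (auto simp: justified_by_def nthd_def)
    next
      case Query
      then obtain x where "xs = [x]" "y = A x" using J
        by (auto simp: justified_by_def nthd_def length_Suc_conv)
      then show ?thesis using computes.query Query by simp
    next
      case (Comp p' qs)
      then obtain j' where j': "j' \<in> set js" "jprog j' = pcode p'" "jout j' = y"
        and len: "length (list_decode (jin j')) = length qs"
        and qs: "\<And>k. k < length qs \<Longrightarrow> jcode (pcode (qs ! k)) (list_encode xs) (list_decode (jin j') ! k) \<in> set js"
        using J by (auto simp: justified_by_def nthd_def)
      have "computes A p' (list_decode (jin j')) y"
        using IH'[OF j'(1,2)] j'(3) by simp
      moreover have "list_all2 (\<lambda>q y. computes A q xs y) qs (list_decode (jin j'))"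
        using len qs IH by (auto simp: list_all2_conv_all_nth)
      ultimately show ?thesis using computes.comp Comp by blast
    next
      case (PrimRec p' q)
      then obtain n xs' where xs: "xs = n # xs'" using J
        by (cases xs) (auto simp: justified_by_def)
      show ?thesis
      proof (cases n)
        case 0
        then show ?thesis using J xs PrimRec IH by (auto simp: justified_by_def nthd_def intro!: computes.primrec_0)
      next
        case (Suc m)
        obtain j' where "j' \<in> set js" "jprog j' = pcode p" "jin j' = list_encode (m # xs')"
          "jcode (pcode q) (list_encode (m # jout j' # xs')) y \<in> set js"
          using J xs PrimRec Suc by (auto simp: justified_by_def nthd_def simp del: list_encode.simps)
        then have "computes A p (m # xs') (jout j')" "computes A q (m # jout j' # xs') y"
          using IH IH' by blast+
        then show ?thesis using computes.primrec_Suc unfolding PrimRec xs Suc by blast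
      qed
    next
      case (Minimize p')
      then have J': "jcode (pcode p') (list_encode (y # xs)) 0 \<in> set js"
        "\<And>m. m < y \<Longrightarrow> \<exists>j\<in>set js. jprog j = pcode p' \<and> jin j = list_encode (m # xs) \<and> 0 < jout j"
        using J by (auto simp: justified_by_def simp del: list_encode.simps)
      have "\<exists>h. computes A p' (m # xs) (Suc h)" if m: "m < y" for m
        using J'(2)[OF m] IH' gr0_conv_Suc by metis
      then obtain h where "\<And>m. m < y \<Longrightarrow> computes A p' (m # xs) (Suc (h m))" by metis
      then show ?thesis using computes.minimize IH[OF J'(1)] unfolding Minimize by blast
    qed
  qed
qed simp

definition certified :: "(nat \<Rightarrow> nat) \<Rightarrow> oracle_program \<Rightarrow> nat list \<Rightarrow> nat \<Rightarrow> bool" where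
  "certified A p xs y \<longleftrightarrow> (\<exists>t js. certificate A t js \<and> jcode (pcode p) (list_encode xs) y \<in> set js)"

lemma certifiedI:
  assumes "certificate A t js" "justified A t (set js) (jcode (pcode p) (list_encode xs) y)"
  shows "certified A p xs y"
  unfolding certified_def using assms
  by (intro exI[of _ t] exI[of _ "jcode (pcode p) (list_encode xs) y # js"]) simp

text \<open>The premises of a rule bring certificates of their own. Appending them and taking the
  largest query bound keeps all of them valid, since a justification survives more judgements and a
  larger bound.\<close>

lemma certified_all:
  fixes n :: nat
  assumes "\<forall>i<n. certified A (p i) (xs i) (y i)"
  shows "\<exists>t js. certificate A t js \<and> (\<forall>i<n. jcode (pcode (p i)) (list_encode (xs i)) (y i) \<in> set js)"
  using assms
proof (induction n)
  case 0 then show ?case by (intro exI[of _ 0] exI[of _ "[]"]) simp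
next
  case (Suc n)
  then obtain t js where t: "certificate A t js" "\<And>i. i < n \<Longrightarrow> jcode (pcode (p i)) (list_encode (xs i)) (y i) \<in> set js"
    by auto
  obtain t' js' where t': "certificate A t' js'" "jcode (pcode (p n)) (list_encode (xs n)) (y n) \<in> set js'"
    using Suc.prems certified_def by auto
  have "certificate A (max t t') (js @ js')"
    using t(1) t'(1) by (intro certificate_append) (auto intro: certificate_mono)
  then show ?case using t(2) t'(2) by (intro exI[of _ "max t t'"] exI[of _ "js @ js'"]) (auto simp: less_Suc_eq)
qed

lemma certified_two:
  assumes "certified A p xs y" "certified A p' xs' y'"
  obtains t js where "certificate A t js" "jcode (pcode p) (list_encode xs) y \<in> set js"
    "jcode (pcode p') (list_encode xs') y' \<in> set js"
  using certified_all[of 2 A "\<lambda>i. if i = 0 then p else p'" "\<lambda>i. if i = 0 then xs else xs'" "\<lambda>i. if i = 0 then y else y'"]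
    assms by (auto simp: numeral_2_eq_2 All_less_Suc)

lemma computes_certified:
  assumes "computes A p xs y" shows "certified A p xs y"
  using assms
proof (induction rule: computes.induct)
  case (zero xs)
  show ?case by (rule certifiedI[of _ 0 "[]"]) (auto simp: justified_def justified_by_def)
next
  case (succ x)
  show ?case by (rule certifiedI[of _ 0 "[]"]) (auto simp: justified_def justified_by_def)
next
  case (proj i xs)
  then show ?case by (intro certifiedI[of _ 0 "[]"]) (auto simp: justified_def justified_by_def nthd_def)
next
  case (query x)
  show ?case by (rule certifiedI[of _ "Suc x" "[]"]) (auto simp: justified_def justified_by_def nthd_def)
next
  case (comp xs qs ys p z)
  have len: "length qs = length ys" using comp.IH(1) by (rule list_all2_lengthD)
  have "\<forall>i<Suc (length qs). certified A (if i < length qs then qs ! i else p)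
      (if i < length qs then xs else ys) (if i < length qs then ys ! i else z)"
    using comp.IH by (auto simp: list_all2_conv_all_nth)
  from certified_all[OF this] obtain t js where t: "certificate A t js"
    "\<And>i. i < length qs \<Longrightarrow> jcode (pcode (qs ! i)) (list_encode xs) (ys ! i) \<in> set js"
    "jcode (pcode p) (list_encode ys) z \<in> set js"
    by (auto simp: All_less_Suc)
  show ?case
    by (rule certifiedI[OF t(1)])
       (use t(2,3) len in \<open>force simp: justified_def justified_by_def nthd_def intro!: bexI[OF _ t(3)]\<close>)
next
  case (primrec_0 p xs y q)
  then obtain t js where t: "certificate A t js" "jcode (pcode p) (list_encode xs) y \<in> set js"
    unfolding certified_def by blast
  show ?case
    by (rule certifiedI[OF t(1)])
       (use t(2) in \<open>simp add: justified_def justified_by_def nthd_def\<close>)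
next
  case (primrec_Suc p q n xs y z)
  then obtain t js where t: "certificate A t js"
    "jcode (pcode (PrimRec p q)) (list_encode (n # xs)) y \<in> set js"
    "jcode (pcode q) (list_encode (n # y # xs)) z \<in> set js"
    using certified_two by metis
  show ?case
    by (rule certifiedI[OF t(1)])
       (use t(3) in \<open>auto simp: justified_def justified_by_def nthd_def intro!: bexI[OF _ t(2)]\<close>)
next
  case (minimize p n xs h)
  have "\<forall>i<Suc n. certified A p (i # xs) (if i < n then Suc (h i) else 0)"
    using minimize.IH by (auto simp: less_Suc_eq)
  from certified_all[OF this] obtain t js where t: "certificate A t js"
    "\<And>i. i < n \<Longrightarrow> jcode (pcode p) (list_encode (i # xs)) (Suc (h i)) \<in> set js"
    "jcode (pcode p) (list_encode (n # xs)) 0 \<in> set js"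
    by (auto simp: All_less_Suc)
  show ?case
    by (rule certifiedI[OF t(1)])
       (use t(2,3) in \<open>force simp: justified_def justified_by_def nthd_def\<close>)
qed

text \<open>The certified computation queries \<open>a s\<close>, a function computed from the
  number \<open>s\<close>, and not the oracle of the checking machine. The latter supplies odds,
  whereas \<open>s\<close> runs through finite approximations of names.\<close>

lemma rc_justified:
  assumes o: "rc D (push (push emp)) (\<lambda>A c. a (snd (fst c)) (snd c))"
    and [rc_intros]: "rc D K s" "rc D K t" "rc D K cs" "rc D K j"
  shows "decid D K (\<lambda>A c. justified (a (s A c)) (t A c) (set (list_decode (cs A c))) (j A c))"
proof -
  have o' [rc_intros]: "rc D K' (\<lambda>A c. a (f A c) (g A c))" if "rc D K' f" "rc D K' g" for K' :: "'c ctx" and f g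
    by (rule rc_subst2[OF o that])
  have "decid D (push (push (push (push emp)))) (\<lambda>A c. justified (a (snd (fst (fst (fst c)))))
      (snd (fst (fst c))) (set (list_decode (snd (fst c)))) (snd c))"
    unfolding justified_def justified_by_def if_bool_eq_conj by (intro rc_intros rc_subst2[OF o])
  from rc_subst4[OF this[unfolded decid_def], OF assms(2-5)] show ?thesis
    unfolding decid_def by simp
qed

section \<open>Mass distributions on the binary tree\<close>

definition mass_distribution :: "(bool list \<Rightarrow> real) \<Rightarrow> bool" where
  "mass_distribution \<rho> \<longleftrightarrow> (\<forall>w. 0 \<le> \<rho> w) \<and> (\<forall>w. \<rho> w = \<rho> (w @ [False]) + \<rho> (w @ [True]))"

lemma mass_distribution_nonneg: "mass_distribution \<rho> \<Longrightarrow> 0 \<le> \<rho> w"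
  unfolding mass_distribution_def by blast

lemma mass_distribution_split: "mass_distribution \<rho> \<Longrightarrow> \<rho> (w @ [False]) + \<rho> (w @ [True]) = \<rho> w"
  unfolding mass_distribution_def by metis

text \<open>Mass is distributed from the root downwards. A value between \<open>lo w\<close> and
  \<open>up w\<close> can always be split within the bounds of the children, because
  \<open>lo\<close> is superadditive and \<open>up\<close> is subadditive.\<close>

lemma mass_distribution_sandwich:
  fixes lo up :: "bool list \<Rightarrow> real"
  assumes lo: "\<And>w. 0 \<le> lo w" "\<And>w. lo (w @ [False]) + lo (w @ [True]) \<le> lo w"
    and up: "\<And>w. up w \<le> up (w @ [False]) + up (w @ [True])"
    and le: "\<And>w. lo w \<le> up w" "lo [] \<le> a" "a \<le> up []"
  obtains \<rho> where "mass_distribution \<rho>" "\<rho> [] = a" "\<And>w. lo w \<le> \<rho> w" "\<And>w. \<rho> w \<le> up w"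
proof -
  \<comment> \<open>The left child receives as much as its own upper bound and the lower bound of
    its sibling permit. Strings are reversed because \<open>rec_list\<close> recurses at the head
    while the tree grows at the end.\<close>
  define R where "R = rec_list a (\<lambda>b w x. let z = min (up (rev w @ [False])) (x - lo (rev w @ [True]))
    in if b then x - z else z)"
  have R: "lo (rev w) \<le> R w \<and> R w \<le> up (rev w)" for w
  proof (induction w)
    case Nil then show ?case using le by (simp add: R_def)
  next
    case (Cons b w)
    then show ?case using lo(2)[of "rev w"] up[of "rev w"] le(1)[of "rev w @ [False]"] le(1)[of "rev w @ [True]"]
      by (cases b) (auto simp: R_def Let_def min_def)
  qed
  define \<rho> where "\<rho> w = R (rev w)" for w
  have b: "lo w \<le> \<rho> w" "\<rho> w \<le> up w" for w using R[of "rev w"] by (auto simp: \<rho>_def)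
  have "mass_distribution \<rho>" unfolding mass_distribution_def
  proof (intro conjI allI)
    show "0 \<le> \<rho> w" for w using b(1)[of w] lo(1)[of w] by linarith
    show "\<rho> w = \<rho> (w @ [False]) + \<rho> (w @ [True])" for w
      by (simp add: \<rho>_def R_def Let_def)
  qed
  moreover have "\<rho> [] = a" by (simp add: \<rho>_def R_def)
  ultimately show ?thesis using b that by blast
qed

lemma finite_length [simp]: "finite {w :: bool list. length w = t}"
  using finite_lists_length_eq[of "UNIV :: bool set" t] by simp

lemma card_length: "card {w :: bool list. length w = t} = 2 ^ t"
  using card_lists_length_eq[of "UNIV :: bool set" t] by simp

lemma sum_length_Suc:
  fixes f :: "bool list \<Rightarrow> 'a :: comm_monoid_add"
  shows "(\<Sum>w | length w = Suc t \<and> P w. f w) =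
    (\<Sum>w | length w = t \<and> P (w @ [False]). f (w @ [False])) + (\<Sum>w | length w = t \<and> P (w @ [True]). f (w @ [True]))"
proof -
  have eq: "{w. length w = Suc t \<and> P w} =
     (\<lambda>w. w @ [False]) ` {w. length w = t \<and> P (w @ [False])} \<union> (\<lambda>w. w @ [True]) ` {w. length w = t \<and> P (w @ [True])}"
    (is "?L = ?A \<union> ?B")
  proof
    show "?L \<subseteq> ?A \<union> ?B"
    proof
      fix w assume "w \<in> ?L"
      then show "w \<in> ?A \<union> ?B" by (cases w rule: rev_cases; cases "last w") auto
    qed
  qed auto
  have "finite ?A" "finite ?B" "?A \<inter> ?B = {}"
    by (intro finite_imageI finite_subset[OF _ finite_length[of t]]; blast)+ blast
  then show ?thesis
    unfolding eq by (simp add: sum.union_disjoint sum.reindex inj_on_def comp_def)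
qed

lemma mass_distribution_sum_extensions:
  assumes \<rho>: "mass_distribution \<rho>" and P: "\<And>w. P w \<Longrightarrow> length w = l" and "l \<le> t"
  shows "(\<Sum>w | length w = t \<and> P (take l w). \<rho> w) = (\<Sum>w | P w. \<rho> w)"
  using \<open>l \<le> t\<close>
proof (induction t rule: dec_induct)
  case base
  show ?case proof (rule sum.cong)
    have "P (take l w) \<longleftrightarrow> P w" if "length w = l" for w using that by simp
    then show "{w. length w = l \<and> P (take l w)} = {w. P w}" using P by blast
  qed simp
next
  case (step t)
  have "(\<Sum>w | length w = Suc t \<and> P (take l w). \<rho> w) =
      (\<Sum>w | length w = t \<and> P (take l (w @ [False])). \<rho> (w @ [False])) +
      (\<Sum>w | length w = t \<and> P (take l (w @ [True])). \<rho> (w @ [True]))"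
    by (rule sum_length_Suc)
  also have "\<dots> = (\<Sum>w | length w = t \<and> P (take l w). \<rho> (w @ [False])) + (\<Sum>w | length w = t \<and> P (take l w). \<rho> (w @ [True]))"
    by (rule arg_cong2[where f = "(+)"]; rule sum.cong) (use step.hyps in auto)
  also have "\<dots> = (\<Sum>w | length w = t \<and> P (take l w). \<rho> w)"
    unfolding sum.distrib[symmetric] using mass_distribution_split[OF \<rho>] by simp
  finally show ?case using step.IH by simp
qed

lemma mass_distribution_sum_length: "mass_distribution \<rho> \<Longrightarrow> (\<Sum>w | length w = t. \<rho> w) = \<rho> []"
  using mass_distribution_sum_extensions[of \<rho> "\<lambda>w. w = []" 0 t] by simp

section \<open>Minimal cuts of a growing open set\<close>

locale growing_cuts =
  fixes \<kappa> :: "bool list \<Rightarrow> real" and V :: "nat \<Rightarrow> bool list set"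
  assumes \<kappa>_nonneg: "0 \<le> \<kappa> w"
    and \<kappa>_le: "\<kappa> w \<le> \<kappa> (w @ [False]) + \<kappa> (w @ [True])"
    and \<kappa>_Nil: "\<kappa> [] = 1"
    and V_length: "v \<in> V t \<Longrightarrow> length v = t"
    and V_snoc: "v \<in> V t \<Longrightarrow> v @ [b] \<in> V (Suc t)"
begin

text \<open>The least \<open>\<kappa>\<close>-weight of a set of strings covering the part of
  \<open>V t\<close> below \<open>w\<close>: either \<open>w\<close> itself is taken or both halves
  are cut separately. \<open>j\<close> counts the levels down to \<open>t\<close>.\<close>

primrec cut_aux :: "nat \<Rightarrow> nat \<Rightarrow> bool list \<Rightarrow> real" where
  "cut_aux t 0 w = (if w \<in> V t then \<kappa> w else 0)"
| "cut_aux t (Suc j) w = min (\<kappa> w) (cut_aux t j (w @ [False]) + cut_aux t j (w @ [True]))"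

definition cut :: "nat \<Rightarrow> bool list \<Rightarrow> real" where
  "cut t w = (if length w \<le> t then cut_aux t (t - length w) w else 0)"

definition open_path :: "nat \<Rightarrow> bool list \<Rightarrow> bool" where
  "open_path t w \<longleftrightarrow> (\<forall>k<length w. cut t (take k w) < \<kappa> (take k w))"

text \<open>A string is saturated when the cheapest cut is the string itself. There
  \<open>cut\<close> may be smaller than the sum over the children, so the values below a saturated
  string stop following \<open>cut\<close> and keep what they had before.\<close>

primrec mass :: "nat \<Rightarrow> bool list \<Rightarrow> real" where
  "mass 0 w = (if open_path 0 w then cut 0 w else 0)"
| "mass (Suc t) w = (if open_path (Suc t) w then cut (Suc t) w else mass t w)"

lemma cut_le: "cut t w \<le> \<kappa> w"
  by (cases "t - length w") (auto simp: cut_def \<kappa>_nonneg)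

lemma cut_aux_nonneg: "0 \<le> cut_aux t j w"
  by (induction j arbitrary: w) (auto simp: \<kappa>_nonneg)

lemma cut_nonneg: "0 \<le> cut t w"
  by (simp add: cut_def cut_aux_nonneg)

lemma cut_rec: "length w < t \<Longrightarrow> cut t w = min (\<kappa> w) (cut t (w @ [False]) + cut t (w @ [True]))"
  by (simp add: cut_def Suc_diff_Suc[symmetric])

lemma cut_length: "length w = t \<Longrightarrow> cut t w = (if w \<in> V t then \<kappa> w else 0)"
  by (simp add: cut_def)

text \<open>Only the leaves matter. The children of a leaf in \<open>V t\<close> lie in the next
  stage and together weigh at least \<open>\<kappa> w\<close>, so cutting at \<open>w\<close>
  remains optimal.\<close>

lemma cut_aux_mono: "cut_aux t j w \<le> cut_aux (Suc t) (Suc j) w"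
proof (induction j arbitrary: w)
  case 0 then show ?case using V_snoc \<kappa>_le[of w] by (auto simp: \<kappa>_nonneg)
next
  case (Suc j)
  have "cut_aux t j (w @ [False]) + cut_aux t j (w @ [True])
      \<le> cut_aux (Suc t) (Suc j) (w @ [False]) + cut_aux (Suc t) (Suc j) (w @ [True])"
    by (intro add_mono Suc.IH)
  then show ?case by (subst (1 2) cut_aux.simps(2)) (rule min.mono, simp_all del: cut_aux.simps)
qed

lemma cut_mono: "cut t w \<le> cut (Suc t) w"
  using cut_aux_mono[of t "t - length w" w] cut_nonneg[of "Suc t" w] by (auto simp: cut_def Suc_diff_le)

lemma open_path_snoc: "open_path t (w @ [b]) \<longleftrightarrow> open_path t w \<and> cut t w < \<kappa> w"
  by (auto simp: open_path_def less_Suc_eq)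

lemma cut_super: "cut t w < \<kappa> w \<Longrightarrow> cut t (w @ [False]) + cut t (w @ [True]) \<le> cut t w"
  using cut_rec[of w t] cut_nonneg[of t w] by (cases "length w < t") (auto simp: min_def cut_def split: if_splits)

lemma mass_le_cut: "mass t w \<le> cut t w"
  by (induction t) (auto intro: cut_nonneg order_trans[OF _ cut_mono])

lemma mass_nonneg: "0 \<le> mass t w"
  by (induction t) (auto intro: cut_nonneg)

lemma mass_mono: "mass t w \<le> mass (Suc t) w"
  using mass_le_cut[of t w] cut_mono[of t w] by auto

text \<open>If \<open>w\<close> is on an open path and unsaturated, both children follow
  \<open>cut\<close>, which is superadditive there. Otherwise both children are frozen while the
  value at \<open>w\<close> can only grow.\<close>

lemma mass_super: "mass t (w @ [False]) + mass t (w @ [True]) \<le> mass t w"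
proof (induction t)
  case 0
  show ?case using cut_super[of 0 w] by (auto simp: open_path_snoc intro: cut_nonneg)
next
  case (Suc t)
  show ?case
  proof (cases "open_path (Suc t) w \<and> cut (Suc t) w < \<kappa> w")
    case True then show ?thesis using cut_super[of "Suc t" w] by (simp add: open_path_snoc)
  next
    case False
    then have "mass (Suc t) (w @ [b]) = mass t (w @ [b])" for b by (auto simp: open_path_snoc)
    then show ?thesis using Suc mass_mono[of t w] by simp
  qed
qed

lemma mass_Nil: "mass t [] = cut t []"
  by (cases t) (auto simp: open_path_def)

lemma mass_le_Nil: "mass t w \<le> cut t []"
proof (induction w rule: rev_induct)
  case (snoc b w)
  then show ?case
    using mass_super[of t w] mass_nonneg[of t "w @ [True]"] mass_nonneg[of t "w @ [False]"]
    by (cases b) auto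
qed (simp add: mass_Nil)

text \<open>\<open>v\<close> itself is saturated at stage \<open>t\<close>. Above its shortest
  saturated prefix nothing is saturated, so at that prefix the mass equals the cut and hence the
  full capacity.\<close>

lemma mass_saturates:
  assumes "v \<in> V t" shows "\<exists>k\<le>t. mass t (take k v) = \<kappa> (take k v)"
proof -
  define k where "k = (LEAST k. cut t (take k v) = \<kappa> (take k v))"
  have t: "cut t (take t v) = \<kappa> (take t v)"
    using assms V_length by (auto simp: cut_length)
  then have k: "cut t (take k v) = \<kappa> (take k v)" "k \<le> t"
    unfolding k_def by (rule LeastI, rule Least_le)
  have "open_path t (take k v)" unfolding open_path_def
  proof (intro allI impI)
    fix i assume "i < length (take k v)"
    then have "i < k" by simp
    then have "cut t (take i v) \<noteq> \<kappa> (take i v)" unfolding k_def by (rule not_less_Least)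
    then show "cut t (take i (take k v)) < \<kappa> (take i (take k v))"
      using cut_le[of t "take i v"] \<open>i < k\<close> by (simp add: min_def)
  qed
  then have "mass t (take k v) = cut t (take k v)" by (cases t) auto
  then show ?thesis using k by auto
qed

text \<open>Max-flow min-cut: a first sandwich below the cut values gives a flow reaching \<open>V t\<close>, a second one
  completes it to total mass 1.\<close>

lemma cut_attained:
  obtains \<rho> where "mass_distribution \<rho>" "\<rho> [] = 1" "\<And>w. \<rho> w \<le> \<kappa> w" "cut t [] \<le> (\<Sum>v\<in>V t. \<rho> v)"
proof -
  \<comment> \<open>Past level \<open>t\<close> the bound continues as \<open>\<kappa>\<close> on
    extensions of \<open>V t\<close> and as 0 elsewhere, which keeps it subadditive on the whole
    tree.\<close>
  define up where "up w = (if length w \<le> t then cut t w else if take t w \<in> V t then \<kappa> w else 0)" for w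
  have up: "up w \<le> up (w @ [False]) + up (w @ [True])" for w
    using \<kappa>_le[of w] by (cases "length w" t rule: linorder_cases)
      (auto simp: up_def cut_length cut_rec intro: V_length)
  have up_nn: "0 \<le> up w" for w by (auto simp: up_def cut_nonneg \<kappa>_nonneg)
  obtain \<nu> where \<nu>: "mass_distribution \<nu>" "\<nu> [] = cut t []" "\<And>w. \<nu> w \<le> up w"
    by (rule mass_distribution_sandwich[of "\<lambda>_. 0" up "cut t []"]) (use up up_nn in \<open>auto simp: up_def cut_nonneg\<close>)
  have \<nu>_nn: "0 \<le> \<nu> w" for w using \<nu>(1) by (rule mass_distribution_nonneg)
  define lo where "lo w = (if length w \<le> t then \<nu> w else 0)" for w
  have \<nu>_le: "\<nu> w \<le> \<kappa> w" for w using \<nu>(3)[of w] cut_le[of t w] \<kappa>_nonneg[of w] by (auto simp: up_def split: if_splits)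
  obtain \<rho> where \<rho>: "mass_distribution \<rho>" "\<rho> [] = 1" "\<And>w. lo w \<le> \<rho> w" "\<And>w. \<rho> w \<le> \<kappa> w"
  proof (rule mass_distribution_sandwich[of lo \<kappa> 1])
    show "lo (w @ [False]) + lo (w @ [True]) \<le> lo w" for w
      using mass_distribution_split[OF \<nu>(1), of w] \<nu>_nn by (auto simp: lo_def)
    show "lo [] \<le> 1" using \<nu>(2) cut_le[of t "[]"] by (simp add: lo_def \<kappa>_Nil)
  qed (use \<nu>_nn \<nu>_le \<kappa>_nonneg \<kappa>_le \<kappa>_Nil in \<open>auto simp: lo_def\<close>)
  have V_sub: "V t \<subseteq> {w. length w = t}" using V_length by auto
  have "cut t [] = (\<Sum>w | length w = t. \<nu> w)" using mass_distribution_sum_length[OF \<nu>(1)] \<nu>(2) by simp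
  also have "\<dots> = (\<Sum>v\<in>V t. \<nu> v)"
  proof (rule sum.mono_neutral_right[OF finite_length V_sub], rule ballI)
    fix w assume "w \<in> {w. length w = t} - V t"
    then show "\<nu> w = 0" using \<nu>(3)[of w] \<nu>_nn[of w] by (auto simp: up_def cut_length)
  qed
  also have "\<dots> \<le> (\<Sum>v\<in>V t. \<rho> v)"
    by (rule sum_mono) (use \<rho>(3) V_length lo_def in \<open>metis order_refl\<close>)
  finally show ?thesis using \<rho> that by blast
qed

end

section \<open>Measures on Cantor space\<close>

text \<open>Lets measurability of a map into Cantor space be checked coordinatewise in
  \<open>mass_distribution_measure\<close>.\<close>

instance bool :: second_countable_topology
proof
  show "\<exists>B :: bool set set. countable B \<and> open = generate_topology B"
    by (intro exI[of _ "range lessThan \<union> range greaterThan"]) (auto simp: open_bool_def)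
qed

lemma length_initial_segment [simp]: "length (initial_segment X n) = n"
  by (simp add: initial_segment_def)

lemma initial_segment_0 [simp]: "initial_segment X 0 = []"
  by (simp add: initial_segment_def)

lemma initial_segment_Suc: "initial_segment X (Suc n) = initial_segment X n @ [X n]"
  by (simp add: initial_segment_def)

lemma take_initial_segment: "take k (initial_segment X n) = initial_segment X (min k n)"
  by (simp add: initial_segment_def take_map min_def)

lemma in_cylinder: "X \<in> cylinder w \<longleftrightarrow> (\<forall>i<length w. X i = w ! i)"
  unfolding cylinder_def initial_segment_def mem_Collect_eq list_eq_iff_nth_eq by simp

lemma initial_segment_in_cylinder: "X \<in> cylinder (initial_segment X n)"
  by (simp add: cylinder_def)

lemma cylinder_Nil [simp]: "cylinder [] = UNIV"
  by (auto simp: in_cylinder)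

lemma cylinder_take: "cylinder w \<subseteq> cylinder (take k w)"
  by (auto simp: in_cylinder)

lemma cylinder_borel [measurable]: "cylinder w \<in> sets borel"
proof -
  have "closed (\<Inter>i\<in>{..<length w}. (\<lambda>X :: nat \<Rightarrow> bool. X i) -` {w ! i})"
    by (intro closed_INT ballI closed_vimage[OF closed_singleton continuous_on_product_coordinates])
  also have "(\<Inter>i\<in>{..<length w}. (\<lambda>X :: nat \<Rightarrow> bool. X i) -` {w ! i}) = cylinder w"
    by (rule set_eqI) (simp only: in_cylinder INT_iff vimage_eq lessThan_iff singleton_iff Ball_def)
  finally show ?thesis by (rule borel_closed)
qed

lemma cylinder_disjoint: "length u = length v \<Longrightarrow> u \<noteq> v \<Longrightarrow> cylinder u \<inter> cylinder v = {}"
  by (auto simp: cylinder_def)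

locale cantor_measure =
  fixes \<mu> :: "(nat \<Rightarrow> bool) measure"
  assumes \<mu>: "cantor_prob_measure \<mu>"

sublocale cantor_measure \<subseteq> prob_space \<mu>
  using \<mu> by (simp add: cantor_prob_measure_def)

context cantor_measure
begin

lemma sets_\<mu> [simp, measurable_cong]: "sets \<mu> = sets borel"
  using \<mu> by (simp add: cantor_prob_measure_def)

lemma space_\<mu> [simp]: "space \<mu> = UNIV"
  using sets_eq_imp_space_eq[OF sets_\<mu>] by simp

lemma measure_cylinder_union:
  assumes "\<And>u. u \<in> C \<Longrightarrow> length u = l"
  shows "measure \<mu> (\<Union>u\<in>C. cylinder u) = (\<Sum>u\<in>C. measure \<mu> (cylinder u))"
proof (rule finite_measure_finite_Union)
  show "finite C" using assms by (intro finite_subset[OF _ finite_length[of l]]) auto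
  show "disjoint_family_on cylinder C"
    unfolding disjoint_family_on_def using assms cylinder_disjoint by metis
qed auto

lemma measure_cylinder_LIMSEQ: "(\<lambda>n. measure \<mu> (cylinder (initial_segment X n))) \<longlonglongrightarrow> measure \<mu> {X}"
proof -
  have "Y \<in> (\<Inter>n. cylinder (initial_segment X n)) \<longleftrightarrow> (\<forall>i. Y i = X i)" for Y
  proof -
    have "Y \<in> cylinder (initial_segment X n) \<longleftrightarrow> (\<forall>i<n. Y i = X i)" for n
      unfolding in_cylinder by (simp add: initial_segment_def)
    then show ?thesis by blast
  qed
  then have "(\<Inter>n. cylinder (initial_segment X n)) = {X}"
    unfolding set_eq_iff singleton_iff fun_eq_iff by blast
  moreover have "(\<lambda>n. measure \<mu> (cylinder (initial_segment X n))) \<longlonglongrightarrow> measure \<mu> (\<Inter>n. cylinder (initial_segment X n))"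
  proof (rule finite_Lim_measure_decseq)
    show "decseq (\<lambda>n. cylinder (initial_segment X n))"
      by (rule decseq_SucI) (auto simp: in_cylinder initial_segment_def nth_append)
  qed auto
  ultimately show ?thesis by simp
qed

end

text \<open>The distribution function construction: \<open>u\<close> in the unit interval is sent to the branch along
  which it lies in the interval allotted to each node.\<close>

lemma mass_distribution_measure:
  assumes \<rho>: "mass_distribution \<rho>" and one: "\<rho> [] = 1"
  shows "\<exists>\<mu>. cantor_prob_measure \<mu> \<and> (\<forall>w. measure \<mu> (cylinder w) = \<rho> w)"
proof -
  \<comment> \<open>\<open>a w\<close> is the left end of the interval of \<open>w\<close>: the mass
    of all siblings left of the path. The intervals are half-open, so each level partitions the unit
    interval.\<close>
  define a where "a w = (\<Sum>k<length w. if w ! k then \<rho> (take k w @ [False]) else 0)" for w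
  have a_Nil: "a [] = 0" by (simp add: a_def)
  have a_snoc: "a (w @ [b]) = a w + (if b then \<rho> (w @ [False]) else 0)" for w b
    unfolding a_def by (auto simp: nth_append intro!: sum.cong)
  define seg where "seg u = rec_nat [] (\<lambda>_ w. w @ [a w + \<rho> (w @ [False]) \<le> u])" for u :: real
  have seg_0: "seg u 0 = []" and seg_Suc: "seg u (Suc n) = seg u n @ [a (seg u n) + \<rho> (seg u n @ [False]) \<le> u]" for u n
    by (simp_all add: seg_def)
  have len: "length (seg u n) = n" for u n by (induction n) (simp_all add: seg_0 seg_Suc)
  define X where "X u n = (a (seg u n) + \<rho> (seg u n @ [False]) \<le> u)" for u n
  have seg_X: "initial_segment (X u) n = seg u n" for u n
    by (induction n) (simp_all add: seg_0 seg_Suc initial_segment_Suc X_def)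
  have seg_iff: "seg u (length w) = w \<longleftrightarrow> a w \<le> u \<and> u < a w + \<rho> w" if u: "0 \<le> u" "u < 1" for u w
  proof (induction w rule: rev_induct)
    case Nil then show ?case using u by (simp add: seg_0 a_Nil one)
  next
    case (snoc b w)
    have "seg u (length (w @ [b])) = w @ [b] \<longleftrightarrow> seg u (length w) = w \<and> b = (a w + \<rho> (w @ [False]) \<le> u)"
      by (auto simp: seg_Suc)
    then show ?case using snoc mass_distribution_split[OF \<rho>, of w] mass_distribution_nonneg[OF \<rho>, of "w @ [False]"]
      mass_distribution_nonneg[OF \<rho>, of "w @ [True]"]
      by (cases b) (auto simp: a_snoc)
  qed
  let ?U = "restrict_space lborel {0..<1::real}"
  have U_space: "space ?U = {0..<1}" by (simp add: space_restrict_space)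
  have emU: "emeasure ?U B = emeasure lborel B" if "B \<in> sets ?U" for B
    using that by (subst emeasure_restrict_space) (auto simp: sets_restrict_space)
  interpret U: prob_space ?U
    by (rule prob_spaceI) (simp add: emeasure_restrict_space U_space)
  have level: "{u \<in> space ?U. seg u n = w} = (if length w = n then {a w..<a w + \<rho> w} \<inter> {0..<1} else {})" for n w
    using seg_iff[of _ w] len[of _ n] by (auto simp: U_space)
  have seg_sets: "{u \<in> space ?U. seg u n = w} \<in> sets ?U" for n w
    unfolding level by (auto simp: sets_restrict_space)
  have X_coord: "(\<lambda>u. X u n) \<in> measurable ?U borel" for n
  proof -
    have "(\<lambda>u. X u n) -` B \<inter> space ?U \<in> sets ?U" for B
    proof -
      have "(\<lambda>u. X u n) -` B \<inter> space ?U =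
          (\<Union>w\<in>{w. length w = Suc n \<and> w ! n \<in> B}. {u \<in> space ?U. seg u (Suc n) = w})"
        using len by (auto simp: seg_Suc X_def nth_append)
      also have "\<dots> \<in> sets ?U"
        by (intro sets.finite_UN seg_sets finite_subset[OF _ finite_length[of "Suc n"]]) auto
      finally show ?thesis .
    qed
    then show ?thesis by (intro measurableI) auto
  qed
  have X_meas: "X \<in> measurable ?U borel"
    by (rule measurable_coordinatewise_then_product) (rule X_coord)
  have interval: "{u \<in> space ?U. seg u (length w) = w} = {a w..<a w + \<rho> w}" for w
  proof -
    have "0 \<le> a w \<and> a w + \<rho> w \<le> 1"
    proof (induction w rule: rev_induct)
      case (snoc b w)
      then show ?case using mass_distribution_split[OF \<rho>, of w] mass_distribution_nonneg[OF \<rho>, of "w @ [False]"]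
        mass_distribution_nonneg[OF \<rho>, of "w @ [True]"] by (cases b) (auto simp: a_snoc)
    qed (simp add: a_Nil one)
    then show ?thesis unfolding level by auto
  qed
  have "measure (distr ?U borel X) (cylinder w) = \<rho> w" for w
  proof -
    have "measure (distr ?U borel X) (cylinder w) = measure ?U (X -` cylinder w \<inter> space ?U)"
      by (rule measure_distr[OF X_meas]) simp
    also have "X -` cylinder w \<inter> space ?U = {u \<in> space ?U. seg u (length w) = w}"
      by (auto simp: cylinder_def seg_X)
    also have "\<dots> = {a w..<a w + \<rho> w}" by (rule interval)
    also have "measure ?U \<dots> = \<rho> w"
      using emU[OF seg_sets[of "length w" w, unfolded interval]] mass_distribution_nonneg[OF \<rho>, of w]
      by (simp add: measure_def)
    finally show ?thesis .
  qed
  moreover have "cantor_prob_measure (distr ?U borel X)"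
    unfolding cantor_prob_measure_def using U.prob_space_distr[OF X_meas] by simp
  ultimately show ?thesis by blast
qed

section \<open>Compactness\<close>

text \<open>\<open>Q w\<close> says that below \<open>w\<close> every stage can be reached, by a
  sequence that may depend on the stage. If one stage refuted the left child and another the right
  child, the larger of the two would refute \<open>w\<close>; so \<open>Q\<close> propagates along a
  path.\<close>

lemma koenig:
  fixes P :: "(nat \<Rightarrow> bool) \<Rightarrow> nat \<Rightarrow> bool"
  assumes local: "\<And>y y' t. \<forall>i<t. y i = y' i \<Longrightarrow> P y t \<Longrightarrow> P y' t"
    and antimono: "\<And>y t t'. P y t' \<Longrightarrow> t \<le> t' \<Longrightarrow> P y t"
    and ex: "\<And>t. \<exists>y. P y t"
  shows "\<exists>y. \<forall>t. P y t"
proof -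
  define Q where "Q w \<longleftrightarrow> (\<forall>t. \<exists>y. initial_segment y (length w) = w \<and> P y t)" for w
  have Q_snoc: "Q (w @ [False]) \<or> Q (w @ [True])" if Qw: "Q w" for w
  proof (rule ccontr)
    assume "\<not> ?thesis"
    then obtain t0 t1 where
      t: "\<And>y. initial_segment y (Suc (length w)) = w @ [False] \<Longrightarrow> \<not> P y t0"
         "\<And>y. initial_segment y (Suc (length w)) = w @ [True] \<Longrightarrow> \<not> P y t1"
      unfolding Q_def by auto
    obtain y where y: "initial_segment y (length w) = w" "P y (max t0 t1)"
      using Qw unfolding Q_def by blast
    then have "P y t0" "P y t1" using antimono by (meson max.cobounded1 max.cobounded2)+
    then show False using t[of y] y(1) by (cases "y (length w)") (auto simp: initial_segment_Suc)
  qed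
  define f where "f = rec_nat [] (\<lambda>_ w. w @ [\<not> Q (w @ [False])])"
  have f_Suc: "f (Suc n) = f n @ [\<not> Q (f n @ [False])]" and f_0: "f 0 = []" for n by (simp_all add: f_def)
  have Qf: "Q (f n)" for n
  proof (induction n)
    case 0 then show ?case using ex by (simp add: f_0 Q_def)
  next
    case (Suc n) then show ?case using Q_snoc[of "f n"] by (cases "Q (f n @ [False])") (simp_all add: f_Suc)
  qed
  define y where "y n = (\<not> Q (f n @ [False]))" for n
  have seg: "initial_segment y n = f n" for n
    by (induction n) (simp_all add: initial_segment_Suc f_0 f_Suc y_def)
  have "P y t" for t
  proof -
    have lf: "length (f t) = t" by (metis seg length_initial_segment)
    obtain y' where y': "initial_segment y' t = f t" "P y' t" using Qf[of t] lf unfolding Q_def by metis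
    then have "initial_segment y' t = initial_segment y t" using seg by simp
    then have "\<forall>i<t. y' i = y i" by (simp add: initial_segment_def)
    then show ?thesis using local y'(2) by blast
  qed
  then show ?thesis by blast
qed

section \<open>Binary names of mass distributions\<close>

text \<open>\<open>y\<close> lists, for each string \<open>w\<close>, the binary digits of the mass of \<open>w\<close>; \<open>digits y w k\<close> is the
  integer given by the first \<open>k\<close> of them.\<close>

definition digits :: "(nat \<Rightarrow> bool) \<Rightarrow> bool list \<Rightarrow> nat \<Rightarrow> nat" where
  "digits y w k = (\<Sum>i<k. of_bool (y (prod_encode (str_code w, i))) * 2 ^ (k - Suc i))"

text \<open>Both inequalities are weak, so that a total mass of 1 is named by the digits 0.111...;
  there is no integer part, as \<open>digits y w 0 = 0\<close>.\<close>

definition names :: "(nat \<Rightarrow> bool) \<Rightarrow> (bool list \<Rightarrow> real) \<Rightarrow> bool" where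
  "names y \<rho> \<longleftrightarrow> (\<forall>w k. real (digits y w k) \<le> \<rho> w * 2 ^ k \<and> \<rho> w * 2 ^ k \<le> real (digits y w k) + 1)"

lemma digits_0 [simp]: "digits y w 0 = 0"
  by (simp add: digits_def)

lemma digits_Suc: "digits y w (Suc k) = 2 * digits y w k + of_bool (y (prod_encode (str_code w, k)))"
proof -
  have "(\<Sum>i<k. of_bool (y (prod_encode (str_code w, i))) * 2 ^ (Suc k - Suc i)) = 2 * digits y w k"
    unfolding digits_def sum_distrib_left
    by (rule sum.cong) (auto simp: Suc_diff_Suc simp flip: power_Suc)
  then show ?thesis by (simp add: digits_def)
qed

lemma digits_bounds: "2 ^ j * digits y w k \<le> digits y w (k + j) \<and> digits y w (k + j) < 2 ^ j * (digits y w k + 1)"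
  by (induction j) (auto simp: digits_Suc)

text \<open>The supremum of the truncations works for any bits. Hence the space of names is the full
  Cantor space, and whether the named function is a mass distribution becomes a separate closed
  condition.\<close>

lemma ex_names: obtains \<rho> where "names y \<rho>"
proof -
  have "\<exists>x. \<forall>k. real (digits y w k) \<le> x * 2 ^ k \<and> x * 2 ^ k \<le> real (digits y w k) + 1" for w
  proof -
    let ?a = "\<lambda>k. digits y w k / 2 ^ k :: real"
    have le: "?a m \<le> (digits y w k + 1) / 2 ^ k" for m k
    proof (cases "m \<le> k")
      case True
      then obtain j where k: "k = m + j" using le_Suc_ex by blast
      have "real (2 ^ j * digits y w m) \<le> digits y w k" using digits_bounds[where k = m and j = j] k by (simp only: of_nat_le_iff)
      then show ?thesis by (simp add: k power_add field_simps)
    next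
      case False
      then obtain j where m: "m = k + j" using le_Suc_ex nat_le_linear by blast
      have "real (digits y w m) < real (2 ^ j * (digits y w k + 1))"
        using digits_bounds[where k = k and j = j] m by (simp only: of_nat_less_iff)
      then show ?thesis by (simp add: m power_add field_simps)
    qed
    then have "bdd_above (range ?a)" by (intro bdd_aboveI2[of _ _ "(digits y w 0 + 1) / 2 ^ 0"]) blast
    then have "?a k \<le> (SUP m. ?a m)" "(SUP m. ?a m) \<le> (digits y w k + 1) / 2 ^ k" for k
      using le by (auto intro: cSUP_upper cSUP_least)
    then show ?thesis by (intro exI[of _ "SUP m. ?a m"]) (simp add: field_simps)
  qed
  then have "\<exists>\<rho>. names y \<rho>" unfolding names_def by metis
  then show ?thesis using that by blast
qed

lemma ex_names_of:
  assumes "\<And>w. 0 \<le> \<rho> w" "\<And>w. \<rho> w \<le> 1"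
  obtains y where "names y \<rho>"
proof -
  \<comment> \<open>\<open>\<lceil>z\<rceil> - 1\<close> in place of the floor picks the expansion
    that does not end in zeros, which gives 1 the digits 0.111...; for \<open>z = 0\<close> the
    conversion \<open>nat\<close> turns -1 into 0.\<close>
  define y where "y i = odd (nat (\<lceil>\<rho> (str (fst (prod_decode i))) * 2 ^ Suc (snd (prod_decode i))\<rceil> - 1))" for i
  have step: "nat (\<lceil>2 * z\<rceil> - 1) = 2 * nat (\<lceil>z\<rceil> - 1) + of_bool (odd (nat (\<lceil>2 * z\<rceil> - 1)))" if "0 \<le> z" for z :: real
  proof -
    have "\<lceil>2 * z\<rceil> = 2 * \<lceil>z\<rceil> \<or> \<lceil>2 * z\<rceil> = 2 * \<lceil>z\<rceil> - 1" by linarith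
    moreover have "0 \<le> \<lceil>z\<rceil>" using that by linarith
    moreover have "z = 0" if "\<lceil>z\<rceil> = 0" using \<open>0 \<le> z\<close> that by linarith
    ultimately show ?thesis
    proof (cases "\<lceil>z\<rceil> = 0")
      case False
      define d where "d = nat (\<lceil>z\<rceil> - 1)"
      have d: "\<lceil>z\<rceil> = int d + 1" using False \<open>0 \<le> \<lceil>z\<rceil>\<close> unfolding d_def by linarith
      have "\<lceil>2 * z\<rceil> - 1 = int (2 * d + 1) \<or> \<lceil>2 * z\<rceil> - 1 = int (2 * d)"
        using \<open>\<lceil>2 * z\<rceil> = 2 * \<lceil>z\<rceil> \<or> \<lceil>2 * z\<rceil> = 2 * \<lceil>z\<rceil> - 1\<close> d by force
      then have "nat (\<lceil>2 * z\<rceil> - 1) = 2 * d + 1 \<or> nat (\<lceil>2 * z\<rceil> - 1) = 2 * d" by (metis nat_int)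
      then show ?thesis unfolding d_def[symmetric] by auto
    qed simp
  qed
  have "digits y w k = nat (\<lceil>\<rho> w * 2 ^ k\<rceil> - 1)" for w k
  proof (induction k)
    case 0 then show ?case using assms(2)[of w] by simp
  next
    case (Suc k)
    show ?case using step[of "\<rho> w * 2 ^ k"] assms(1)[of w] Suc by (simp add: digits_Suc y_def mult_ac)
  qed
  moreover have "real (nat (\<lceil>z\<rceil> - 1)) \<le> z \<and> z \<le> real (nat (\<lceil>z\<rceil> - 1)) + 1" if "0 \<le> z" for z :: real
    using that by linarith
  ultimately have "names y \<rho>" unfolding names_def using assms(1) by (metis mult_nonneg_nonneg zero_le_numeral zero_le_power)
  then show ?thesis using that by blast
qed

definition name_oracle :: "(nat \<Rightarrow> bool) \<Rightarrow> nat \<Rightarrow> nat" where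
  "name_oracle y i = rat_code (of_nat (digits y (str (fst (prod_decode i))) (snd (prod_decode i))) / of_nat (2 ^ snd (prod_decode i)))"

lemma name_oracle_represents:
  assumes "names y (\<lambda>w. measure \<mu> (cylinder w))" shows "represents (name_oracle y) \<mu>"
  unfolding represents_def
proof (intro allI exI conjI)
  fix w n
  let ?q = "of_nat (digits y w n) / of_nat (2 ^ n) :: rat"
  show "name_oracle y (prod_encode (str_code w, n)) = rat_code ?q" by (simp add: name_oracle_def)
  have "real_of_rat ?q = digits y w n / 2 ^ n" by (simp add: of_rat_divide of_rat_power)
  moreover have "\<bar>digits y w n - measure \<mu> (cylinder w) * 2 ^ n\<bar> \<le> 1"
    using assms unfolding names_def by (smt (verit, best))
  ultimately show "\<bar>real_of_rat ?q - measure \<mu> (cylinder w)\<bar> \<le> 1 / 2 ^ n"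
    by (simp add: field_simps abs_le_iff)
qed

lemma prod_encode_less: "k < k' \<Longrightarrow> prod_encode (x, k) < prod_encode (x, k')"
proof (induction k' rule: less_Suc_induct)
  case (1 k) then show ?case by (simp add: prod_encode_def)
qed simp

lemma prod_encode_mono: "x \<le> x' \<Longrightarrow> k \<le> k' \<Longrightarrow> prod_encode (x, k) \<le> prod_encode (x', k')"
proof -
  assume "x \<le> x'" "k \<le> k'"
  moreover have "triangle a \<le> triangle b" if "a \<le> b" for a b
    using that by (induction rule: dec_induct) auto
  ultimately show ?thesis unfolding prod_encode_def by (simp add: add_mono)
qed

lemma digits_cong:
  assumes "\<And>i. i < t \<Longrightarrow> y i = y' i" "prod_encode (str_code w, k) \<le> t"
  shows "digits y w k = digits y' w k"
  unfolding digits_def using assms prod_encode_less[of _ k "str_code w"]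
  by (intro sum.cong) (auto intro: less_le_trans)

text \<open>The answer to query \<open>i = prod_encode (x, k)\<close> reads bits
  \<open>prod_encode (x, k')\<close> with \<open>k' < k\<close> only, and these lie below
  \<open>i\<close>. A query bound is therefore also a bound on the bits used.\<close>

lemma name_oracle_cong:
  assumes "\<And>i. i < t \<Longrightarrow> y i = y' i" "i < t" shows "name_oracle y i = name_oracle y' i"
  unfolding name_oracle_def using digits_cong[of t y y' "str (fst (prod_decode i))" "snd (prod_decode i)"] assms
  by simp

text \<open>Additivity, total mass 1 and the bound \<open>1 / 2 ^ L w\<close>, seen at precision
  \<open>k\<close>. Each truncation loses at most one unit; this gives slack 1 where one value is
  rounded down on the larger side, and 2 where two are.\<close>

definition name_ok :: "(bool list \<Rightarrow> nat) \<Rightarrow> (nat \<Rightarrow> bool) \<Rightarrow> bool list \<Rightarrow> nat \<Rightarrow> bool" where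
  "name_ok L y w k \<longleftrightarrow>
     digits y (w @ [False]) k + digits y (w @ [True]) k \<le> digits y w k + 1 \<and>
     digits y w k \<le> digits y (w @ [False]) k + digits y (w @ [True]) k + 2 \<and>
     (str_code w = 0 \<longrightarrow> 2 ^ k \<le> digits y w k + 1) \<and>
     digits y w k * 2 ^ L w \<le> 2 ^ k"

text \<open>Only conditions confined to the first \<open>t\<close> bits are checked; among the three
  strings in \<open>name_ok\<close>, the one ending in \<open>True\<close> has the largest
  code.\<close>

definition bounded_name :: "(bool list \<Rightarrow> nat) \<Rightarrow> (nat \<Rightarrow> bool) \<Rightarrow> nat \<Rightarrow> bool" where
  "bounded_name L y t \<longleftrightarrow> (\<forall>x<t. \<forall>k<t. prod_encode (str_code (str x @ [True]), k) < t \<longrightarrow> name_ok L y (str x) k)"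

lemma bounded_name_antimono: "bounded_name L y t' \<Longrightarrow> t \<le> t' \<Longrightarrow> bounded_name L y t"
  unfolding bounded_name_def by (meson less_le_trans)

lemma bounded_name_cong:
  assumes "\<And>i. i < t \<Longrightarrow> y i = y' i" shows "bounded_name L y t = bounded_name L y' t"
proof -
  have "name_ok L y (str x) k = name_ok L y' (str x) k"
    if t: "prod_encode (str_code (str x @ [True]), k) < t" for x k
  proof -
    have "prod_encode (str_code (str x), k) \<le> prod_encode (str_code (str x @ [True]), k)"
      "prod_encode (str_code (str x @ [False]), k) \<le> prod_encode (str_code (str x @ [True]), k)"
      by (intro prod_encode_mono; simp add: str_code_snoc)+
    then have "digits y (str x) k = digits y' (str x) k" "digits y (str x @ [False]) k = digits y' (str x @ [False]) k"
      "digits y (str x @ [True]) k = digits y' (str x @ [True]) k"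
      using t by (intro digits_cong[of t, OF assms]; linarith)+
    then show ?thesis by (simp only: name_ok_def)
  qed
  then show ?thesis unfolding bounded_name_def by blast
qed

lemma le_if_le_plus_small:
  fixes x y c :: real assumes "\<And>k :: nat. x \<le> y + c / 2 ^ k" shows "x \<le> y"
proof (rule LIMSEQ_le_const)
  have "(\<lambda>k. y + c * (1 / 2) ^ k) \<longlonglongrightarrow> y + c * 0"
    by (intro tendsto_intros LIMSEQ_power_zero) simp
  then show "(\<lambda>k. y + c / 2 ^ k) \<longlonglongrightarrow> y" by (simp add: power_one_over)
qed (use assms in blast)

lemma bounded_name_mass_distribution:
  assumes "names y \<rho>" "\<And>t. bounded_name L y t"
  shows "mass_distribution \<rho>" "\<rho> [] = 1" "\<rho> w \<le> 1 / 2 ^ L w"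
proof -
  have n: "digits y w k \<le> \<rho> w * 2 ^ k" "\<rho> w * 2 ^ k \<le> real (digits y w k) + 1" for w k
    using assms(1) unfolding names_def by blast+
  have ok: "name_ok L y w k" for w k
    using assms(2)[of "Suc (str_code w + k + prod_encode (str_code (w @ [True]), k))",
      unfolded bounded_name_def, rule_format, of "str_code w" k] by simp
  have b: "digits y (w @ [False]) k + digits y (w @ [True]) k \<le> digits y w k + 1"
    "digits y w k \<le> digits y (w @ [False]) k + digits y (w @ [True]) k + 2"
    "w = [] \<Longrightarrow> 2 ^ k \<le> digits y w k + 1" "digits y w k * 2 ^ L w \<le> 2 ^ k" for w k
    using ok[of w k] by (auto simp: name_ok_def)
  have nn: "0 \<le> \<rho> w" for w using n[where k = 0] by simp
  have 1: "\<rho> (w @ [False]) + \<rho> (w @ [True]) \<le> \<rho> w + 3 / 2 ^ k" for w k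
  proof -
    have "real (digits y (w @ [False]) k + digits y (w @ [True]) k) \<le> real (digits y w k + 1)"
      using b(1) of_nat_mono by blast
    then have "(\<rho> (w @ [False]) + \<rho> (w @ [True])) * 2 ^ k \<le> \<rho> w * 2 ^ k + 3"
      using n(1)[of w k] n(2)[of "w @ [False]" k] n(2)[of "w @ [True]" k] by (simp add: algebra_simps)
    then show ?thesis by (simp add: field_simps)
  qed
  have 2: "\<rho> w \<le> \<rho> (w @ [False]) + \<rho> (w @ [True]) + 3 / 2 ^ k" for w k
  proof -
    have "real (digits y w k) \<le> real (digits y (w @ [False]) k + digits y (w @ [True]) k + 2)"
      using b(2) of_nat_mono by blast
    then have "\<rho> w * 2 ^ k \<le> (\<rho> (w @ [False]) + \<rho> (w @ [True])) * 2 ^ k + 3"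
      using n(2)[of w k] n(1)[of "w @ [False]" k] n(1)[of "w @ [True]" k] by (simp add: algebra_simps)
    then show ?thesis by (simp add: field_simps)
  qed
  show "mass_distribution \<rho>" unfolding mass_distribution_def
    using nn le_if_le_plus_small[OF 1] le_if_le_plus_small[OF 2] by (meson order_antisym)
  have "1 \<le> \<rho> [] + 1 / 2 ^ k" for k
  proof -
    have "real (2 ^ k) \<le> real (digits y [] k + 1)" using b(3) of_nat_mono by blast
    then have "2 ^ k \<le> \<rho> [] * 2 ^ k + 1" using n(1)[of "[]" k] by simp
    then show ?thesis by (simp add: field_simps)
  qed
  then have "1 \<le> \<rho> []" by (rule le_if_le_plus_small)
  moreover have "\<rho> [] \<le> 1" using n(2)[of "[]" 0] by simp
  ultimately show "\<rho> [] = 1" by simp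
  have "\<rho> w \<le> 1 / 2 ^ L w + 1 / 2 ^ k" for k
  proof -
    have "real (digits y w k * 2 ^ L w) \<le> real (2 ^ k)" using b(4) of_nat_mono by blast
    then have "real (digits y w k) \<le> 2 ^ k / 2 ^ L w" by (simp add: field_simps)
    then have "\<rho> w * 2 ^ k \<le> 2 ^ k / 2 ^ L w + 1" using n(2)[of w k] by simp
    then have "\<rho> w \<le> (2 ^ k / 2 ^ L w + 1) / 2 ^ k" by (simp add: field_simps)
    then show ?thesis by (simp add: add_divide_distrib)
  qed
  then show "\<rho> w \<le> 1 / 2 ^ L w" by (rule le_if_le_plus_small)
qed

lemma mass_distribution_bounded_name:
  assumes \<rho>: "mass_distribution \<rho>" "\<rho> [] = 1" "\<And>w. \<rho> w \<le> 1 / 2 ^ L w" and y: "names y \<rho>"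
  shows "bounded_name L y t"
  unfolding bounded_name_def name_ok_def
proof (intro allI impI conjI)
  fix x k
  have n: "digits y w k \<le> \<rho> w * 2 ^ k" "\<rho> w * 2 ^ k \<le> real (digits y w k) + 1" for w
    using y unfolding names_def by blast+
  let ?w = "str x"
  have s: "\<rho> (?w @ [False]) * 2 ^ k + \<rho> (?w @ [True]) * 2 ^ k = \<rho> ?w * 2 ^ k"
    unfolding distrib_right[symmetric] mass_distribution_split[OF \<rho>(1)] ..
  have "real (digits y (?w @ [False]) k + digits y (?w @ [True]) k) \<le> real (digits y ?w k + 1)"
    using n(1)[of "?w @ [False]"] n(1)[of "?w @ [True]"] n(2)[of ?w] s by simp
  then show "digits y (?w @ [False]) k + digits y (?w @ [True]) k \<le> digits y ?w k + 1" by linarith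
  have "real (digits y ?w k) \<le> real (digits y (?w @ [False]) k + digits y (?w @ [True]) k + 2)"
    using n(2)[of "?w @ [False]"] n(2)[of "?w @ [True]"] n(1)[of ?w] s by simp
  then show "digits y ?w k \<le> digits y (?w @ [False]) k + digits y (?w @ [True]) k + 2" by linarith
  have "real (digits y ?w k * 2 ^ L ?w) \<le> real (2 ^ k)"
  proof -
    have "digits y ?w k * 2 ^ L ?w \<le> \<rho> ?w * 2 ^ k * 2 ^ L ?w" using n(1)[of ?w] by simp
    also have "\<dots> = (\<rho> ?w * 2 ^ L ?w) * 2 ^ k" by simp
    also have "\<dots> \<le> 1 * 2 ^ k" using \<rho>(3)[of ?w] by (intro mult_right_mono) (auto simp: field_simps)
    finally show ?thesis by simp
  qed
  then show "digits y ?w k * 2 ^ L ?w \<le> 2 ^ k" by (simp only: of_nat_le_iff)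
  assume "str_code ?w = 0"
  then have w: "?w = []" by (simp only: str_code_eq_0)
  have "real (2 ^ k) \<le> real (digits y ?w k + 1)" using n(2)[of "[]"] \<rho>(2) unfolding w by simp
  then show "2 ^ k \<le> digits y ?w k + 1" by (simp only: of_nat_le_iff)
qed

section \<open>Tests trimmed by a name of the measure\<close>

text \<open>The single bound \<open>l\<close> limits the length of the string, the queries and the
  code of the certificate. The relation is thus decidable, and it persists when \<open>u\<close> is
  extended and \<open>l\<close> grows with it.\<close>

definition enumerated :: "(nat \<Rightarrow> bool) \<Rightarrow> nat \<Rightarrow> nat \<Rightarrow> nat \<Rightarrow> bool list \<Rightarrow> bool" where
  "enumerated y e m l u \<longleftrightarrow> length u = l \<and> (\<exists>j\<le>l. \<exists>c<l. certificate (name_oracle y) l (list_decode c) \<and>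
     (\<exists>a\<in>set (list_decode c). jprog a = e \<and> jin a = list_encode [m, str_code (take j u)]))"

text \<open>In units of \<open>1 / 2 ^ (m + l)\<close> the bound \<open>2 ^ l\<close> is
  \<open>1 / 2 ^ m\<close>. At most \<open>2 ^ l\<close> strings lose one unit each by rounding, so
  a light level has measure at most \<open>2 / 2 ^ m\<close>, while a genuine test always passes
  because \<open>digits\<close> rounds down.\<close>

definition light :: "(nat \<Rightarrow> bool) \<Rightarrow> nat \<Rightarrow> nat \<Rightarrow> nat \<Rightarrow> bool" where
  "light y e m l \<longleftrightarrow> (\<Sum>u | enumerated y e m l u. digits y u (m + l)) \<le> 2 ^ l"

text \<open>Only strings not yet seen to have large measure are accepted, so every \<open>e\<close> may take part,
  whether or not it codes a test; the shift by \<open>e + 2\<close> makes the measures sum to at most \<open>1 / 2 ^ n\<close>.\<close>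

definition universal_test :: "(nat \<Rightarrow> bool) \<Rightarrow> nat \<Rightarrow> nat \<Rightarrow> bool list \<Rightarrow> bool" where
  "universal_test y n t v \<longleftrightarrow> (\<exists>e<t. \<exists>l\<le>t. prod_encode (2 ^ Suc l, n + e + 2 + l) < t \<and>
     light y e (n + e + 2) l \<and> enumerated y e (n + e + 2) l (take l v))"

definition nat_bits :: "nat \<Rightarrow> nat \<Rightarrow> bool" where
  "nat_bits s i \<longleftrightarrow> s div 2 ^ i mod 2 = 1"

text \<open>The numbers below \<open>2 ^ t\<close> stand for all \<open>t\<close>-bit prefixes of
  names. Prefixes already refuted as names of bounded measures impose no condition.\<close>

definition covered :: "(bool list \<Rightarrow> nat) \<Rightarrow> nat \<Rightarrow> nat \<Rightarrow> bool list set" where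
  "covered L n t = {v. length v = t \<and>
     (\<forall>s<2 ^ t. bounded_name L (nat_bits s) t \<longrightarrow> universal_test (nat_bits s) n t v)}"

lemma enumerated_mono:
  assumes "enumerated y e m l (take l u)" "l \<le> length u" shows "enumerated y e m (length u) u"
proof -
  from assms(1) obtain j c a where "j \<le> l" "c < l" "certificate (name_oracle y) l (list_decode c)"
    "a \<in> set (list_decode c)" "jprog a = e" "jin a = list_encode [m, str_code (take j (take l u))]"
    unfolding enumerated_def by blast
  then show ?thesis unfolding enumerated_def using assms(2)
    by (intro conjI refl exI[of _ j] exI[of _ c] bexI[of _ a])
       (auto simp: min_absorb1 intro: certificate_mono)
qed

lemma length_enumerated: "enumerated y e m l u \<Longrightarrow> length u = l"
  by (simp add: enumerated_def)

lemma str_code_less: "str_code w < 2 ^ Suc (length w)"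
proof -
  have "str_code w + 2 \<le> 2 ^ Suc (length w)" by (induction w) auto
  then show ?thesis by linarith
qed

lemma enumerated_cong:
  assumes "\<And>i. i < t \<Longrightarrow> y i = y' i" "l \<le> t"
  shows "enumerated y e m l u = enumerated y' e m l u"
proof -
  have "certificate (name_oracle y) l js = certificate (name_oracle y') l js" for js
    using assms by (intro certificate_cong name_oracle_cong[of t]) auto
  then show ?thesis by (simp add: enumerated_def)
qed

text \<open>Strings of length \<open>l\<close> have codes below \<open>2 ^ Suc l\<close>, so the
  premise bounds every bit position that \<open>light\<close> reads; \<open>universal_test\<close>
  contains it for this reason.\<close>

lemma light_cong:
  assumes eq: "\<And>i. i < t \<Longrightarrow> y i = y' i" and "prod_encode (2 ^ Suc l, m + l) < t"
  shows "light y e m l = light y' e m l"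
proof -
  have "l \<le> t" using le_prod_encode_2[of "m + l" "2 ^ Suc l"] assms(2) by linarith
  have "digits y u (m + l) = digits y' u (m + l)" if "length u = l" for u
  proof (rule digits_cong[OF eq])
    have "prod_encode (str_code u, m + l) \<le> prod_encode (2 ^ Suc l, m + l)"
      using str_code_less[of u] that by (intro prod_encode_mono) auto
    then show "prod_encode (str_code u, m + l) \<le> t" using assms(2) by linarith
  qed
  then have "(\<Sum>u | enumerated y e m l u. digits y u (m + l)) = (\<Sum>u | enumerated y' e m l u. digits y' u (m + l))"
    using enumerated_cong[OF eq \<open>l \<le> t\<close>] length_enumerated by (intro sum.cong) auto
  then show ?thesis by (simp add: light_def)
qed

lemma universal_test_cong:
  assumes eq: "\<And>i. i < t \<Longrightarrow> y i = y' i"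
  shows "universal_test y n t v = universal_test y' n t v"
proof -
  have "light y e (n + e + 2) l = light y' e (n + e + 2) l" if "prod_encode (2 ^ Suc l, n + e + 2 + l) < t" for e l
    using light_cong[of t y y' l "n + e + 2" e] eq that by blast
  moreover have "enumerated y e (n + e + 2) l u = enumerated y' e (n + e + 2) l u" if "l \<le> t" for e l u
    using enumerated_cong[of t y y' l] eq that by blast
  ultimately show ?thesis unfolding universal_test_def by blast
qed

lemma universal_test_mono:
  "universal_test y n t v \<Longrightarrow> t \<le> t' \<Longrightarrow> universal_test y n t' v"
  unfolding universal_test_def by (meson less_le_trans order_trans)

lemma universal_test_extend:
  "universal_test y n t (take k v) \<Longrightarrow> universal_test y n t v"
proof -
  have "take l (take k v) = take l v" if "length (take l (take k v)) = l" for l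
    using that by (metis length_take min.cobounded1 min.cobounded2 min_def take_take)
  then show "universal_test y n t (take k v) \<Longrightarrow> universal_test y n t v"
    unfolding universal_test_def using length_enumerated by (metis (no_types, lifting))
qed

lemma ex_nat_bits: "\<exists>s<2 ^ t. \<forall>i<t. nat_bits s i = y i"
proof (intro exI conjI allI impI)
  show "horner_sum of_bool 2 (map y [0..<t]) < (2 :: nat) ^ t"
    using horner_sum_of_bool_2_less[of "map y [0..<t]", where ?'a = nat] by simp
  show "nat_bits (horner_sum of_bool 2 (map y [0..<t])) i = y i" if "i < t" for i
    using bit_horner_sum_bit_iff[of "map y [0..<t]" i, where ?'a = nat] that
    by (simp add: nat_bits_def bit_iff_odd odd_iff_mod_2_eq_one)
qed

lemma covered_snoc: assumes "v \<in> covered L n t" shows "v @ [b] \<in> covered L n (Suc t)"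
proof -
  have "universal_test (nat_bits s) n (Suc t) (v @ [b])" if s: "bounded_name L (nat_bits s) (Suc t)" for s
  proof -
    obtain s' where s': "s' < 2 ^ t" "\<forall>i<t. nat_bits s' i = nat_bits s i" using ex_nat_bits by blast
    have "bounded_name L (nat_bits s') t"
      using bounded_name_antimono[OF s, of t] bounded_name_cong[of t "nat_bits s'" "nat_bits s" L] s' by simp
    then have "universal_test (nat_bits s') n t (take t (v @ [b]))"
      using assms s'(1) unfolding covered_def by simp
    then have "universal_test (nat_bits s) n t (v @ [b])"
      using universal_test_cong[of t "nat_bits s'" "nat_bits s"] s'(2) universal_test_extend by blast
    then show ?thesis by (rule universal_test_mono) simp
  qed
  then show ?thesis using assms by (simp add: covered_def)
qed

lemma covered_length: "v \<in> covered L n t \<Longrightarrow> length v = t"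
  by (simp add: covered_def)

lemma light_sum_le:
  assumes \<rho>: "mass_distribution \<rho>" and y: "names y \<rho>" and light: "light y e m l"
  shows "(\<Sum>u | enumerated y e m l u. \<rho> u) \<le> 2 / 2 ^ m"
proof -
  let ?E = "{u. enumerated y e m l u}"
  have "(\<Sum>u\<in>?E. \<rho> u) * 2 ^ (m + l) \<le> (\<Sum>u\<in>?E. real (digits y u (m + l)) + 1)"
    unfolding sum_distrib_right using y unfolding names_def by (intro sum_mono) blast
  also have "\<dots> = real (\<Sum>u\<in>?E. digits y u (m + l)) + card ?E"
    by (simp add: sum.distrib)
  also have "\<dots> \<le> 2 ^ l + 2 ^ l"
  proof (rule add_mono)
    show "real (\<Sum>u\<in>?E. digits y u (m + l)) \<le> 2 ^ l"
      using light unfolding light_def by (metis of_nat_le_iff of_nat_numeral of_nat_power)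
    have "card ?E \<le> card {w :: bool list. length w = l}"
      by (intro card_mono finite_length) (auto simp: enumerated_def)
    then show "real (card ?E) \<le> 2 ^ l" unfolding card_length by (metis of_nat_le_iff of_nat_numeral of_nat_power)
  qed
  finally show ?thesis by (simp add: power_add field_simps)
qed

lemma sum_UN_le:
  fixes f :: "'a \<Rightarrow> real" and t :: nat
  assumes "\<And>e. finite (E e)" "\<And>v. 0 \<le> f v"
  shows "(\<Sum>v\<in>(\<Union>e<t. E e). f v) \<le> (\<Sum>e<t. \<Sum>v\<in>E e. f v)"
proof (induction t)
  case (Suc t)
  have "(\<Sum>v\<in>(\<Union>e<Suc t. E e). f v) \<le> (\<Sum>v\<in>(\<Union>e<t. E e). f v) + (\<Sum>v\<in>E t. f v)"
    using assms by (simp add: lessThan_Suc Un_commute[of "E t"] sum_Un sum_nonneg)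
  then show ?case using Suc by simp
qed simp

lemma universal_test_sum_le:
  assumes \<rho>: "mass_distribution \<rho>" "\<rho> [] = 1" and y: "names y \<rho>"
  shows "(\<Sum>v | length v = t \<and> universal_test y n t v. \<rho> v) \<le> 1 / 2 ^ n"
proof -
  define E where "E e = {v. length v = t \<and> (\<exists>l\<le>t. light y e (n + e + 2) l \<and> enumerated y e (n + e + 2) l (take l v))}" for e
  have nn: "0 \<le> \<rho> w" for w by (rule mass_distribution_nonneg[OF \<rho>(1)])
  have E: "(\<Sum>v\<in>E e. \<rho> v) \<le> 1 / 2 ^ n * (1 / 2) ^ Suc e" for e
  proof (cases "\<exists>l\<le>t. light y e (n + e + 2) l")
    case False
    then have "E e = {}" by (auto simp: E_def)
    then show ?thesis by simp
  next
    case True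
    let ?m = "n + e + 2"
    \<comment> \<open>For fixed \<open>e\<close> the enumerated sets grow with the level, so the
      greatest light level contains whatever was accepted at the smaller ones and one bound
      suffices.\<close>
    define l where "l = (GREATEST l. l \<le> t \<and> light y e ?m l)"
    have l: "l \<le> t" "light y e ?m l"
      using GreatestI_ex_nat[of "\<lambda>l. l \<le> t \<and> light y e ?m l" t] True unfolding l_def by blast+
    have lmax: "l' \<le> l" if "l' \<le> t" "light y e ?m l'" for l'
      unfolding l_def using that by (intro Greatest_le_nat[of _ _ t]) auto
    have "E e \<subseteq> {v. length v = t \<and> enumerated y e ?m l (take l v)}"
    proof
      fix v assume "v \<in> E e"
      then obtain l' where l': "length v = t" "l' \<le> t" "light y e ?m l'" "enumerated y e ?m l' (take l' v)"
        unfolding E_def by blast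
      have "enumerated y e ?m l' (take l' (take l v))"
        using l' lmax[OF l'(2,3)] by (simp add: min_absorb1)
      then have "enumerated y e ?m (length (take l v)) (take l v)"
        using lmax[OF l'(2,3)] l(1) l'(1) by (intro enumerated_mono) auto
      then show "v \<in> {v. length v = t \<and> enumerated y e ?m l (take l v)}" using l'(1) l(1) by simp
    qed
    then have "(\<Sum>v\<in>E e. \<rho> v) \<le> (\<Sum>v | length v = t \<and> enumerated y e ?m l (take l v). \<rho> v)"
      using nn by (intro sum_mono2 finite_subset[OF _ finite_length[of t]]) auto
    also have "\<dots> = (\<Sum>u | enumerated y e ?m l u. \<rho> u)"
      by (rule mass_distribution_sum_extensions[OF \<rho>(1) _ l(1)]) (rule length_enumerated)
    also have "\<dots> \<le> 2 / 2 ^ ?m" by (rule light_sum_le[OF \<rho>(1) y l(2)])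
    also have "\<dots> = 1 / 2 ^ n * (1 / 2) ^ Suc e" by (simp add: power_add power_one_over field_simps)
    finally show ?thesis .
  qed
  have "finite (E e)" for e unfolding E_def by (rule finite_subset[OF _ finite_length[of t]]) auto
  have "(\<Sum>v | length v = t \<and> universal_test y n t v. \<rho> v) \<le> (\<Sum>v\<in>(\<Union>e<t. E e). \<rho> v)"
    using nn \<open>\<And>e. finite (E e)\<close> by (intro sum_mono2) (auto simp: universal_test_def E_def)
  also have "\<dots> \<le> (\<Sum>e<t. \<Sum>v\<in>E e. \<rho> v)"
    using nn \<open>\<And>e. finite (E e)\<close> by (intro sum_UN_le)
  also have "\<dots> \<le> (\<Sum>e<t. 1 / 2 ^ n * (1 / 2) ^ Suc e)" by (rule sum_mono) (rule E)
  also have "\<dots> = 1 / 2 ^ n * (\<Sum>e<t. (1 / 2) ^ Suc e)" by (rule sum_distrib_left[symmetric])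
  also have "\<dots> \<le> 1 / 2 ^ n * 1"
  proof (rule mult_left_mono)
    have "(\<Sum>e<t. (1 / 2 :: real) ^ Suc e) = 1 - (1 / 2) ^ t" by (induction t) (auto simp: field_simps)
    then show "(\<Sum>e<t. (1 / 2 :: real) ^ Suc e) \<le> 1" by simp
  qed simp
  finally show ?thesis by simp
qed

text \<open>A name of \<open>\<rho>\<close> is never refuted, so \<open>covered\<close> lies inside
  the trimmed test of that name. One set is thereby small for all measures below the capacity at
  once.\<close>

lemma covered_sum_le:
  assumes \<rho>: "mass_distribution \<rho>" "\<rho> [] = 1" "\<And>w. \<rho> w \<le> 1 / 2 ^ L w"
  shows "(\<Sum>v\<in>covered L n t. \<rho> v) \<le> 1 / 2 ^ n"
proof -
  have "\<rho> w \<le> 1" for w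
    using \<rho>(3)[of w] by (rule order_trans) (simp add: field_simps)
  then obtain y where y: "names y \<rho>"
    using ex_names_of[of \<rho>] mass_distribution_nonneg[OF \<rho>(1)] by blast
  obtain s where s: "s < 2 ^ t" "\<forall>i<t. nat_bits s i = y i" using ex_nat_bits by blast
  have "bounded_name L (nat_bits s) t"
    using mass_distribution_bounded_name[OF \<rho> y, of t] bounded_name_cong[of t "nat_bits s" y L] s(2) by simp
  then have "covered L n t \<subseteq> {v. length v = t \<and> universal_test y n t v}"
    using universal_test_cong[of t "nat_bits s" y n] s by (auto simp: covered_def)
  then have "(\<Sum>v\<in>covered L n t. \<rho> v) \<le> (\<Sum>v | length v = t \<and> universal_test y n t v. \<rho> v)"
    using mass_distribution_nonneg[OF \<rho>(1)] by (intro sum_mono2 finite_subset[OF _ finite_length[of t]]) auto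
  also have "\<dots> \<le> 1 / 2 ^ n" by (rule universal_test_sum_le[OF \<rho>(1,2) y])
  finally show ?thesis .
qed

lemma NCR_universal_test:
  assumes S: "S \<in> NCR" and L: "\<And>X c. \<exists>n. c \<le> L (initial_segment X n)"
    and y: "\<And>t. bounded_name L y t"
  shows "\<exists>t. universal_test y n t (initial_segment S t)"
proof -
  obtain \<rho> where \<rho>: "names y \<rho>" by (rule ex_names)
  note \<rho>' = bounded_name_mass_distribution[OF \<rho> y]
  obtain \<mu> where m: "cantor_prob_measure \<mu>" "\<And>w. measure \<mu> (cylinder w) = \<rho> w"
    using mass_distribution_measure[OF \<rho>'(1,2)] by blast
  interpret cantor_measure \<mu> by unfold_locales (rule m(1))
  have "measure \<mu> {X} = 0" for X
  proof -
    have "measure \<mu> {X} \<le> 0 + 1 / 2 ^ c" for c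
    proof -
      obtain n where "c \<le> L (initial_segment X n)" using L by blast
      have "measure \<mu> {X} \<le> measure \<mu> (cylinder (initial_segment X n))"
        by (rule finite_measure_mono) (auto simp: initial_segment_in_cylinder)
      also have "\<dots> \<le> 1 / 2 ^ L (initial_segment X n)" unfolding m(2) by (rule \<rho>'(3))
      also have "\<dots> \<le> 1 / 2 ^ c" using \<open>c \<le> _\<close> by (simp add: divide_left_mono power_increasing)
      finally show ?thesis by simp
    qed
    then show ?thesis using le_if_le_plus_small[of "measure \<mu> {X}" 0 1] by (simp add: order_antisym)
  qed
  then have "continuous_measure \<mu>" by (simp add: continuous_measure_def)
  then have "\<not> random_for \<mu> S" using S m(1) unfolding NCR_def by blast
  moreover have "represents (name_oracle y) \<mu>"
    by (rule name_oracle_represents) (simp add: m(2) \<rho>)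
  ultimately have "\<exists>W. Martin_Loef_test \<mu> (name_oracle y) W \<and> S \<in> (\<Inter>n. W n)"
    unfolding random_for_def not_ex de_Morgan_conj not_all not_imp not_not by (elim allE[of _ "name_oracle y"]) simp
  then obtain W where W: "Martin_Loef_test \<mu> (name_oracle y) W" "\<And>n. S \<in> W n" by auto
  then obtain p where p: "\<And>n. W n = (\<Union>w\<in>{w. \<exists>z. computes (name_oracle y) p [n, str_code w] z}. cylinder w)"
    unfolding Martin_Loef_test_def uniformly_Sigma01_def by blast
  have meas: "measure \<mu> (W n) \<le> 1 / 2 ^ n" for n using W(1) by (simp add: Martin_Loef_test_def)
  define e where "e = pcode p"
  \<comment> \<open>The class of the test that \<open>universal_test\<close> consults at level
    \<open>n\<close> for the program with code \<open>e\<close>.\<close>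
  define k where "k = n + e + 2"
  obtain w z where w: "S \<in> cylinder w" "computes (name_oracle y) p [k, str_code w] z"
    using W(2)[of k] unfolding p by blast
  obtain t js where js: "certificate (name_oracle y) t js" "jcode (pcode p) (list_encode [k, str_code w]) z \<in> set js"
    using computes_certified[OF w(2)] unfolding certified_def by blast
  \<comment> \<open>Long enough to hold the query bound, the string and the code of the certificate
    at the same time.\<close>
  define l where "l = Suc (t + length w + list_encode js)"
  have "enumerated y e k l (initial_segment S l)"
    unfolding enumerated_def
  proof (intro conjI exI bexI)
    show "certificate (name_oracle y) l (list_decode (list_encode js))"
      using certificate_mono[OF js(1), of l] by (simp add: l_def)
    show "jcode (pcode p) (list_encode [k, str_code w]) z \<in> set (list_decode (list_encode js))" using js(2) by simp
    show "length w \<le> l" "list_encode js < l" by (simp_all add: l_def)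
    have "take (length w) (initial_segment S l) = w"
      using w(1) by (simp add: take_initial_segment min_absorb1 l_def cylinder_def)
    then show "jin (jcode (pcode p) (list_encode [k, str_code w]) z) = list_encode [k, str_code (take (length w) (initial_segment S l))]"
      by simp
  qed (simp_all add: e_def)
  \<comment> \<open>A genuine test is never trimmed: by soundness of certificates the enumerated
    cylinders lie in \<open>W k\<close>, and rounding down only lowers the sum.\<close>
  moreover have "light y e k l"
  proof -
    let ?E = "{u. enumerated y e k l u}"
    have sub: "(\<Union>u\<in>?E. cylinder u) \<subseteq> W k"
    proof (rule UN_least)
      fix u assume "u \<in> ?E"
      then obtain j c a where a: "certificate (name_oracle y) l (list_decode c)" "a \<in> set (list_decode c)"
        "jprog a = pcode p" "jin a = list_encode [k, str_code (take j u)]"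
        unfolding enumerated_def e_def by blast
      then have "jcode (pcode p) (list_encode [k, str_code (take j u)]) (jout a) \<in> set (list_decode c)"
        by (metis jcode_collapse)
      then have "computes (name_oracle y) p [k, str_code (take j u)] (jout a)"
        by (rule certificate_sound[OF a(1)])
      then have "cylinder (take j u) \<subseteq> W k" unfolding p by blast
      then show "cylinder u \<subseteq> W k" using cylinder_take by blast
    qed
    have "W k \<in> sets \<mu>" unfolding p
      by (intro sets.countable_UN'') auto
    have "real (\<Sum>u\<in>?E. digits y u (k + l)) \<le> (\<Sum>u\<in>?E. \<rho> u * 2 ^ (k + l))"
      unfolding of_nat_sum using \<rho> unfolding names_def by (intro sum_mono) blast
    also have "\<dots> = measure \<mu> (\<Union>u\<in>?E. cylinder u) * 2 ^ (k + l)"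
      by (subst measure_cylinder_union[of _ l]) (auto simp: m(2) sum_distrib_right length_enumerated)
    also have "\<dots> \<le> 1 / 2 ^ k * 2 ^ (k + l)"
      using finite_measure_mono[OF sub \<open>W k \<in> sets \<mu>\<close>] meas[of k] by (intro mult_right_mono) auto
    also have "\<dots> = 2 ^ l" by (simp add: power_add)
    finally have "real (\<Sum>u\<in>?E. digits y u (k + l)) \<le> real (2 ^ l)" by simp
    then show ?thesis unfolding light_def by (simp only: of_nat_le_iff)
  qed
  moreover define t' where "t' = Suc (e + l + prod_encode (2 ^ Suc l, k + l))"
  moreover have "take l (initial_segment S t') = initial_segment S l"
    by (simp add: take_initial_segment t'_def min_absorb1)
  ultimately have "universal_test y n t' (initial_segment S t')"
    unfolding universal_test_def by (intro exI[of _ e] exI[of _ l] conjI) (simp_all add: k_def)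
  then show ?thesis by blast
qed

text \<open>Each name captures \<open>S\<close> at some stage of its own; compactness turns this
  into one stage for all names. If no stage worked, the prefixes that fail would converge to a
  single name whose test misses \<open>S\<close>.\<close>

lemma NCR_covered:
  assumes S: "S \<in> NCR" and L: "\<And>X c. \<exists>n. c \<le> L (initial_segment X n)"
  shows "\<exists>t. initial_segment S t \<in> covered L n t"
proof (rule ccontr)
  assume none: "\<not> ?thesis"
  have "\<exists>y. \<forall>t. bounded_name L y t \<and> \<not> universal_test y n t (initial_segment S t)"
  proof (rule koenig)
    fix y y' :: "nat \<Rightarrow> bool" and t assume "\<forall>i<t. y i = y' i"
    then show "bounded_name L y t \<and> \<not> universal_test y n t (initial_segment S t) \<Longrightarrow>
        bounded_name L y' t \<and> \<not> universal_test y' n t (initial_segment S t)"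
      using bounded_name_cong[of t y y'] universal_test_cong[of t y y'] by simp
  next
    fix y :: "nat \<Rightarrow> bool" and t t' :: nat
    assume *: "bounded_name L y t' \<and> \<not> universal_test y n t' (initial_segment S t')" and "t \<le> t'"
    have "universal_test y n t' (initial_segment S t')" if "universal_test y n t (initial_segment S t)"
      using universal_test_extend[of y n t t "initial_segment S t'"] universal_test_mono that \<open>t \<le> t'\<close>
      by (simp add: take_initial_segment min_absorb1)
    then show "bounded_name L y t \<and> \<not> universal_test y n t (initial_segment S t)"
      using * bounded_name_antimono[OF _ \<open>t \<le> t'\<close>] by blast
  next
    fix t show "\<exists>y. bounded_name L y t \<and> \<not> universal_test y n t (initial_segment S t)"
      using none unfolding covered_def by (auto simp: not_all)
  qed
  then show False using NCR_universal_test[OF S L] by blast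
qed

section \<open>Computability of the universal test and its cuts\<close>

lemma int_encode_int [simp]: "int_encode (int n) = 2 * n"
  by (simp add: int_encode_def sum_encode_def)

text \<open>The reduced denominator of \<open>a / b\<close> is the least positive \<open>d\<close>
  with \<open>b\<close> dividing \<open>a * d\<close>, so reduction becomes a search. The leading 2
  comes from the coding of nonnegative integers.\<close>

lemma rat_code_fraction:
  assumes "0 < b"
  shows "rat_code (of_nat a / of_nat b) =
    prod_encode (2 * (a * (LEAST d. 0 < d \<and> a * d mod b = 0) div b), LEAST d. 0 < d \<and> a * d mod b = 0)"
proof -
  let ?r = "of_nat a / of_nat b :: rat"
  obtain p' q' where pq: "quotient_of ?r = (p', q')" by fastforce
  have q'_pos: "0 < q'" by (rule quotient_of_denom_pos[OF pq])
  have r: "?r = of_int p' / of_int q'" by (rule quotient_of_div[OF pq])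
  have "0 \<le> p'"
  proof (rule ccontr)
    assume "\<not> 0 \<le> p'"
    then have "of_int p' / of_int q' < (0 :: rat)" using q'_pos by (simp add: divide_neg_pos)
    moreover have "0 \<le> ?r" by simp
    ultimately show False using r by simp
  qed
  then obtain p q where p: "p' = int p" and q: "q' = int q" using q'_pos by (metis nonneg_int_cases order_less_imp_le)
  have cop: "coprime p q" using quotient_of_coprime[OF pq] by (simp add: p q)
  have q0: "0 < q" using q'_pos q by simp
  have "of_nat a * of_nat q = (of_nat p * of_nat b :: rat)"
    using r assms q0 by (simp add: p q field_simps)
  then have eq: "a * q = p * b" by (metis of_nat_eq_iff of_nat_mult)
  have dvd: "a * d mod b = 0 \<longleftrightarrow> q dvd d" for d
  proof -
    have "b dvd a * d \<longleftrightarrow> b * q dvd (a * d) * q" using q0 by simp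
    also have "(a * d) * q = b * (p * d)" using eq by (simp add: mult_ac)
    also have "b * q dvd b * (p * d) \<longleftrightarrow> q dvd p * d" using assms by simp
    also have "\<dots> \<longleftrightarrow> q dvd d" using cop by (simp add: coprime_commute coprime_dvd_mult_right_iff)
    finally show ?thesis by (simp add: dvd_eq_mod_eq_0)
  qed
  have least: "(LEAST d. 0 < d \<and> a * d mod b = 0) = q"
    unfolding dvd by (rule Least_equality) (auto simp: q0 dvd_imp_le)
  have "a * q div b = p" using eq assms by simp
  then show ?thesis unfolding least rat_code_def pq by (simp add: p q)
qed

lemma rc_rat_code [rc_intros]:
  assumes "rc D K f" "rc D K g" "\<And>A c. A \<in> D \<Longrightarrow> 0 < g A c"
  shows "rc D K (\<lambda>A c. rat_code (of_nat (f A c) / of_nat (g A c)))"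
proof -
  \<comment> \<open>The disjunct \<open>b = 0\<close> makes the search total on bare variables,
    before the positive denominator is substituted.\<close>
  define den where "den a b = (LEAST d. 0 < d \<and> (b = 0 \<or> a * d mod b = 0))" for a b :: nat
  have base: "rc D (push (push emp)) (\<lambda>A c. LEAST d. 0 < d \<and> (snd c = 0 \<or> snd (fst c) * d mod snd c = 0))"
  proof (rule rc_Least)
    show "\<exists>d. 0 < d \<and> (snd c = 0 \<or> snd (fst c) * d mod snd c = 0)" for c :: "(unit \<times> nat) \<times> nat"
      by (rule exI[of _ "if snd c = 0 then 1 else snd c"]) simp
  qed (intro rc_intros)
  have den [rc_intros]: "rc D K (\<lambda>A c. den (f A c) (g A c))"
    unfolding den_def by (rule rc_subst2[where h = "\<lambda>A a b. LEAST d. 0 < d \<and> (b = 0 \<or> a * d mod b = 0)", OF base assms(1,2)])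
  have "rc D K (\<lambda>A c. prod_encode (2 * (f A c * den (f A c) (g A c) div g A c), den (f A c) (g A c)))"
    by (intro rc_intros assms)
  moreover have "rat_code (of_nat (f A c) / of_nat (g A c)) =
      prod_encode (2 * (f A c * den (f A c) (g A c) div g A c), den (f A c) (g A c))" if "A \<in> D" for A c
    using assms(3)[OF that, of c] by (simp add: rat_code_fraction den_def)
  ultimately show ?thesis unfolding rc_def by metis
qed

lemma rc_digits [rc_intros]:
  assumes "rc D K s" "rc D K x" "rc D K k"
  shows "rc D K (\<lambda>A c. digits (nat_bits (s A c)) (str (x A c)) (k A c))"
proof -
  have "rc D (push (push (push emp))) (\<lambda>A c. digits (nat_bits (snd (fst (fst c)))) (str (snd (fst c))) (snd c))"
    unfolding digits_def nat_bits_def str_code_str by (intro rc_intros)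
  from rc_subst3[where h = "\<lambda>A s x k. digits (nat_bits s) (str x) k", OF this assms] show ?thesis .
qed

lemma rc_name_oracle:
  "rc D (push (push emp)) (\<lambda>A c. name_oracle (nat_bits (snd (fst c))) (snd c))"
  unfolding name_oracle_def by (intro rc_intros) simp

lemma decid_certificate [rc_intros]:
  assumes "rc D K s" "rc D K t" "rc D K x"
  shows "decid D K (\<lambda>A c. certificate (name_oracle (nat_bits (s A c))) (t A c) (list_decode (x A c)))"
proof -
  have eq: "certificate B t (list_decode x) \<longleftrightarrow> (\<forall>i<length (list_decode x).
      justified B t (set (list_decode (list_encode (drop (Suc i) (list_decode x))))) (nthd (list_decode x) i))" for B t x
    by (simp add: certificate_nth)
  have "decid D (push (push (push emp))) (\<lambda>A c. certificate (name_oracle (nat_bits (snd (fst (fst c))))) (snd (fst c)) (list_decode (snd c)))"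
    unfolding eq by (intro rc_intros rc_justified[OF rc_name_oracle])
  from rc_subst3[where h = "\<lambda>A s t x. of_bool (certificate (name_oracle (nat_bits s)) t (list_decode x))", OF this[unfolded decid_def] assms]
  show ?thesis unfolding decid_def .
qed

lemma decid_enumerated [rc_intros]:
  assumes "rc D K s" "rc D K e" "rc D K m" "rc D K l" "rc D K x"
  shows "decid D K (\<lambda>A c. enumerated (nat_bits (s A c)) (e A c) (m A c) (l A c) (str (x A c)))"
proof -
  \<comment> \<open>Rewrites the list into the shape that \<open>rc_Cons\<close> recognizes, with 0
    as the code of the empty list.\<close>
  have eq: "list_encode [m, z] = list_encode (m # list_decode (list_encode (z # list_decode 0)))" for m z
    by simp
  have "decid D (push (push (push (push (push emp))))) (\<lambda>A c. enumerated (nat_bits (snd (fst (fst (fst (fst c))))))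
      (snd (fst (fst (fst c)))) (snd (fst (fst c))) (snd (fst c)) (str (snd c)))"
    unfolding enumerated_def eq by (intro rc_intros)
  from rc_subst5[where h = "\<lambda>A s e m l x. of_bool (enumerated (nat_bits s) e m l (str x))", OF this[unfolded decid_def] assms]
  show ?thesis unfolding decid_def .
qed

lemma sum_enumerated:
  fixes f :: "bool list \<Rightarrow> nat"
  shows "(\<Sum>u | enumerated y e m l u. f u) = (\<Sum>x<2 ^ Suc l. if enumerated y e m l (str x) then f (str x) else 0)"
proof -
  have "(\<Sum>x<2 ^ Suc l. if enumerated y e m l (str x) then f (str x) else 0) =
      (\<Sum>x | x < 2 ^ Suc l \<and> enumerated y e m l (str x). f (str x))"
    by (subst sum.inter_filter[symmetric]) auto
  also have "\<dots> = (\<Sum>u | enumerated y e m l u. f u)"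
  proof (rule sum.reindex_bij_witness[where i = str_code and j = str])
    fix u assume "u \<in> {u. enumerated y e m l u}"
    then show "str_code u \<in> {x. x < 2 ^ Suc l \<and> enumerated y e m l (str x)}"
      using str_code_less[of u] length_enumerated[of y e m l u] by simp
  qed auto
  finally show ?thesis ..
qed

lemma decid_light [rc_intros]:
  assumes "rc D K s" "rc D K e" "rc D K m" "rc D K l"
  shows "decid D K (\<lambda>A c. light (nat_bits (s A c)) (e A c) (m A c) (l A c))"
proof -
  have "decid D (push (push (push (push emp)))) (\<lambda>A c. light (nat_bits (snd (fst (fst (fst c)))))
      (snd (fst (fst c))) (snd (fst c)) (snd c))"
    unfolding light_def sum_enumerated by (intro rc_intros)
  from rc_subst4[where h = "\<lambda>A s e m l. of_bool (light (nat_bits s) e m l)", OF this[unfolded decid_def] assms]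
  show ?thesis unfolding decid_def .
qed

lemma decid_universal_test [rc_intros]:
  assumes "rc D K s" "rc D K n" "rc D K t" "rc D K x"
  shows "decid D K (\<lambda>A c. universal_test (nat_bits (s A c)) (n A c) (t A c) (str (x A c)))"
proof -
  have eq: "take l (str x) = str (str_code (take l (str x)))" for l x by simp
  have "decid D (push (push (push (push emp)))) (\<lambda>A c. universal_test (nat_bits (snd (fst (fst (fst c)))))
      (snd (fst (fst c))) (snd (fst c)) (str (snd c)))"
    unfolding universal_test_def by (subst eq) (intro rc_intros)
  from rc_subst4[where h = "\<lambda>A s n t x. of_bool (universal_test (nat_bits s) n t (str x))", OF this[unfolded decid_def] assms]
  show ?thesis unfolding decid_def .
qed

definition rc_level :: "(nat \<Rightarrow> nat) set \<Rightarrow> ((nat \<Rightarrow> nat) \<Rightarrow> bool list \<Rightarrow> nat) \<Rightarrow> bool" where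
  "rc_level D L \<longleftrightarrow> rc D (push emp) (\<lambda>A c. L A (str (snd c)))"

lemma rc_levelD:
  assumes "rc_level D L" "rc D K x" shows "rc D K (\<lambda>A c. L A (str (x A c)))"
  using rc_subst1[where h = "\<lambda>A x. L A (str x)", OF assms(1)[unfolded rc_level_def] assms(2)] .

lemma decid_bounded_name:
  assumes L: "rc_level D L" and "rc D K s" "rc D K t"
  shows "decid D K (\<lambda>A c. bounded_name (L A) (nat_bits (s A c)) (t A c))"
proof -
  have eq: "str x @ [b] = str (str_code (str x @ [b]))" for x b by simp
  have "decid D (push (push emp)) (\<lambda>A c. bounded_name (L A) (nat_bits (snd (fst c))) (snd c))"
    unfolding bounded_name_def name_ok_def str_code_str
    by (subst (2 3 4 5) eq) (intro rc_intros rc_levelD[OF L])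
  from rc_subst2[where h = "\<lambda>A s t. of_bool (bounded_name (L A) (nat_bits s) t)", OF this[unfolded decid_def] assms(2,3)]
  show ?thesis unfolding decid_def .
qed

lemma decid_covered:
  assumes L: "rc_level D L" and "rc D K n" "rc D K t" "rc D K x"
  shows "decid D K (\<lambda>A c. str (x A c) \<in> covered (L A) (n A c) (t A c))"
proof -
  have "decid D (push (push (push emp))) (\<lambda>A c. str (snd c) \<in> covered (L A) (snd (fst (fst c))) (snd (fst c)))"
    unfolding covered_def mem_Collect_eq by (intro rc_intros decid_bounded_name[OF L])
  from rc_subst3[where h = "\<lambda>A n t x. of_bool (str x \<in> covered (L A) n t)", OF this[unfolded decid_def] assms(2-4)]
  show ?thesis unfolding decid_def .
qed

section \<open>Minimal cuts in integer arithmetic\<close>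

primrec cut_nat_aux :: "(bool list \<Rightarrow> nat) \<Rightarrow> nat \<Rightarrow> nat \<Rightarrow> nat \<Rightarrow> bool list \<Rightarrow> nat" where
  "cut_nat_aux L n t 0 w = (if w \<in> covered L n t then 2 ^ (t - L w) else 0)"
| "cut_nat_aux L n t (Suc j) w =
     min (2 ^ (t - L w)) (cut_nat_aux L n t j (w @ [False]) + cut_nat_aux L n t j (w @ [True]))"

definition cut_nat :: "(bool list \<Rightarrow> nat) \<Rightarrow> nat \<Rightarrow> nat \<Rightarrow> bool list \<Rightarrow> nat" where
  "cut_nat L n t w = (if length w \<le> t then cut_nat_aux L n t (t - length w) w else 0)"

definition open_nat :: "(bool list \<Rightarrow> nat) \<Rightarrow> nat \<Rightarrow> nat \<Rightarrow> bool list \<Rightarrow> bool" where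
  "open_nat L n t w \<longleftrightarrow> (\<forall>k<length w. cut_nat L n t (take k w) < 2 ^ (t - L (take k w)))"

text \<open>Stage \<open>t\<close> counts in units of \<open>1 / 2 ^ t\<close>, so a frozen value
  doubles from one stage to the next.\<close>

definition mass_nat :: "(bool list \<Rightarrow> nat) \<Rightarrow> nat \<Rightarrow> nat \<Rightarrow> bool list \<Rightarrow> nat" where
  "mass_nat L n t w = rec_nat (if open_nat L n 0 w then cut_nat L n 0 w else 0)
     (\<lambda>i y. if open_nat L n (Suc i) w then cut_nat L n (Suc i) w else 2 * y) t"

text \<open>The recursion for cuts runs down a tree, so it is computed by searching for the table of all
  its values.\<close>

definition cut_table :: "(bool list \<Rightarrow> nat) \<Rightarrow> nat \<Rightarrow> nat \<Rightarrow> nat list \<Rightarrow> bool" where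
  "cut_table L n t c \<longleftrightarrow> (\<forall>x<2 ^ Suc t. length (str x) \<le> t \<longrightarrow> nthd c x =
     (if length (str x) = t then (if str x \<in> covered L n t then 2 ^ (t - L (str x)) else 0)
      else min (2 ^ (t - L (str x))) (nthd c (str_code (str x @ [False])) + nthd c (str_code (str x @ [True])))))"

lemma cut_nat_rec:
  "length w \<le> t \<Longrightarrow> cut_nat L n t w = (if length w = t then (if w \<in> covered L n t then 2 ^ (t - L w) else 0)
     else min (2 ^ (t - L w)) (cut_nat L n t (w @ [False]) + cut_nat L n t (w @ [True])))"
  by (cases "t - length w") (auto simp: cut_nat_def Suc_diff_Suc[symmetric] simp del: cut_nat_aux.simps(2)
      intro: cut_nat_aux.simps(2)[THEN trans])

lemma str_code_bound: "length w \<le> t \<Longrightarrow> str_code w < 2 ^ Suc t"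
  by (rule less_le_trans[OF str_code_less power_increasing]) auto

lemma cut_table_unique:
  assumes "cut_table L n t c" "length w \<le> t" shows "nthd c (str_code w) = cut_nat L n t w"
  using assms(2)
proof (induction "t - length w" arbitrary: w)
  case 0
  then show ?case using assms(1)[unfolded cut_table_def, rule_format, of "str_code w"] str_code_bound[of w t]
    by (simp add: cut_nat_rec)
next
  case (Suc j)
  then have "nthd c (str_code (w @ [b])) = cut_nat L n t (w @ [b])" for b by (intro Suc.hyps(1)) auto
  moreover have "length w < t" using Suc.hyps(2) by linarith
  ultimately show ?case
    using assms(1)[unfolded cut_table_def, rule_format, of "str_code w"] str_code_bound[of w t]
    by (simp add: cut_nat_rec[of w])
qed

lemma ex_cut_table: "\<exists>c. cut_table L n t c"
proof
  let ?c = "map (\<lambda>x. cut_nat L n t (str x)) [0..<2 ^ Suc t]"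
  have c: "nthd ?c (str_code w) = cut_nat L n t w" if "length w \<le> t" for w
    using str_code_bound[OF that] by (simp add: nthd_def del: power_Suc)
  show "cut_table L n t ?c"
    unfolding cut_table_def
  proof (intro allI impI)
    fix x assume "x < 2 ^ Suc t" and l: "length (str x) \<le> t"
    have "nthd ?c x = cut_nat L n t (str x)" using c[OF l] by (simp del: upt_Suc power_Suc)
    also have "\<dots> = (if length (str x) = t then (if str x \<in> covered L n t then 2 ^ (t - L (str x)) else 0)
      else min (2 ^ (t - L (str x))) (nthd ?c (str_code (str x @ [False])) + nthd ?c (str_code (str x @ [True]))))"
    proof (cases "length (str x) = t")
      case False
      then have "nthd ?c (str_code (str x @ [b])) = cut_nat L n t (str x @ [b])" for b using l by (intro c) simp
      then show ?thesis unfolding cut_nat_rec[OF l] by (simp only:)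
    qed (simp add: cut_nat_rec)
    finally show "nthd ?c x = \<dots>" .
  qed
qed

lemma rc_cut_nat:
  assumes L: "rc_level D L" and "rc D K n" "rc D K t" "rc D K x"
  shows "rc D K (\<lambda>A c. cut_nat (L A) (n A c) (t A c) (str (x A c)))"
proof -
  have ex: "\<exists>c. cut_table L n t (list_decode c)" for L n t
    using ex_cut_table[of L n t] list_encode_inverse by metis
  have eq: "cut_nat L n t (str x) = (if length (str x) \<le> t
      then nthd (list_decode (LEAST c. cut_table L n t (list_decode c))) x else 0)" for L n t x
    using cut_table_unique[OF LeastI_ex[OF ex[of L n t]], of "str x"] by (simp add: cut_nat_def)
  have "rc D (push (push emp)) (\<lambda>A c. LEAST z. cut_table (L A) (snd (fst c)) (snd c) (list_decode z))"
  proof (rule rc_Least)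
    show "decid D (push (push (push emp))) (\<lambda>A c. cut_table (L A) (snd (fst (fst c))) (snd (fst c)) (list_decode (snd c)))"
      unfolding cut_table_def by (intro rc_intros rc_levelD[OF L] decid_covered[OF L])
  qed (rule ex)
  note tab = rc_subst2[where h = "\<lambda>A n t. LEAST z. cut_table (L A) n t (list_decode z)", OF this]
  have "rc D (push (push (push emp))) (\<lambda>A c. cut_nat (L A) (snd (fst (fst c))) (snd (fst c)) (str (snd c)))"
    unfolding eq by (intro rc_intros tab)
  from rc_subst3[where h = "\<lambda>A n t x. cut_nat (L A) n t (str x)", OF this assms(2-4)] show ?thesis .
qed

lemma decid_open_nat:
  assumes L: "rc_level D L" and "rc D K n" "rc D K t" "rc D K x"
  shows "decid D K (\<lambda>A c. open_nat (L A) (n A c) (t A c) (str (x A c)))"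
proof -
  have eq: "take k (str x) = str (str_code (take k (str x)))" for k x by simp
  have "decid D (push (push (push emp))) (\<lambda>A c. open_nat (L A) (snd (fst (fst c))) (snd (fst c)) (str (snd c)))"
    unfolding open_nat_def by (subst (1 2) eq) (intro rc_intros rc_levelD[OF L] rc_cut_nat[OF L])
  from rc_subst3[where h = "\<lambda>A n t x. of_bool (open_nat (L A) n t (str x))", OF this[unfolded decid_def] assms(2-4)]
  show ?thesis unfolding decid_def .
qed

lemma rc_mass_nat:
  assumes L: "rc_level D L" and "rc D K n" "rc D K t" "rc D K x"
  shows "rc D K (\<lambda>A c. mass_nat (L A) (n A c) (t A c) (str (x A c)))"
proof -
  have "rc D (push (push (push emp))) (\<lambda>A c. mass_nat (L A) (snd (fst (fst c))) (snd (fst c)) (str (snd c)))"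
    unfolding mass_nat_def by (intro rc_rec rc_intros rc_cut_nat[OF L] decid_open_nat[OF L])
  from rc_subst3[where h = "\<lambda>A n t x. mass_nat (L A) n t (str x)", OF this assms(2-4)] show ?thesis .
qed

section \<open>Capacities that are powers of 1/2\<close>

locale level =
  fixes L :: "bool list \<Rightarrow> nat"
  assumes L_Nil: "L [] = 0"
    and L_le: "L w \<le> L (w @ [b])"
    and L_snoc: "L (w @ [b]) \<le> Suc (L w)"
begin

definition capacity :: "bool list \<Rightarrow> real" where
  "capacity w = 1 / 2 ^ L w"

lemma capacity_pos: "0 < capacity w"
  by (simp add: capacity_def)

lemma L_le_length: "L w \<le> length w"
  by (induction w rule: rev_induct) (auto simp: L_Nil intro: order_trans[OF L_snoc])

text \<open>By \<open>L_snoc\<close> one more bit at most halves the capacity, whence subadditivity.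
  For odds this is the place where the bound 2 enters.\<close>

lemma growing_cuts: "growing_cuts capacity (covered L n)"
proof
  show "capacity w \<le> capacity (w @ [False]) + capacity (w @ [True])" for w
  proof -
    have "capacity w / 2 \<le> capacity (w @ [b])" for b
      using power_increasing[OF L_snoc[of w b], of "2 :: real"] by (simp add: capacity_def field_simps)
    from this[of False] this[of True] show ?thesis by linarith
  qed
  show "capacity [] = 1" by (simp add: capacity_def L_Nil)
qed (use capacity_pos in \<open>auto intro: less_imp_le covered_length covered_snoc\<close>)

sublocale cuts: growing_cuts capacity "covered L n" for n
  by (rule growing_cuts)

text \<open>Exact because \<open>L w \<le> length w \<le> t\<close>, so that the subtraction
  \<open>t - L w\<close> is not truncated.\<close>

lemma real_power_capacity: "length w \<le> t \<Longrightarrow> real (2 ^ (t - L w)) = 2 ^ t * capacity w"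
  using L_le_length[of w] power_add[of "2 :: real" "t - L w" "L w"] by (simp add: capacity_def field_simps)

lemma real_cut_nat_aux: "length w + j = t \<Longrightarrow> real (cut_nat_aux L n t j w) = 2 ^ t * cuts.cut_aux n t j w"
proof (induction j arbitrary: w)
  case 0 then show ?case using real_power_capacity[of w t] by simp
next
  case (Suc j)
  then have "real (cut_nat_aux L n t j (w @ [b])) = 2 ^ t * cuts.cut_aux n t j (w @ [b])" for b
    by (intro Suc.IH) simp
  then show ?case using real_power_capacity[of w t] Suc.prems
    by (simp add: of_nat_min min_mult_distrib_left distrib_left del: of_nat_power)
qed

lemma real_cut_nat: "real (cut_nat L n t w) = 2 ^ t * cuts.cut n t w"
  by (simp add: cut_nat_def cuts.cut_def real_cut_nat_aux)

lemma open_nat: "open_nat L n t w \<longleftrightarrow> cuts.open_path n t w"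
proof -
  have "cut_nat L n t w < 2 ^ (t - L w) \<longleftrightarrow> cuts.cut n t w < capacity w" for w
  proof (cases "length w \<le> t")
    case True
    have "cut_nat L n t w < 2 ^ (t - L w) \<longleftrightarrow> real (cut_nat L n t w) < real (2 ^ (t - L w))"
      by (simp only: of_nat_less_iff)
    then show ?thesis by (simp only: real_cut_nat real_power_capacity[OF True]) simp
  next
    case False
    then show ?thesis using capacity_pos by (simp add: cut_nat_def cuts.cut_def)
  qed
  then show ?thesis by (simp add: open_nat_def cuts.open_path_def)
qed

lemma real_mass_nat: "real (mass_nat L n t w) = 2 ^ t * cuts.mass n t w"
  by (induction t) (simp_all add: mass_nat_def open_nat real_cut_nat)

text \<open>The flow attaining the minimal cut is a probability distribution below the capacity, and
  \<open>covered_sum_le\<close> bounds what any such distribution gives to the covered set.\<close>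

lemma cut_Nil_le: "cuts.cut n t [] \<le> 1 / 2 ^ n"
proof -
  obtain \<rho> where "mass_distribution \<rho>" "\<rho> [] = 1" "\<And>w. \<rho> w \<le> capacity w" "cuts.cut n t [] \<le> (\<Sum>v\<in>covered L n t. \<rho> v)"
    using cuts.cut_attained[of n t] by blast
  then show ?thesis using covered_sum_le[of \<rho> L n t] by (simp add: capacity_def)
qed

text \<open>The mass at level \<open>2 * n\<close> is at most \<open>1 / 2 ^ (2 * n)\<close> at the root, so that weighting it by
  \<open>2 ^ n\<close> keeps the total finite.\<close>

definition total_mass :: "nat \<Rightarrow> bool list \<Rightarrow> real" where
  "total_mass t w = (\<Sum>n<t. 2 ^ n * cuts.mass (2 * n) t w)"

lemma total_mass_nonneg: "0 \<le> total_mass t w"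
  unfolding total_mass_def by (intro sum_nonneg mult_nonneg_nonneg cuts.mass_nonneg) simp

lemma total_mass_mono: "total_mass t w \<le> total_mass (Suc t) w"
proof -
  have "total_mass t w \<le> (\<Sum>n<t. 2 ^ n * cuts.mass (2 * n) (Suc t) w)"
    unfolding total_mass_def by (intro sum_mono mult_left_mono cuts.mass_mono) simp
  also have "\<dots> \<le> total_mass (Suc t) w"
    unfolding total_mass_def using cuts.mass_nonneg[of "2 * t" "Suc t" w] by simp
  finally show ?thesis .
qed

lemma total_mass_super: "total_mass t (w @ [False]) + total_mass t (w @ [True]) \<le> total_mass t w"
  unfolding total_mass_def sum.distrib[symmetric] distrib_left[symmetric]
  by (intro sum_mono mult_left_mono cuts.mass_super) simp

lemma total_mass_le: "total_mass t w \<le> 2"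
proof -
  have "total_mass t w \<le> (\<Sum>n<t. 2 ^ n * (1 / 2 ^ (2 * n)))"
    unfolding total_mass_def
    by (intro sum_mono mult_left_mono order_trans[OF cuts.mass_le_Nil cut_Nil_le]) simp
  also have "\<dots> = (\<Sum>n<t. (1 / 2) ^ n)" by (intro sum.cong) (simp_all add: mult_2 power_add power_one_over)
  also have "\<dots> = 2 - 2 * (1 / 2) ^ t" by (induction t) (auto simp: field_simps)
  also have "\<dots> \<le> 2" by simp
  finally show ?thesis .
qed

lemma total_large:
  assumes S: "S \<in> NCR" and L: "\<And>X c. \<exists>n. c \<le> L (initial_segment X n)"
  shows "\<exists>t k. 2 ^ n * capacity (initial_segment S k) \<le> total_mass t (initial_segment S k)"
proof -
  obtain t where "initial_segment S t \<in> covered L (2 * n) t" using NCR_covered[OF S L] by blast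
  then obtain k where k: "k \<le> t" "cuts.mass (2 * n) t (take k (initial_segment S t)) = capacity (take k (initial_segment S t))"
    using cuts.mass_saturates by blast
  \<comment> \<open>Adding \<open>Suc n\<close> puts \<open>n\<close> among the indices over which
    \<open>total_mass\<close> sums; monotonicity in the stage preserves the saturated value.\<close>
  let ?w = "initial_segment S k" and ?t = "t + Suc n"
  have "capacity ?w = cuts.mass (2 * n) t ?w" using k by (simp add: take_initial_segment min_absorb1)
  also have "\<dots> \<le> cuts.mass (2 * n) ?t ?w"
    using lift_Suc_mono_le[of "\<lambda>t. cuts.mass (2 * n) t ?w", OF cuts.mass_mono] by (simp del: cuts.mass.simps)
  finally have "2 ^ n * capacity ?w \<le> 2 ^ n * cuts.mass (2 * n) ?t ?w" by simp
  also have "\<dots> \<le> total_mass ?t ?w"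
    unfolding total_mass_def using cuts.mass_nonneg by (intro member_le_sum) (auto simp del: cuts.mass.simps)
  finally show ?thesis by blast
qed

end

section \<open>Sequences in NCR have algorithmic strong measure zero\<close>

definition valid_odds :: "(bool list \<Rightarrow> rat) \<Rightarrow> bool" where
  "valid_odds b \<longleftrightarrow> (\<forall>w. b w \<in> {1..2}) \<and> acceptable (\<lambda>w. real_of_rat (b w))"

definition odds_product :: "(bool list \<Rightarrow> rat) \<Rightarrow> bool list \<Rightarrow> real" where
  "odds_product b w = (\<Prod>k<length w. real_of_rat (b (take (Suc k) w)))"

text \<open>A nonnegative integer \<open>a\<close> has code \<open>2 * a\<close>, so halving the
  first component of the code recovers a numerator. The product is kept as an unreduced
  fraction.\<close>

definition odds_num :: "(nat \<Rightarrow> nat) \<Rightarrow> bool list \<Rightarrow> nat" where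
  "odds_num A w = (\<Prod>k<length w. fst (prod_decode (A (str_code (take (Suc k) w)))) div 2)"

definition odds_den :: "(nat \<Rightarrow> nat) \<Rightarrow> bool list \<Rightarrow> nat" where
  "odds_den A w = (\<Prod>k<length w. snd (prod_decode (A (str_code (take (Suc k) w)))))"

text \<open>The integer part of the binary logarithm of the odds product.\<close>

definition log_odds :: "(nat \<Rightarrow> nat) \<Rightarrow> bool list \<Rightarrow> nat" where
  "log_odds A w = (LEAST l. odds_num A w < 2 ^ Suc l * odds_den A w)"

lemma odds_product_Nil [simp]: "odds_product b [] = 1"
  by (simp add: odds_product_def)

lemma odds_product_snoc: "odds_product b (w @ [c]) = odds_product b w * real_of_rat (b (w @ [c]))"
  by (simp add: odds_product_def)

lemma odds_product_initial_segment:
  "odds_product b (initial_segment X n) = (\<Prod>k<n. real_of_rat (b (initial_segment X (Suc k))))"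
  unfolding odds_product_def length_initial_segment
  by (intro prod.cong) (auto simp: take_initial_segment min_def)

lemma string_oracle_str_code [simp]: "string_oracle b (str_code w) = rat_code (b w)"
  by (simp add: string_oracle_def)

lemma rat_code_pos:
  assumes "0 \<le> q"
  shows "0 < snd (prod_decode (rat_code q))"
    "real_of_rat q = real (fst (prod_decode (rat_code q)) div 2) / real (snd (prod_decode (rat_code q)))"
proof -
  obtain a d where q: "quotient_of q = (a, d)" by fastforce
  have d: "0 < d" by (rule quotient_of_denom_pos[OF q])
  have qd: "q = of_int a / of_int d" by (rule quotient_of_div[OF q])
  have "0 \<le> a"
  proof (rule ccontr)
    assume "\<not> 0 \<le> a"
    then have "q < 0" unfolding qd using d by (simp add: divide_neg_pos)
    then show False using assms by simp
  qed
  then obtain a' where a: "a = int a'" using nonneg_int_cases by blast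
  show "0 < snd (prod_decode (rat_code q))"
    "real_of_rat q = real (fst (prod_decode (rat_code q)) div 2) / real (snd (prod_decode (rat_code q)))"
    using d by (simp_all add: rat_code_def q a) (simp add: qd a of_rat_divide)
qed

context
  fixes b :: "bool list \<Rightarrow> rat"
  assumes b: "valid_odds b"
begin

lemma valid_oddsD: "1 \<le> b w" "b w \<le> 2" "1 \<le> real_of_rat (b w)" "real_of_rat (b w) \<le> 2"
proof -
  show *: "1 \<le> b w" "b w \<le> 2" using b by (auto simp: valid_odds_def)
  from * show "1 \<le> real_of_rat (b w)" "real_of_rat (b w) \<le> 2"
    by (metis of_rat_1 of_rat_less_eq, metis of_rat_numeral_eq of_rat_less_eq)
qed

lemma odds_den_pos: "0 < odds_den (string_oracle b) w"
  unfolding odds_den_def string_oracle_str_code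
  by (intro prod_pos ballI rat_code_pos) (rule order_trans[OF zero_le_one valid_oddsD(1)])

lemma odds_num_den: "real (odds_num (string_oracle b) w) = odds_product b w * real (odds_den (string_oracle b) w)"
proof -
  have nn: "0 \<le> b v" for v by (rule order_trans[OF zero_le_one valid_oddsD(1)])
  have "real_of_rat (b v) * real (snd (prod_decode (rat_code (b v)))) = real (fst (prod_decode (rat_code (b v))) div 2)" for v
    using rat_code_pos[OF nn[of v]] by simp
  then show ?thesis
    unfolding odds_num_def odds_den_def odds_product_def string_oracle_str_code of_nat_prod prod.distrib[symmetric]
    by simp
qed

lemma odds_less_iff:
  "odds_num (string_oracle b) w < 2 ^ Suc l * odds_den (string_oracle b) w \<longleftrightarrow> odds_product b w < 2 ^ Suc l"
proof -
  have "odds_num (string_oracle b) w < 2 ^ Suc l * odds_den (string_oracle b) w \<longleftrightarrow>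
      real (odds_num (string_oracle b) w) < real (2 ^ Suc l * odds_den (string_oracle b) w)"
    by (simp only: of_nat_less_iff)
  also have "\<dots> \<longleftrightarrow> odds_product b w * real (odds_den (string_oracle b) w) < 2 ^ Suc l * real (odds_den (string_oracle b) w)"
    unfolding odds_num_den by simp
  also have "\<dots> \<longleftrightarrow> odds_product b w < 2 ^ Suc l" using odds_den_pos[of w] by simp
  finally show ?thesis .
qed

lemma ex_log_odds: "\<exists>l. odds_num (string_oracle b) w < 2 ^ Suc l * odds_den (string_oracle b) w"
proof -
  obtain l where "odds_product b w < 2 ^ l" using real_arch_pow[of 2 "odds_product b w"] by auto
  also have "(2 :: real) ^ l \<le> 2 ^ Suc l" by simp
  finally show ?thesis unfolding odds_less_iff by blast
qed

lemma log_odds_le_iff: "log_odds (string_oracle b) w \<le> l \<longleftrightarrow> odds_product b w < 2 ^ Suc l"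
proof
  assume "log_odds (string_oracle b) w \<le> l"
  have "odds_product b w < 2 ^ Suc (log_odds (string_oracle b) w)"
    using LeastI_ex[OF ex_log_odds[of w]] unfolding odds_less_iff[symmetric] log_odds_def .
  also have "\<dots> \<le> 2 ^ Suc l" using \<open>_ \<le> l\<close> by (intro power_increasing) auto
  finally show "odds_product b w < 2 ^ Suc l" .
next
  assume "odds_product b w < 2 ^ Suc l"
  then show "log_odds (string_oracle b) w \<le> l"
    unfolding log_odds_def odds_less_iff[symmetric] by (rule Least_le)
qed

lemma odds_product_ge1: "1 \<le> odds_product b w"
  unfolding odds_product_def by (intro prod_ge_1 valid_oddsD)

lemma two_power_log_odds: "2 ^ log_odds (string_oracle b) w \<le> odds_product b w"
proof (cases "log_odds (string_oracle b) w")
  case 0 then show ?thesis using odds_product_ge1 by simp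
next
  case (Suc l)
  then have "\<not> log_odds (string_oracle b) w \<le> l" by simp
  then have "\<not> odds_product b w < 2 ^ Suc l" using log_odds_le_iff[of w l] by blast
  then show ?thesis by (simp add: Suc)
qed

lemma level_log_odds: "level (log_odds (string_oracle b))"
proof
  show "log_odds (string_oracle b) [] = 0" using log_odds_le_iff[of "[]" 0] by simp
  fix w c
  have le: "odds_product b w \<le> odds_product b (w @ [c])" "odds_product b (w @ [c]) \<le> odds_product b w * 2"
    unfolding odds_product_snoc using valid_oddsD[of "w @ [c]"] odds_product_ge1[of w]
    by (simp_all add: mult_le_cancel_left1)
  show "log_odds (string_oracle b) w \<le> log_odds (string_oracle b) (w @ [c])"
    using le(1) log_odds_le_iff[of "w @ [c]" "log_odds (string_oracle b) (w @ [c])"]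
      log_odds_le_iff[of w "log_odds (string_oracle b) (w @ [c])"] by (meson le_less_trans order_refl)
  have "odds_product b w < 2 ^ Suc (log_odds (string_oracle b) w)" using log_odds_le_iff by blast
  then show "log_odds (string_oracle b) (w @ [c]) \<le> Suc (log_odds (string_oracle b) w)"
    using le(2) unfolding log_odds_le_iff by simp
qed

lemma log_odds_unbounded: "\<exists>n. c \<le> log_odds (string_oracle b) (initial_segment X n)"
proof -
  have "filterlim (\<lambda>n. \<Prod>k<n. real_of_rat (b (initial_segment X k))) at_top sequentially"
    using b unfolding valid_odds_def acceptable_def by blast
  then have "eventually (\<lambda>n. 2 * 2 ^ c \<le> (\<Prod>k<n. real_of_rat (b (initial_segment X k)))) sequentially"
    unfolding filterlim_at_top by blast
  then obtain N where N: "\<And>n. N \<le> n \<Longrightarrow> 2 * 2 ^ c \<le> (\<Prod>k<n. real_of_rat (b (initial_segment X k)))"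
    unfolding eventually_sequentially by blast
  \<comment> \<open>\<open>acceptable\<close> multiplies the odds from the empty string on,
    \<open>odds_product\<close> only over nonempty prefixes; the additional factor 2 pays for
    \<open>b []\<close>.\<close>
  have "2 * 2 ^ c \<le> real_of_rat (b []) * odds_product b (initial_segment X N)"
    using N[of "Suc N"] unfolding odds_product_initial_segment prod.lessThan_Suc_shift by simp
  also have "\<dots> \<le> 2 * odds_product b (initial_segment X N)"
    using valid_oddsD odds_product_ge1[of "initial_segment X N"] by (intro mult_right_mono) auto
  finally have "2 ^ c \<le> odds_product b (initial_segment X N)" by simp
  then have "\<not> odds_product b (initial_segment X N) < 2 ^ Suc (c - 1)" if "0 < c" using that by simp
  then show ?thesis unfolding log_odds_le_iff[symmetric]
    by (cases "c = 0") (auto intro!: exI[of _ N])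
qed

end

definition odds_oracles :: "(nat \<Rightarrow> nat) set" where
  "odds_oracles = {string_oracle b |b. valid_odds b}"

lemma rc_odds [rc_intros]:
  assumes "rc D K x"
  shows "rc D K (\<lambda>A c. odds_num A (str (x A c)))" "rc D K (\<lambda>A c. odds_den A (str (x A c)))"
proof -
  have "rc D (push emp) (\<lambda>A c. odds_num A (str (snd c)))" "rc D (push emp) (\<lambda>A c. odds_den A (str (snd c)))"
    unfolding odds_num_def odds_den_def by (intro rc_intros)+
  from rc_subst1[where h = "\<lambda>A x. odds_num A (str x)", OF this(1) assms]
    rc_subst1[where h = "\<lambda>A x. odds_den A (str x)", OF this(2) assms]
  show "rc D K (\<lambda>A c. odds_num A (str (x A c)))" "rc D K (\<lambda>A c. odds_den A (str (x A c)))" .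
qed

lemma rc_level_log_odds: "rc_level odds_oracles log_odds"
  unfolding rc_level_def log_odds_def
proof (rule rc_Least)
  show "\<exists>l. odds_num A (str (snd c)) < 2 ^ Suc l * odds_den A (str (snd c))"
    if "A \<in> odds_oracles" for A and c :: "unit \<times> nat"
    using that ex_log_odds unfolding odds_oracles_def by blast
qed (intro rc_intros)

text \<open>Multiplication by the odds turns mass back into capital; the power of 2 in
  \<open>universal_den\<close> undoes the scaling of \<open>mass_nat\<close>.\<close>

definition universal_num :: "(nat \<Rightarrow> nat) \<Rightarrow> nat \<Rightarrow> bool list \<Rightarrow> nat" where
  "universal_num A t w = (\<Sum>n<t. 2 ^ n * mass_nat (log_odds A) (2 * n) t w) * odds_num A w"

definition universal_den :: "(nat \<Rightarrow> nat) \<Rightarrow> nat \<Rightarrow> bool list \<Rightarrow> nat" where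
  "universal_den A t w = 2 ^ t * odds_den A w"

definition universal_martingale :: "(nat \<Rightarrow> nat) \<Rightarrow> nat \<Rightarrow> bool list \<Rightarrow> rat" where
  "universal_martingale A t w = of_nat (universal_num A t w) / of_nat (universal_den A t w)"

lemma universal_martingale_computable:
  "\<exists>M. \<forall>b t w. valid_odds b \<longrightarrow>
     computes (string_oracle b) M [t, str_code w] (rat_code (universal_martingale (string_oracle b) t w))"
proof -
  have "rc odds_oracles (push (push emp)) (\<lambda>A c. rat_code (universal_martingale A (snd c) (str (snd (fst c)))))"
    unfolding universal_martingale_def universal_num_def universal_den_def
    by (intro rc_intros rc_mass_nat[OF rc_level_log_odds]) (auto simp: odds_oracles_def odds_den_pos)
  then obtain M where M: "\<forall>A\<in>odds_oracles. \<forall>c. computes A M (ctx_args (push (push emp)) c)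
      (rat_code (universal_martingale A (snd c) (str (snd (fst c)))))"
    unfolding rc_def by blast
  then have "computes (string_oracle b) M [t, str_code w] (rat_code (universal_martingale (string_oracle b) t w))"
    if "valid_odds b" for b t w
    using M[rule_format, of "string_oracle b" "(((), str_code w), t)"] that by (auto simp: odds_oracles_def)
  then show ?thesis by blast
qed

lemma real_universal_martingale:
  assumes b: "valid_odds b"
  shows "real_of_rat (universal_martingale (string_oracle b) t w) =
    level.total_mass (log_odds (string_oracle b)) t w * odds_product b w"
proof -
  interpret level "log_odds (string_oracle b)" by (rule level_log_odds[OF b])
  have "real (universal_num (string_oracle b) t w) =
      (2 ^ t * total_mass t w) * (odds_product b w * real (odds_den (string_oracle b) w))"
    unfolding universal_num_def of_nat_mult odds_num_den[OF b] of_nat_sum real_mass_nat total_mass_def sum_distrib_left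
    by (simp add: mult_ac)
  then show ?thesis
    unfolding universal_martingale_def universal_den_def of_rat_divide of_rat_of_nat_eq
    using odds_den_pos[OF b, of w] by simp
qed

text \<open>Finitely many values are bounded, so exceeding every bound once already means exceeding
  each bound infinitely often.\<close>

lemma succeeds_on_iff: "succeeds_on d S \<longleftrightarrow> (\<forall>C. \<exists>n. C < d (initial_segment S n))"
proof -
  have "succeeds_on d S \<longleftrightarrow> (\<forall>C. frequently (\<lambda>n. C < d (initial_segment S (Suc n))) sequentially)"
  proof -
    have "limsup (\<lambda>n. ereal (f n)) = \<infinity> \<longleftrightarrow> (\<forall>C. frequently (\<lambda>n. C < f n) sequentially)" for f :: "nat \<Rightarrow> real"
    proof
      assume inf: "limsup (\<lambda>n. ereal (f n)) = \<infinity>"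
      show "\<forall>C. frequently (\<lambda>n. C < f n) sequentially"
      proof (rule allI, rule ccontr)
        fix C assume "\<not> frequently (\<lambda>n. C < f n) sequentially"
        then have "eventually (\<lambda>n. ereal (f n) \<le> ereal C) sequentially" by (simp add: not_frequently not_less)
        then have "limsup (\<lambda>n. ereal (f n)) \<le> ereal C" by (rule Limsup_bounded)
        then show False using inf by simp
      qed
    next
      assume freq: "\<forall>C. frequently (\<lambda>n. C < f n) sequentially"
      have "ereal C \<le> limsup (\<lambda>n. ereal (f n))" for C
      proof (rule ccontr)
        assume "\<not> ?thesis"
        then have "eventually (\<lambda>n. ereal (f n) < ereal C) sequentially"
          by (intro Limsup_lessD) (simp add: not_le)
        then have "\<not> frequently (\<lambda>n. C < f n) sequentially"
          unfolding not_frequently by (rule eventually_mono) simp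
        then show False using freq by blast
      qed
      then show "limsup (\<lambda>n. ereal (f n)) = \<infinity>" by (rule ereal_top)
    qed
    then show ?thesis by (simp add: succeeds_on_def)
  qed
  also have "\<dots> \<longleftrightarrow> (\<forall>C. \<exists>n. C < d (initial_segment S n))"
  proof
    assume "\<forall>C. frequently (\<lambda>n. C < d (initial_segment S (Suc n))) sequentially"
    then show "\<forall>C. \<exists>n. C < d (initial_segment S n)" using frequently_ex by fast
  next
    assume *: "\<forall>C. \<exists>n. C < d (initial_segment S n)"
    show "\<forall>C. frequently (\<lambda>n. C < d (initial_segment S (Suc n))) sequentially"
    proof (intro allI, unfold frequently_sequentially, intro allI)
      fix C N
      obtain n where n: "max C (Max ((\<lambda>n. d (initial_segment S n)) ` {..N})) < d (initial_segment S n)"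
        using * by blast
      have "N < n"
      proof (rule ccontr)
        assume "\<not> N < n"
        then have "d (initial_segment S n) \<le> Max ((\<lambda>n. d (initial_segment S n)) ` {..N})" by (intro Max_ge) auto
        then show False using le_less_trans[OF max.cobounded2 n] by linarith
      qed
      then obtain m where "n = Suc m" "N \<le> m" by (cases n) auto
      then show "\<exists>n\<ge>N. C < d (initial_segment S (Suc n))" using le_less_trans[OF max.cobounded1 n] by blast
    qed
  qed
  finally show ?thesis .
qed

theorem NCR_imp_algorithmic_strong_measure_zero:
  assumes S: "S \<in> NCR" shows "algorithmic_strong_measure_zero S"
proof -
  obtain M where M: "\<And>b t w. valid_odds b \<Longrightarrow>
     computes (string_oracle b) M [t, str_code w] (rat_code (universal_martingale (string_oracle b) t w))"
    using universal_martingale_computable by blast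
  show ?thesis
    unfolding algorithmic_strong_measure_zero_def
  proof (intro exI[of _ M] allI impI)
    fix b :: "bool list \<Rightarrow> rat"
    assume "(\<forall>w. b w \<in> {1..2}) \<and> acceptable (\<lambda>w. real_of_rat (b w))"
    then have b: "valid_odds b" by (simp add: valid_odds_def)
    interpret level "log_odds (string_oracle b)" by (rule level_log_odds[OF b])
    define g where "g = universal_martingale (string_oracle b)"
    have g: "real_of_rat (g t w) = total_mass t w * odds_product b w" for t w
      unfolding g_def by (rule real_universal_martingale[OF b])
    have B: "1 \<le> odds_product b w" for w by (rule odds_product_ge1[OF b])
    have mono_g: "real_of_rat (g t w) \<le> real_of_rat (g (Suc t) w)" for t w
      unfolding g using B[of w] total_mass_mono by (intro mult_right_mono) auto
    have inc: "incseq (\<lambda>t. real_of_rat (g t w))" for w by (intro incseq_SucI mono_g)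
    have bound: "real_of_rat (g t w) \<le> 2 * odds_product b w" for t w
      unfolding g using B[of w] total_mass_le by (intro mult_right_mono) auto
    have "\<exists>l. (\<lambda>t. real_of_rat (g t w)) \<longlonglongrightarrow> l" for w
    proof -
      have "\<forall>t. real_of_rat (g t w) \<le> 2 * odds_product b w" by (intro allI bound)
      from incseq_convergent[OF inc this] show ?thesis by metis
    qed
    then obtain F where F: "\<And>w. (\<lambda>t. real_of_rat (g t w)) \<longlonglongrightarrow> F w" by metis
    have g_le_F: "real_of_rat (g t w) \<le> F w" for t w by (rule incseq_le[OF inc F])
    have g_nonneg: "0 \<le> real_of_rat (g t w)" for t w
      unfolding g using B[of w] total_mass_nonneg by simp
    have "supermartingale (\<lambda>w. real_of_rat (b w)) F"
      unfolding supermartingale_def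
    proof (intro conjI allI)
      show "0 \<le> F w" for w using g_nonneg g_le_F order_trans by blast
      fix w
      have "real_of_rat (g t (w @ [c])) / real_of_rat (b (w @ [c])) = total_mass t (w @ [c]) * odds_product b w" for t c
        unfolding g odds_product_snoc using valid_oddsD(3)[OF b, of "w @ [c]"] by simp
      then have "real_of_rat (g t (w @ [False])) / real_of_rat (b (w @ [False])) +
          real_of_rat (g t (w @ [True])) / real_of_rat (b (w @ [True])) \<le> real_of_rat (g t w)" for t
        unfolding g[of t w] using total_mass_super[of t w] B[of w]
        by (simp add: distrib_right[symmetric] mult_right_mono)
      moreover have "b v \<noteq> 0" for v using valid_oddsD(1)[OF b, of v] by auto
      ultimately show "F (w @ [False]) / real_of_rat (b (w @ [False])) + F (w @ [True]) / real_of_rat (b (w @ [True])) \<le> F w"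
        by (intro LIMSEQ_le[OF tendsto_add[OF tendsto_divide[OF F tendsto_const] tendsto_divide[OF F tendsto_const]] F]) auto
    qed
    moreover have "succeeds_on F S"
      unfolding succeeds_on_iff
    proof
      fix C :: real
      obtain n where n: "C < 2 ^ n" using real_arch_pow[of 2 C] by auto
      obtain t k where tk: "2 ^ n * capacity (initial_segment S k) \<le> total_mass t (initial_segment S k)"
        using total_large[OF S log_odds_unbounded[OF b]] by blast
      let ?w = "initial_segment S k"
      \<comment> \<open>The capacity is the reciprocal of the odds product rounded up, so a mass of
        \<open>2 ^ n\<close> capacities is worth at least \<open>2 ^ n\<close> in capital.\<close>
      have "1 \<le> capacity ?w * odds_product b ?w"
        using two_power_log_odds[OF b, of ?w] by (simp add: capacity_def field_simps)
      then have "2 ^ n \<le> (2 ^ n * capacity ?w) * odds_product b ?w" by simp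
      also have "\<dots> \<le> total_mass t ?w * odds_product b ?w" using tk B[of ?w] by (intro mult_right_mono) auto
      also have "\<dots> \<le> F ?w" using g_le_F unfolding g .
      finally show "\<exists>k. C < F (initial_segment S k)" using n by (intro exI[of _ k]) simp
    qed
    moreover have "mono (\<lambda>t. g t w)" for w
      using mono_g unfolding mono_iff_le_Suc by (simp add: of_rat_less_eq)
    moreover have "0 \<le> g t w" for t w using g_nonneg by simp
    ultimately show "\<exists>(g :: nat \<Rightarrow> bool list \<Rightarrow> rat) F.
        (\<forall>r x. computes (string_oracle b) M [r, str_code x] (rat_code (g r x))) \<and>
        (\<forall>r x. 0 \<le> g r x) \<and> (\<forall>x. mono (\<lambda>r. g r x)) \<and>
        (\<forall>x. (\<lambda>r. real_of_rat (g r x)) \<longlonglongrightarrow> F x) \<and>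
        supermartingale (\<lambda>w. real_of_rat (b w)) F \<and> succeeds_on F S"
      using M[OF b] F unfolding g_def by blast
  qed
qed

section \<open>Sequences of algorithmic strong measure zero are in NCR\<close>

fun subst_query :: "oracle_program \<Rightarrow> oracle_program \<Rightarrow> oracle_program" where
  "subst_query q Query = q"
| "subst_query q (Comp p ps) = Comp (subst_query q p) (map (subst_query q) ps)"
| "subst_query q (PrimRec p p') = PrimRec (subst_query q p) (subst_query q p')"
| "subst_query q (Minimize p) = Minimize (subst_query q p)"
| "subst_query q Zero = Zero"
| "subst_query q Succ = Succ"
| "subst_query q (Proj i) = Proj i"

text \<open>Transitivity of relative computability: since a name computes the odds, it can run the
  machine that expects the odds as oracle.\<close>

lemma computes_subst_query:
  assumes "computes B p xs y" and q: "\<And>x. computes A q [x] (B x)"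
  shows "computes A (subst_query q p) xs y"
  using assms(1)
proof (induction rule: computes.induct)
  case (comp xs qs ys p z)
  then show ?case by (auto simp: list_all2_map1 intro!: computes.comp elim: list_all2_mono)
qed (use q in \<open>auto intro: computes.intros\<close>)

text \<open>The precision \<open>l + 3\<close> is such that \<open>small_code r x l\<close> bounds the measure by \<open>1 / 2 ^ (l + 1)\<close> and
  holds for all measures below \<open>1 / 2 ^ (l + 3)\<close>. Odd numerator codes are those of negative numbers.\<close>

definition small_code :: "(nat \<Rightarrow> nat) \<Rightarrow> nat \<Rightarrow> nat \<Rightarrow> bool" where
  "small_code r x l \<longleftrightarrow> (let z = r (prod_encode (x, l + 3)) in
     fst (prod_decode z) mod 2 = 1 \<or> fst (prod_decode z) div 2 * 2 ^ (l + 2) \<le> snd (prod_decode z))"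

text \<open>Counts the doublings of the odds along \<open>w\<close>. The counter advances only when
  the name shows that the measure has fallen to half the current bound, which keeps the measure of
  the prefix at most \<open>1 / 2 ^ depth\<close>.\<close>

definition depth :: "(nat \<Rightarrow> nat) \<Rightarrow> bool list \<Rightarrow> nat \<Rightarrow> nat" where
  "depth r w = rec_nat 0 (\<lambda>i y. if small_code r (str_code (take (Suc i) w)) y then Suc y else y)"

definition name_odds :: "(nat \<Rightarrow> nat) \<Rightarrow> bool list \<Rightarrow> rat" where
  "name_odds r w = (if w \<noteq> [] \<and> small_code r (str_code w) (depth r w (length w - 1)) then 2 else 1)"

lemma depth_0 [simp]: "depth r w 0 = 0"
  by (simp add: depth_def)

lemma depth_Suc: "depth r w (Suc i) =
  (if small_code r (str_code (take (Suc i) w)) (depth r w i) then Suc (depth r w i) else depth r w i)"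
  by (simp add: depth_def)

lemma depth_take: "k \<le> m \<Longrightarrow> depth r (take m w) k = depth r w k"
  by (induction k) (simp_all add: depth_Suc min_def)

lemma name_odds_take:
  "k < length w \<Longrightarrow> name_odds r (take (Suc k) w) = (if small_code r (str_code (take (Suc k) w)) (depth r w k) then 2 else 1)"
proof -
  assume k: "k < length w"
  then have "length (take (Suc k) w) = Suc k" by simp
  moreover from this have "take (Suc k) w \<noteq> []" by auto
  ultimately show ?thesis using depth_take[of k "Suc k" r w] by (simp add: name_odds_def del: length_take)
qed

lemma odds_product_name_odds: "odds_product (name_odds r) w = 2 ^ depth r w (length w)"
proof -
  have "(\<Prod>i<k. real_of_rat (name_odds r (take (Suc i) w))) = 2 ^ depth r w k" if "k \<le> length w" for k
    using that by (induction k) (auto simp: depth_Suc name_odds_take)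
  then show ?thesis by (simp add: odds_product_def)
qed

lemma string_oracle_name_odds_computable:
  "\<exists>q. \<forall>x. computes r q [x] (string_oracle (name_odds r) x)"
proof -
  have small: "decid {r} K (\<lambda>A c. small_code A (f A c) (g A c))" if "rc {r} K f" "rc {r} K g" for K :: "'c ctx" and f g
    unfolding small_code_def Let_def by (intro rc_intros that)
  have depth: "rc {r} (push (push emp)) (\<lambda>A c. depth A (str (snd (fst c))) (snd c))"
    unfolding depth_def by (intro rc_rec rc_intros small)
  \<comment> \<open>The two pairs are the codes of the rationals 2 and 1: doubled numerator,
    denominator 1.\<close>
  have eq: "string_oracle (name_odds A) x =
      (if 0 < length (str x) \<and> small_code A x (depth A (str x) (length (str x) - 1))
       then prod_encode (4, 1) else prod_encode (2, 1))" for A x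
    by (simp add: string_oracle_def name_odds_def rat_code_def int_encode_def sum_encode_def)
  have "rc {r} (push emp) (\<lambda>A c. string_oracle (name_odds A) (snd c))"
    unfolding eq
    by (intro rc_intros small rc_subst2[where h = "\<lambda>A x k. depth A (str x) k", OF depth])
  then obtain q where "\<forall>A\<in>{r}. \<forall>c. computes A q (ctx_args (push emp) c) (string_oracle (name_odds A) (snd c))"
    unfolding rc_def by blast
  then have "computes r q [x] (string_oracle (name_odds r) x)" for x
    by (auto dest: spec[of _ "((), x)"])
  then show ?thesis by blast
qed

lemma small_code_rat:
  assumes "r (prod_encode (x, l + 3)) = rat_code q"
  shows "small_code r x l \<longleftrightarrow> real_of_rat q \<le> 1 / 2 ^ (l + 2)"
proof (cases "0 \<le> q")
  case True
  note rc = rat_code_pos[OF True]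
  have even: "fst (prod_decode (rat_code q)) mod 2 \<noteq> 1"
  proof -
    obtain a d where ad: "quotient_of q = (a, d)" by fastforce
    have "q = of_int a / of_int d" "0 < d" using quotient_of_div[OF ad] quotient_of_denom_pos[OF ad] by auto
    then have "0 \<le> a" using True by (simp add: zero_le_divide_iff)
    then show ?thesis using ad by (auto simp: rat_code_def int_encode_def sum_encode_def)
  qed
  let ?a = "fst (prod_decode (rat_code q)) div 2" and ?d = "snd (prod_decode (rat_code q))"
  have "small_code r x l \<longleftrightarrow> ?a * 2 ^ (l + 2) \<le> ?d"
    using even unfolding small_code_def assms by (simp add: Let_def)
  also have "\<dots> \<longleftrightarrow> real (?a * 2 ^ (l + 2)) \<le> real ?d" by (simp only: of_nat_le_iff)
  also have "\<dots> \<longleftrightarrow> real_of_rat q \<le> 1 / 2 ^ (l + 2)"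
    unfolding rc(2) using rc(1) by (simp add: field_simps)
  finally show ?thesis .
next
  case False
  obtain a d where ad: "quotient_of q = (a, d)" by fastforce
  have "q = of_int a / of_int d" "0 < d" using quotient_of_div[OF ad] quotient_of_denom_pos[OF ad] by auto
  then have "a < 0" using False by (simp add: zero_le_divide_iff)
  then have "fst (prod_decode (rat_code q)) mod 2 = 1"
    using ad by (auto simp: rat_code_def int_encode_def sum_encode_def)
  then have "small_code r x l" unfolding small_code_def assms by (simp add: Let_def)
  moreover have "real_of_rat q \<le> 0" using False by simp
  then have "real_of_rat q \<le> 1 / 2 ^ (l + 2)" by (rule order_trans) simp
  ultimately show ?thesis by blast
qed

section \<open>Odds whose capacity dominates a continuous measure\<close>

locale named_measure = cantor_measure +
  fixes r :: "nat \<Rightarrow> nat"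
  assumes r: "represents r \<mu>" and cont: "continuous_measure \<mu>"
begin

lemma small_codeD:
  assumes "small_code r (str_code w) l" shows "measure \<mu> (cylinder w) \<le> 1 / 2 ^ Suc l"
proof -
  obtain q where q: "r (prod_encode (str_code w, l + 3)) = rat_code q"
    "\<bar>real_of_rat q - measure \<mu> (cylinder w)\<bar> \<le> 1 / 2 ^ (l + 3)"
    using r unfolding represents_def by blast
  have "real_of_rat q \<le> 1 / 2 ^ (l + 2)" using assms small_code_rat[of r "str_code w" l q, OF q(1)] by blast
  then have "measure \<mu> (cylinder w) \<le> 1 / 2 ^ (l + 2) + 1 / 2 ^ (l + 3)" using q(2) by linarith
  also have "\<dots> \<le> 1 / 2 ^ Suc l" by (simp add: power_add field_simps)
  finally show ?thesis .
qed

lemma small_codeI: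
  assumes "measure \<mu> (cylinder w) \<le> 1 / 2 ^ (l + 3)" shows "small_code r (str_code w) l"
proof -
  obtain q where q: "r (prod_encode (str_code w, l + 3)) = rat_code q"
    "\<bar>real_of_rat q - measure \<mu> (cylinder w)\<bar> \<le> 1 / 2 ^ (l + 3)"
    using r unfolding represents_def by blast
  have "real_of_rat q \<le> 1 / 2 ^ (l + 3) + 1 / 2 ^ (l + 3)" using assms q(2) by linarith
  also have "\<dots> = 1 / 2 ^ (l + 2)" by (simp add: power_add)
  finally show ?thesis using small_code_rat[of r "str_code w" l q, OF q(1)] by blast
qed

lemma measure_le_odds_product: "measure \<mu> (cylinder w) \<le> 1 / odds_product (name_odds r) w"
proof -
  have "measure \<mu> (cylinder (take k w)) \<le> 1 / 2 ^ depth r w k" for k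
  proof (induction k)
    case (Suc k)
    have "measure \<mu> (cylinder (take (Suc k) w)) \<le> measure \<mu> (cylinder (take k w))"
      using cylinder_take[of "take (Suc k) w" k] by (intro finite_measure_mono) (auto simp: min_def)
    then show ?case using Suc small_codeD[of "take (Suc k) w" "depth r w k"] by (auto simp: depth_Suc)
  qed simp
  from this[of "length w"] show ?thesis by (simp add: odds_product_name_odds)
qed

text \<open>Without atoms the cylinder measures tend to 0 along \<open>X\<close>. Once they stay
  below \<open>1 / 2 ^ (c + 3)\<close>, a counter still at \<open>c\<close> advances at the next bit
  by \<open>small_codeI\<close>.\<close>

lemma depth_unbounded: "\<exists>n. c \<le> depth r (initial_segment X n) n"
proof (induction c)
  case (Suc c)
  define D where "D n = depth r (initial_segment X n) n" for n
  have D_Suc: "D (Suc n) = (if small_code r (str_code (initial_segment X (Suc n))) (D n) then Suc (D n) else D n)" for n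
    using depth_take[of n n r "initial_segment X (Suc n)"]
    by (simp add: D_def depth_Suc take_initial_segment)
  have D_mono: "n \<le> m \<Longrightarrow> D n \<le> D m" for n m by (rule lift_Suc_mono_le[of D]) (auto simp: D_Suc)
  obtain n where n: "c \<le> D n" using Suc unfolding D_def by blast
  have "(\<lambda>n. measure \<mu> (cylinder (initial_segment X n))) \<longlonglongrightarrow> 0"
    using measure_cylinder_LIMSEQ[of X] cont by (simp add: continuous_measure_def)
  then have "eventually (\<lambda>n. measure \<mu> (cylinder (initial_segment X n)) < 1 / 2 ^ (c + 3)) sequentially"
    by (rule order_tendstoD) simp
  then obtain N where N: "\<And>m. N \<le> m \<Longrightarrow> measure \<mu> (cylinder (initial_segment X m)) < 1 / 2 ^ (c + 3)"
    unfolding eventually_sequentially by blast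
  define m where "m = max n N"
  have "c \<le> D m" using n D_mono[of n m] by (simp add: m_def)
  moreover have "small_code r (str_code (initial_segment X (Suc m))) c"
    using N[of "Suc m"] by (intro small_codeI less_imp_le) (simp add: m_def)
  ultimately have "Suc c \<le> D (Suc m)" by (cases "D m = c") (auto simp: D_Suc)
  then show ?case unfolding D_def by blast
qed simp

lemma valid_name_odds: "valid_odds (name_odds r)"
proof -
  have "filterlim (\<lambda>n. \<Prod>k<n. real_of_rat (name_odds r (initial_segment X k))) at_top sequentially" (is "filterlim ?f _ _") for X
  proof -
    have ge1: "1 \<le> real_of_rat (name_odds r w)" for w by (simp add: name_odds_def)
    have mono: "incseq ?f"
    proof (rule incseq_SucI)
      fix n
      have "0 \<le> ?f n" by (intro prod_nonneg ballI order_trans[OF zero_le_one ge1])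
      then have "?f n * 1 \<le> ?f n * real_of_rat (name_odds r (initial_segment X n))" by (intro mult_left_mono ge1)
      then show "?f n \<le> ?f (Suc n)" by simp
    qed
    have f_Suc: "?f (Suc n) = 2 ^ depth r (initial_segment X n) n" for n
    proof -
      have "?f (Suc n) = odds_product (name_odds r) (initial_segment X n)"
        unfolding odds_product_initial_segment prod.lessThan_Suc_shift by (simp add: name_odds_def)
      then show ?thesis by (simp add: odds_product_name_odds)
    qed
    show ?thesis
      unfolding filterlim_at_top
    proof
      fix Z :: real
      obtain c where c: "Z < 2 ^ c" using real_arch_pow[of 2 Z] by auto
      obtain n where n: "c \<le> depth r (initial_segment X n) n" using depth_unbounded by blast
      have "(2 :: real) ^ c \<le> ?f (Suc n)" unfolding f_Suc using n by (intro power_increasing) auto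
      then have "Z \<le> ?f m" if "Suc n \<le> m" for m using c incseqD[OF mono that] by linarith
      then show "eventually (\<lambda>n. Z \<le> ?f n) sequentially" unfolding eventually_sequentially by blast
    qed
  qed
  then show ?thesis
    unfolding valid_odds_def acceptable_def odds_function_def by (auto simp: name_odds_def)
qed

text \<open>Dividing \<open>F\<close> by the odds product gives a superadditive function. Where
  \<open>F w\<close> exceeds \<open>B\<close>, this function divided by \<open>B\<close> exceeds the
  capacity at \<open>w\<close> and hence the measure of the cylinder; superadditivity carries the
  bound up to the root.\<close>

lemma ville:
  assumes F: "supermartingale (\<lambda>w. real_of_rat (name_odds r w)) F" and B: "0 < B"
  shows "measure \<mu> (\<Union>w\<in>{w. B < F w}. cylinder w) \<le> F [] / B"
proof -
  define m where "m w = F w / odds_product (name_odds r) w" for w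
  note b = valid_name_odds
  have op: "0 < odds_product (name_odds r) w" for w using odds_product_ge1[OF b, of w] by simp
  have F0: "0 \<le> F w" for w using F by (simp add: supermartingale_def)
  have m_nonneg: "0 \<le> m w" for w using F0[of w] op[of w] by (simp add: m_def)
  have m_super: "m (w @ [False]) + m (w @ [True]) \<le> m w" for w
  proof -
    have "m (w @ [c]) = F (w @ [c]) / real_of_rat (name_odds r (w @ [c])) / odds_product (name_odds r) w" for c
      by (simp add: m_def odds_product_snoc)
    then have "m (w @ [False]) + m (w @ [True]) =
      (F (w @ [False]) / real_of_rat (name_odds r (w @ [False])) + F (w @ [True]) / real_of_rat (name_odds r (w @ [True])))
        / odds_product (name_odds r) w"
      by (simp add: add_divide_distrib)
    also have "\<dots> \<le> F w / odds_product (name_odds r) w"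
      using F op[of w] unfolding supermartingale_def by (intro divide_right_mono) auto
    finally show ?thesis by (simp add: m_def)
  qed
  \<comment> \<open>The part of the set below \<open>w\<close> that shows within \<open>j\<close>
    further bits; the case \<open>B < F w\<close> stops the induction early because the whole
    cylinder is then captured.\<close>
  define G where "G j w = (\<Union>u\<in>{u. length u \<le> j \<and> B < F (w @ u)}. cylinder (w @ u))" for j :: nat and w
  have G_sets: "G j w \<in> sets \<mu>" for j w unfolding G_def by (intro sets.countable_UN'') auto
  have G_sub: "G j w \<subseteq> cylinder w" for j w
    unfolding G_def using cylinder_take[of "w @ _" "length w"] by auto
  have G_le: "measure \<mu> (G j w) \<le> m w / B" for j w
  proof (induction j arbitrary: w)
    case 0
    show ?case
    proof (cases "B < F w")
      case True
      have "measure \<mu> (G 0 w) \<le> measure \<mu> (cylinder w)" by (rule finite_measure_mono[OF G_sub]) simp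
      also have "\<dots> \<le> 1 / odds_product (name_odds r) w" by (rule measure_le_odds_product)
      also have "\<dots> \<le> m w / B" using True op[of w] B by (simp add: m_def field_simps)
      finally show ?thesis .
    next
      case False
      then have "G 0 w = {}" by (auto simp: G_def)
      then show ?thesis using m_nonneg[of w] B by simp
    qed
  next
    case (Suc j)
    show ?case
    proof (cases "B < F w")
      case True
      have "measure \<mu> (G (Suc j) w) \<le> measure \<mu> (cylinder w)" by (rule finite_measure_mono[OF G_sub]) simp
      also have "\<dots> \<le> 1 / odds_product (name_odds r) w" by (rule measure_le_odds_product)
      also have "\<dots> \<le> m w / B" using True op[of w] B by (simp add: m_def field_simps)
      finally show ?thesis .
    next
      case False
      have "G (Suc j) w \<subseteq> G j (w @ [False]) \<union> G j (w @ [True])"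
      proof
        fix X assume "X \<in> G (Suc j) w"
        then obtain u where u: "length u \<le> Suc j" "B < F (w @ u)" "X \<in> cylinder (w @ u)" unfolding G_def by blast
        then obtain c u' where "u = c # u'" using False by (cases u) auto
        then have "X \<in> G j (w @ [c])" using u by (auto simp: G_def intro!: exI[of _ u'])
        then show "X \<in> G j (w @ [False]) \<union> G j (w @ [True])" by (cases c) auto
      qed
      then have "measure \<mu> (G (Suc j) w) \<le> measure \<mu> (G j (w @ [False]) \<union> G j (w @ [True]))"
        using G_sets by (intro finite_measure_mono) auto
      also have "\<dots> \<le> measure \<mu> (G j (w @ [False])) + measure \<mu> (G j (w @ [True]))"
        by (intro measure_Un_le G_sets)
      also have "\<dots> \<le> m (w @ [False]) / B + m (w @ [True]) / B" by (intro add_mono Suc.IH)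
      also have "\<dots> \<le> m w / B" using m_super[of w] B by (simp add: divide_right_mono add_divide_distrib[symmetric])
      finally show ?thesis .
    qed
  qed
  have "(\<Union>w\<in>{w. B < F w}. cylinder w) = (\<Union>j. G j [])" by (auto simp: G_def)
  moreover have "(\<lambda>j. measure \<mu> (G j [])) \<longlonglongrightarrow> measure \<mu> (\<Union>j. G j [])"
    proof (rule finite_Lim_measure_incseq)
    show "incseq (\<lambda>j. G j [])" unfolding G_def by (intro incseq_SucI UN_mono) auto
  qed (use G_sets in auto)
  ultimately have "measure \<mu> (\<Union>w\<in>{w. B < F w}. cylinder w) \<le> m [] / B"
    using G_le by (auto intro!: LIMSEQ_le_const2)
  then show ?thesis by (simp add: m_def)
qed

lemma not_random:
  assumes "algorithmic_strong_measure_zero S"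
  shows "\<exists>W. Martin_Loef_test \<mu> r W \<and> S \<in> (\<Inter>n. W n)"
proof -
  let ?b = "name_odds r"
  obtain M where M: "\<And>b. valid_odds b \<Longrightarrow> \<exists>(g :: nat \<Rightarrow> bool list \<Rightarrow> rat) F.
           (\<forall>r x. computes (string_oracle b) M [r, str_code x] (rat_code (g r x))) \<and>
           (\<forall>r x. 0 \<le> g r x) \<and>
           (\<forall>x. mono (\<lambda>r. g r x)) \<and>
           (\<forall>x. (\<lambda>r. real_of_rat (g r x)) \<longlonglongrightarrow> F x) \<and>
           supermartingale (\<lambda>w. real_of_rat (b w)) F \<and>
           succeeds_on F S"
    using assms unfolding algorithmic_strong_measure_zero_def valid_odds_def by blast
  obtain g :: "nat \<Rightarrow> bool list \<Rightarrow> rat" and F where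
    comp: "\<And>t x. computes (string_oracle ?b) M [t, str_code x] (rat_code (g t x))" and
    g0: "\<And>t x. 0 \<le> g t x" and mono: "\<And>x. mono (\<lambda>t. g t x)" and
    lim: "\<And>x. (\<lambda>t. real_of_rat (g t x)) \<longlonglongrightarrow> F x" and
    F: "supermartingale (\<lambda>w. real_of_rat (?b w)) F" and succ: "succeeds_on F S"
    using M[OF valid_name_odds] by blast
  have inc: "incseq (\<lambda>t. real_of_rat (g t x))" for x
    using mono[of x] by (simp add: mono_def of_rat_less_eq)
  have g_le_F: "real_of_rat (g t x) \<le> F x" for t x by (rule incseq_le[OF inc lim])
  have ex_g: "\<exists>t. C < real_of_rat (g t x)" if "C < F x" for C x
    using order_tendstoD(1)[OF lim that] by (auto dest: eventually_happens)
  obtain q where q: "\<And>x. computes r q [x] (string_oracle ?b x)"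
    using string_oracle_name_odds_computable by blast
  have comp': "computes r (subst_query q M) [t, str_code x] (rat_code (g t x))" for t x
    by (rule computes_subst_query[OF comp q])
  \<comment> \<open>\<open>F []\<close> is an arbitrary real, so an integer bound for it is built
    into the program of the test as a constant.\<close>
  obtain K :: nat where K: "F [] \<le> K" "0 < K"
    using real_arch_simple[of "max (F []) 1"] by (metis max.bounded_iff of_nat_0_less_iff less_le_trans zero_less_one)
  define hit where "hit n t x \<longleftrightarrow> K * 2 ^ n * snd (prod_decode (rat_code (g t x))) < fst (prod_decode (rat_code (g t x))) div 2"
    for n t x
  have hit: "hit n t x \<longleftrightarrow> K * 2 ^ n < real_of_rat (g t x)" for n t x
  proof -
    note rc = rat_code_pos[OF g0[of t x]]
    have "hit n t x \<longleftrightarrow> real (K * 2 ^ n * snd (prod_decode (rat_code (g t x)))) < real (fst (prod_decode (rat_code (g t x))) div 2)"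
      unfolding hit_def by (simp only: of_nat_less_iff)
    then show ?thesis unfolding rc(2) using rc(1) by (simp add: field_simps)
  qed
  have "rc {r} (push (push emp)) (\<lambda>A c. rat_code (g (snd c) (str (snd (fst c)))))"
    unfolding rc_def using comp'[of _ "str _"] by (auto intro!: exI[of _ "subst_query q M"])
  from rc_subst2[where h = "\<lambda>A x t. rat_code (g t (str x))", OF this]
  have gc: "rc {r} K (\<lambda>A c. rat_code (g (t A c) (str (x A c))))" if "rc {r} K x" "rc {r} K t" for K :: "'c ctx" and t x
    using that by blast
  \<comment> \<open>\<open>Minimize\<close> looks for a zero, hence the negation; the search then
    halts exactly on the strings to be enumerated.\<close>
  have "rc {r} (push (push (push emp))) (\<lambda>A c. of_bool (\<not> hit (snd (fst c)) (snd c) (str (snd (fst (fst c))))))"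
    unfolding hit_def by (intro rc_intros gc rc_const[of _ _ K])
  then obtain p where p0: "\<forall>A\<in>{r}. \<forall>c. computes A p (ctx_args (push (push (push emp))) c)
      (of_bool (\<not> hit (snd (fst c)) (snd c) (str (snd (fst (fst c))))))"
    unfolding rc_def by blast
  then have p: "computes r p [t, n, str_code x] (of_bool (\<not> hit n t x))" for t n x
    using p0[rule_format, of r "((((), str_code x), n), t)"] by simp
  have halts: "(\<exists>y. computes r (Minimize p) [n, str_code x] y) \<longleftrightarrow> (\<exists>t. hit n t x)" for n x
  proof
    assume "\<exists>y. computes r (Minimize p) [n, str_code x] y"
    then obtain y where "computes r (Minimize p) [n, str_code x] y" by blast
    then have "computes r p [y, n, str_code x] 0" by cases
    then have "of_bool (\<not> hit n y x) = (0 :: nat)" using computes_deterministic p by blast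
    then show "\<exists>t. hit n t x" by auto
  next
    assume ex: "\<exists>t. hit n t x"
    let ?t = "LEAST t. hit n t x"
    have "computes r (Minimize p) [n, str_code x] ?t"
    proof (rule computes.minimize[where h = "\<lambda>_. 0"])
      show "computes r p [?t, n, str_code x] 0" using p[of ?t n x] LeastI_ex[OF ex] by simp
      show "computes r p [m, n, str_code x] (Suc 0)" if "m < ?t" for m
        using p[of m n x] not_less_Least[OF that] by simp
    qed
    then show "\<exists>y. computes r (Minimize p) [n, str_code x] y" by blast
  qed
  define W where "W n = (\<Union>w\<in>{w. \<exists>t. hit n t w}. cylinder w)" for n
  have "Martin_Loef_test \<mu> r W"
    unfolding Martin_Loef_test_def
  proof (intro conjI allI)
    show "uniformly_Sigma01 r W"
      unfolding uniformly_Sigma01_def by (intro exI[of _ "Minimize p"]) (simp add: W_def halts)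
    fix n
    let ?U = "\<Union>w\<in>{w. real K * 2 ^ n < F w}. cylinder w"
    have "W n \<subseteq> ?U" unfolding W_def hit using g_le_F by (auto intro: less_le_trans)
    moreover have "?U \<in> sets \<mu>" by (intro sets.countable_UN'') auto
    ultimately have "measure \<mu> (W n) \<le> measure \<mu> ?U" by (rule finite_measure_mono)
    also have "\<dots> \<le> F [] / (real K * 2 ^ n)" using K(2) by (intro ville[OF F]) simp
    also have "\<dots> \<le> real K / (real K * 2 ^ n)" using K by (intro divide_right_mono) auto
    also have "\<dots> = 1 / 2 ^ n" using K(2) by simp
    finally show "measure \<mu> (W n) \<le> 1 / 2 ^ n" .
  qed
  moreover have "S \<in> W n" for n
  proof -
    obtain k where "K * 2 ^ n < F (initial_segment S k)" using succ unfolding succeeds_on_iff by blast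
    then obtain t where "hit n t (initial_segment S k)" using ex_g hit by blast
    then show ?thesis unfolding W_def using initial_segment_in_cylinder by blast
  qed
  ultimately show ?thesis by blast
qed

end

theorem algorithmic_strong_measure_zero_imp_NCR:
  assumes "algorithmic_strong_measure_zero S" shows "S \<in> NCR"
proof (rule ccontr)
  assume "S \<notin> NCR"
  then obtain \<mu> r where *: "cantor_prob_measure \<mu>" "continuous_measure \<mu>" "represents r \<mu>"
    and random: "\<And>W. Martin_Loef_test \<mu> r W \<Longrightarrow> S \<notin> (\<Inter>n. W n)"
    unfolding NCR_def random_for_def mem_Collect_eq not_not by blast
  interpret named_measure \<mu> r by unfold_locales (fact *)+
  obtain W where "Martin_Loef_test \<mu> r W" "S \<in> (\<Inter>n. W n)" using not_random[OF assms] by blast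
  then show False using random by blast
qed

theorem mainTheorem2:
  fixes S :: "nat \<Rightarrow> bool"
  shows "algorithmic_strong_measure_zero S \<longleftrightarrow> S \<in> NCR"
  using algorithmic_strong_measure_zero_imp_NCR NCR_imp_algorithmic_strong_measure_zero by blast

end
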